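(* Fix $0<c_m<c_M$, $\varepsilon>0$ and $V>0$, and let $\mathscr{K}_V=\{c\in\mathscr{K}:\ TV(c)\le V\}$. Every $c\in\mathscr{K}$ of bounded variation satisfies the minimal amplitude hypothesis with respect to $\mathscr{A}^c_\varepsilon$, uniformly over $\mathscr{K}_V$. More precisely: (1) For every $c\in\mathscr{K}$ of bounded variation, $$\mathfrak{r}_{c,\varepsilon}^2=\inf_{y\in[0,H],\ (\mu_k,\lambda)\in\mathscr{A}^c_\varepsilon}\big[u_{\lambda,k}(y)^2+(c(y)u'_{\lambda,k}(y))^2\big]>0,$$ and $\mathfrak{r}_{V,\varepsilon}^2:=\inf_{c\in\mathscr{K}_V}\mathfrak{r}_{c,\varepsilon}^2>0.$ (2) For every nonempty interval $(a,b)\subseteq(0,H)$, $$\inf_{c\in\mathscr{K}_V,\ (\mu_k,\lambda)\in\mathscr{A}^c_\varepsilon}\int_a^b u_{\lambda,k}(y)^2\,dy>0.$$ (3) For every nonempty interval $(a,b)\subseteq(0,H)$ there exist a constant $\lambda_0$ depending only on $\varepsilon,c_m,c_M,b-a$ and a constant $\mathfrak{f}>0$ depending only on $\varepsilon,c_m,c_M,b-a,\mathfrak{r}_{V,\varepsilon}$ such that, for every $c\in\mathscr{K}_V$ and every normalized $u_{\lambda,k}$ associated with $(\mu_k,\lambda)\in\mathscr{A}^c_\varepsilon$, $$\int_a^b u_{\lambda,k}(y)^2\,dy\ge\mathfrak{f}\qquad\text{whenever }\lambda>\lambda_0.$$ (4) Let $\omega=\omega'\times(a,b)$ with $\omega'\subseteq\Omega'$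 nonempty and open and $(a,b)\subseteq(0,H)$ nonempty. If $\omega'\ne\Omega'$, assume that the family $\{\phi_k\}_{k=1}^\infty$ does not concentrate in $\Omega'\setminus\omega'$, i.e. $\liminf_{k\to\infty}\|\phi_k\|^2_{L^2(\omega')}/\|\phi_k\|^2_{L^2(\Omega')}>0$. Then there exists a constant $\mathfrak{g}>0$ such that every eigenfunction $v_\lambda(x',y)=u_{\lambda,k}(y)\phi_k(x')$ satisfies $$\mathfrak{g}\le\frac{\|v_\lambda\|_{L^2(\omega)}}{\|v_\lambda\|_{L^2(\Omega)}}\le1$$ uniformly for all $c\in\mathscr{K}_V$ and all $(\mu_k,\lambda)\in\mathscr{A}^c_\varepsilon$.
   Context: $\Omega'\subset\mathbb{R}^d$ ($d\ge1$) is a fixed bounded smooth open domain, $H>0$ is fixed, $\Omega=\Omega'\times(0,H)$ with coordinates $x=(x',y)$. ($\Omega'$ and $H$ are fixed throughout; dependence of constants on them is not tracked.) $\{(\mu_k^2,\phi_k)\}_{k\ge1}$ is the sequence of eigenvalues (nondecreasing, with multiplicity, $\mu_k>0$) and $L^2$-normalized eigenfunctions (forming an orthonormal basis of $L^2(\Omega')$) of the Dirichlet Laplacian $-\Delta_{x'}$ in $L^2(\Omega')$. $\mathscr{K}$ is the set of all $c\in L^\infty([0,H])$ with $\operatorname{ess\,inf}c=c_m$ and $\operatorname{ess\,sup}c=c_M$. $TV(c)$ is the total variation of $c$ on $[0,H]$. For $c\in\mathscr{K}$ and $k\ge1$, $$A_k=c(y)\mu_k^2-\frac{d}{dy}c(y)\frac{d}{dy}\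 \text{ in }L^2(0,H),\qquad D(A_k)=\{u\in H^1_0(0,H):\ cu'\in H^1(0,H)\},$$ is self-adjoint with simple eigenvalues $\beta_{k,1}<\beta_{k,2}<\cdots$. If $\lambda=\beta_{k,\ell}$, $u_{\lambda,k}$ denotes the (real) eigenfunction of $A_k$ for $\lambda$, normalized in $L^2(0,H)$; then $v_\lambda(x',y)=\phi_k(x')u_{\lambda,k}(y)$ is an eigenfunction for $\lambda$ of the self-adjoint Dirichlet operator $-\nabla\cdot\tilde c\,\nabla$ in $L^2(\Omega)$, $\tilde c(x',y)=c(y)$. $\mathscr{A}^c_\varepsilon=\bigcup_{k\ge1}\{(\mu_k,\lambda):\ \lambda=\beta_{k,\ell}\text{ for some }\ell\ge1,\ \lambda\ge(c_M+\varepsilon)\mu_k^2\}$. The function $c$ satisfies the minimal amplitude hypothesis with respect to $\mathscr{A}^c_\varepsilon$ if $\mathfrak{r}_{c,\varepsilon}>0$, where $\mathfrak{r}_{c,\varepsilon}\ge0$ is the quantity defined in the infimum in (1), $cu_{\lambda,k}'$ being understood as its continuous representative. *)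

theory Defs
  imports "HOL-Analysis.Analysis" "HOL-Probability.Essential_Supremum"
begin

section \<open>Smooth functions, test functions, smooth domains\<close>

definition partial_deriv :: "'a::euclidean_space \<Rightarrow> ('a \<Rightarrow> real) \<Rightarrow> 'a \<Rightarrow> real" where
  "partial_deriv i f x = frechet_derivative f (at x) i"

text \<open>Meant for open \<open>S\<close> only.\<close>

primrec Ck_on :: "nat \<Rightarrow> 'a::euclidean_space set \<Rightarrow> ('a \<Rightarrow> real) \<Rightarrow> bool" where
  "Ck_on 0 S f \<longleftrightarrow> continuous_on S f"
| "Ck_on (Suc k) S f \<longleftrightarrow>
     f differentiable_on S \<and> (\<forall>i\<in>Basis. Ck_on k S (partial_deriv i f))"

definition smooth_on :: "'a::euclidean_space set \<Rightarrow> ('a \<Rightarrow> real) \<Rightarrow> bool" where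
  "smooth_on S f \<longleftrightarrow> (\<forall>k. Ck_on k S f)"

definition test_fun :: "'a::euclidean_space set \<Rightarrow> ('a \<Rightarrow> real) \<Rightarrow> bool" where
  "test_fun U \<psi> \<longleftrightarrow> smooth_on UNIV \<psi> \<and>
     compact (closure {x. \<psi> x \<noteq> 0}) \<and> closure {x. \<psi> x \<noteq> 0} \<subseteq> U"

text \<open>A bounded domain (nonempty, open, connected) with smooth boundary: near each boundary point
  the domain is the negativity set of a smooth function with nonvanishing gradient there.
  In dimension one this just says that the domain is a bounded open interval.\<close>

definition smooth_bounded_domain :: "'a::euclidean_space set \<Rightarrow> bool" where
  "smooth_bounded_domain U \<longleftrightarrow> open U \<and> connected U \<and> U \<noteq> {} \<and> bounded U \<and>
     (\<forall>p\<in>frontier U. \<exists>r>0. \<exists>\<rho>. smooth_on (ball p r) \<rho> \<and>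
        (\<exists>i\<in>Basis. partial_deriv i \<rho> p \<noteq> 0) \<and>
        U \<inter> ball p r = {x\<in>ball p r. \<rho> x < 0})"


section \<open>\<open>L\<^sup>2\<close> and Sobolev spaces\<close>

text \<open>Elements of \<open>L\<^sup>2\<close> are represented by functions; all notions below are invariant under
  changes on null sets unless a continuous representative is explicitly asked for.\<close>

definition square_integrable :: "'a::euclidean_space set \<Rightarrow> ('a \<Rightarrow> real) \<Rightarrow> bool" where
  "square_integrable U f \<longleftrightarrow>
     f \<in> borel_measurable (lebesgue_on U) \<and> integrable (lebesgue_on U) (\<lambda>x. (f x)\<^sup>2)"

definition L2_inner :: "'a::euclidean_space set \<Rightarrow> ('a \<Rightarrow> real) \<Rightarrow> ('a \<Rightarrow> real) \<Rightarrow> real" where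
  "L2_inner U f g = (\<integral>x. f x * g x \<partial>lebesgue_on U)"

definition L2_norm :: "'a::euclidean_space set \<Rightarrow> ('a \<Rightarrow> real) \<Rightarrow> real" where
  "L2_norm U f = sqrt (L2_inner U f f)"

definition L2_orthonormal_basis ::
  "'a::euclidean_space set \<Rightarrow> (nat \<Rightarrow> 'a \<Rightarrow> real) \<Rightarrow> bool" where
  "L2_orthonormal_basis U e \<longleftrightarrow>
     (\<forall>k. square_integrable U (e k)) \<and>
     (\<forall>j k. L2_inner U (e j) (e k) = (if j = k then 1 else 0)) \<and>
     (\<forall>f. square_integrable U f \<longrightarrow>
        (\<lambda>n. L2_norm U (\<lambda>x. f x - (\<Sum>k<n. L2_inner U f (e k) * e k x))) \<longlonglongrightarrow> 0)"

text \<open>\<open>u\<close> is in \<open>H\<^sup>1(U)\<close> with distributional gradient \<open>G\<close>. For functions of one real variable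
  (\<open>Basis = {1}\<close>) \<open>G\<close> is the distributional derivative \<open>u'\<close>.\<close>

definition H1_gradient ::
  "'a::euclidean_space set \<Rightarrow> ('a \<Rightarrow> real) \<Rightarrow> ('a \<Rightarrow> 'a) \<Rightarrow> bool" where
  "H1_gradient U u G \<longleftrightarrow> square_integrable U u \<and>
     (\<forall>i\<in>Basis. square_integrable U (\<lambda>x. G x \<bullet> i) \<and>
        (\<forall>\<psi>. test_fun U \<psi> \<longrightarrow>
           L2_inner U u (partial_deriv i \<psi>) = - L2_inner U (\<lambda>x. G x \<bullet> i) \<psi>))"

text \<open>\<open>u\<close> is in \<open>H\<^sup>1\<^sub>0(U)\<close>, the \<open>H\<^sup>1\<close>-closure of the test functions, with gradient \<open>G\<close>.\<close>

definition H10_gradient ::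
  "'a::euclidean_space set \<Rightarrow> ('a \<Rightarrow> real) \<Rightarrow> ('a \<Rightarrow> 'a) \<Rightarrow> bool" where
  "H10_gradient U u G \<longleftrightarrow> H1_gradient U u G \<and>
     (\<exists>\<psi>. (\<forall>n. test_fun U (\<psi> n)) \<and>
        (\<lambda>n. L2_norm U (\<lambda>x. \<psi> n x - u x)) \<longlonglongrightarrow> 0 \<and>
        (\<forall>i\<in>Basis. (\<lambda>n. L2_norm U (\<lambda>x. partial_deriv i (\<psi> n) x - G x \<bullet> i)) \<longlonglongrightarrow> 0))"


section \<open>Dirichlet Laplacian\<close>

text \<open>Graph of the self-adjoint operator \<open>-\<Delta>\<close> with domain
  \<open>{u \<in> H\<^sup>1\<^sub>0(U). \<Delta>u \<in> L\<^sup>2(U)}\<close>, the equation \<open>-\<Delta>u = f\<close> being read in the sense of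
  distributions.\<close>

definition dirichlet_laplacian ::
  "'a::euclidean_space set \<Rightarrow> ('a \<Rightarrow> real) \<Rightarrow> ('a \<Rightarrow> real) \<Rightarrow> bool" where
  "dirichlet_laplacian U u f \<longleftrightarrow> square_integrable U f \<and>
     (\<exists>G. H10_gradient U u G \<and>
        (\<forall>\<psi>. test_fun U \<psi> \<longrightarrow>
           (\<Sum>i\<in>Basis. L2_inner U (\<lambda>x. G x \<bullet> i) (partial_deriv i \<psi>)) = L2_inner U f \<psi>))"

text \<open>\<open>(\<mu>\<^sub>k\<^sup>2, \<phi>\<^sub>k)\<close> lists the spectrum with multiplicity. The enumeration starts at \<open>k = 0\<close>.\<close>

definition dirichlet_eigenbasis ::
  "'a::euclidean_space set \<Rightarrow> (nat \<Rightarrow> real) \<Rightarrow> (nat \<Rightarrow> 'a \<Rightarrow> real) \<Rightarrow> bool" where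
  "dirichlet_eigenbasis U \<mu> \<phi> \<longleftrightarrow> mono \<mu> \<and> (\<forall>k. 0 < \<mu> k) \<and>
     (\<forall>k. dirichlet_laplacian U (\<phi> k) (\<lambda>x. (\<mu> k)\<^sup>2 * \<phi> k x)) \<and>
     L2_orthonormal_basis U \<phi>"


section \<open>Coefficients\<close>

text \<open>The essential infimum is \<open>- esssup (-c)\<close>.\<close>

definition coeff_class :: "real \<Rightarrow> real \<Rightarrow> real \<Rightarrow> (real \<Rightarrow> real) set" where
  "coeff_class H cm cM = {c. c \<in> borel_measurable (lebesgue_on {0..H}) \<and>
     esssup (lebesgue_on {0..H}) (\<lambda>y. ereal (c y)) = ereal cM \<and>
     - esssup (lebesgue_on {0..H}) (\<lambda>y. - ereal (c y)) = ereal cm}"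

definition pointwise_variation :: "real \<Rightarrow> (real \<Rightarrow> real) \<Rightarrow> ereal" where
  "pointwise_variation H f =
     (SUP (n, t) \<in> {(n, t). mono_on {..n} t \<and> t ` {..n} \<subseteq> {0..H}}.
        ereal (\<Sum>i<n. \<bar>f (t (Suc i)) - f (t i)\<bar>))"

text \<open>As \<open>c\<close> is an \<open>L\<^sup>\<infinity>\<close>-class, its total variation is the least pointwise variation among the
  representatives of the class.\<close>

definition total_variation :: "real \<Rightarrow> (real \<Rightarrow> real) \<Rightarrow> ereal" where
  "total_variation H c =
     (INF f \<in> {f. AE y in lebesgue_on {0..H}. f y = c y}. pointwise_variation H f)"

definition coeff_class_TV :: "real \<Rightarrow> real \<Rightarrow> real \<Rightarrow> real \<Rightarrow> (real \<Rightarrow> real) set" where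
  "coeff_class_TV H cm cM V = {c \<in> coeff_class H cm cM. total_variation H c \<le> ereal V}"


section \<open>The operators \<open>A\<^sub>k\<close> and the minimal amplitude\<close>

text \<open>Graph of \<open>A = c m\<^sup>2 - d/dy c d/dy\<close> in \<open>L\<^sup>2(0,H)\<close> with domain
  \<open>{u \<in> H\<^sup>1\<^sub>0(0,H). c u' \<in> H\<^sup>1(0,H)}\<close>; \<open>A\<^sub>k\<close> is the case \<open>m = \<mu>\<^sub>k\<close>.\<close>

definition A_op ::
  "real \<Rightarrow> (real \<Rightarrow> real) \<Rightarrow> real \<Rightarrow> (real \<Rightarrow> real) \<Rightarrow> (real \<Rightarrow> real) \<Rightarrow> bool" where
  "A_op H c m u f \<longleftrightarrow>
     (\<exists>u' w. H10_gradient {0<..<H} u u' \<and> H1_gradient {0<..<H} (\<lambda>y. c y * u' y) w \<and>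
        (AE y in lebesgue_on {0<..<H}. f y = c y * m\<^sup>2 * u y - w y))"

definition A_eigenvalue :: "real \<Rightarrow> (real \<Rightarrow> real) \<Rightarrow> real \<Rightarrow> real \<Rightarrow> bool" where
  "A_eigenvalue H c m lam \<longleftrightarrow>
     (\<exists>u. A_op H c m u (\<lambda>y. lam * u y) \<and> \<not> (AE y in lebesgue_on {0<..<H}. u y = 0))"

text \<open>The \<open>L\<^sup>2\<close>-normalized real eigenfunctions, given by their continuous representatives on
  \<open>[0,H]\<close>. Eigenvalues being simple, such a function is unique up to sign; instead of
  fixing a sign we always quantify over both choices.\<close>

definition A_eigenfunction ::
  "real \<Rightarrow> (real \<Rightarrow> real) \<Rightarrow> real \<Rightarrow> real \<Rightarrow> (real \<Rightarrow> real) \<Rightarrow> bool" where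
  "A_eigenfunction H c m lam u \<longleftrightarrow> A_op H c m u (\<lambda>y. lam * u y) \<and>
     L2_norm {0<..<H} u = 1 \<and> continuous_on {0..H} u"

text \<open>\<open>q\<close> is the continuous representative of \<open>c u'\<close>.\<close>

definition flux :: "real \<Rightarrow> (real \<Rightarrow> real) \<Rightarrow> (real \<Rightarrow> real) \<Rightarrow> (real \<Rightarrow> real) \<Rightarrow> bool" where
  "flux H c u q \<longleftrightarrow> continuous_on {0..H} q \<and>
     (\<exists>u'. H1_gradient {0<..<H} u u' \<and> (AE y in lebesgue_on {0<..<H}. q y = c y * u' y))"

text \<open>The numbers \<open>\<beta>\<^sub>k\<^sub>,\<^sub>l\<close> exhaust the eigenvalues of \<open>A\<^sub>k\<close>.\<close>

definition A_pairs ::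
  "real \<Rightarrow> (nat \<Rightarrow> real) \<Rightarrow> real \<Rightarrow> real \<Rightarrow> (real \<Rightarrow> real) \<Rightarrow> (real \<times> real) set" where
  "A_pairs H \<mu> cM \<epsilon> c =
     (\<Union>k. {(\<mu> k, lam) |lam. A_eigenvalue H c (\<mu> k) lam \<and> (cM + \<epsilon>) * (\<mu> k)\<^sup>2 \<le> lam})"

text \<open>The squared minimal amplitudes. They are extended reals, so that an infimum over the empty
  set (\<open>coeff_class_TV\<close> is empty if \<open>V < cM - cm\<close>) is \<open>\<infinity>\<close>.\<close>

definition min_amplitude_sq ::
  "real \<Rightarrow> (nat \<Rightarrow> real) \<Rightarrow> real \<Rightarrow> real \<Rightarrow> (real \<Rightarrow> real) \<Rightarrow> ereal" where
  "min_amplitude_sq H \<mu> cM \<epsilon> c =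
     Inf {ereal ((u y)\<^sup>2 + (q y)\<^sup>2) |y m lam u q.
       y \<in> {0..H} \<and> (m, lam) \<in> A_pairs H \<mu> cM \<epsilon> c \<and> A_eigenfunction H c m lam u \<and> flux H c u q}"

definition min_amplitude_TV_sq ::
  "real \<Rightarrow> (nat \<Rightarrow> real) \<Rightarrow> real \<Rightarrow> real \<Rightarrow> real \<Rightarrow> real \<Rightarrow> ereal" where
  "min_amplitude_TV_sq H \<mu> cm cM \<epsilon> V =
     (INF c \<in> coeff_class_TV H cm cM V. min_amplitude_sq H \<mu> cM \<epsilon> c)"

definition min_amplitude_TV ::
  "real \<Rightarrow> (nat \<Rightarrow> real) \<Rightarrow> real \<Rightarrow> real \<Rightarrow> real \<Rightarrow> real \<Rightarrow> real" where
  "min_amplitude_TV H \<mu> cm cM \<epsilon> V = sqrt (real_of_ereal (min_amplitude_TV_sq H \<mu> cm cM \<epsilon> V))"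

end

theory Submission
  imports Defs
begin

text \<open>
  Let \<open>u\<close> be a normalized eigenfunction for \<open>lam \<ge> (cM + \<epsilon>) m\<^sup>2\<close> and \<open>q = c u'\<close>. Then
  \<open>u' = q / c\<close> and \<open>q' = - (lam - c m\<^sup>2) u\<close>, where \<open>lam - c m\<^sup>2\<close> lies between \<open>\<kappa> lam\<close> and
  \<open>lam\<close> with \<open>\<kappa> = \<epsilon> / (cM + \<epsilon>)\<close>: the pair \<open>(u, q)\<close> rotates at a speed comparable to the
  square root of \<open>lam\<close>. Everything rests on the energy \<open>E = c (lam - c m\<^sup>2) u\<^sup>2 + q\<^sup>2\<close>. For a
  smooth coefficient \<open>E' = (c (lam - c m\<^sup>2))' u\<^sup>2\<close>, so the logarithm of \<open>E\<close> changes by at most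
  \<open>1 / cm + 1 / \<epsilon>\<close> times the variation of \<open>c\<close>; \<open>energy_comparison\<close> proves this for
  coefficients of bounded variation, which may jump, by freezing the coefficient on short
  intervals. As \<open>u\<^sup>2\<close> has mean \<open>1 / H\<close>, the energy is somewhere, hence everywhere, at least a
  constant times \<open>lam\<close>; dividing by \<open>lam\<close>, which is bounded below by \<open>(cM + \<epsilon>) (\<mu> 0)\<^sup>2\<close>, gives
  the minimal amplitude (\<open>amplitude_lower_bound\<close>).

  Let \<open>r\<^sup>2\<close> be a lower bound of \<open>u\<^sup>2 + q\<^sup>2\<close>. For large \<open>lam\<close> every interval whose length is a
  fixed multiple of \<open>1 / sqrt lam\<close> contains a zero of \<open>q\<close> (\<open>flux_zero_in_interval\<close>). There
  \<open>u\<^sup>2 \<ge> r\<^sup>2\<close>, and \<open>u\<close> keeps this size on an interval of comparable length. About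
  \<open>(b - a) sqrt lam\<close> such intervals fit into \<open>(a, b)\<close>, so the mass of \<open>u\<close> there is bounded
  below independently of \<open>lam\<close> (\<open>mass_high_energy\<close>). For bounded \<open>lam\<close>, smallness of \<open>u\<close> on
  \<open>(a, b)\<close> would keep \<open>q\<close> away from zero there, so that \<open>u\<close> would have to grow
  (\<open>mass_low_energy\<close>).

  The norm of \<open>u(y) \<phi> k (x')\<close> on a product set is a product of norms. The liminf hypothesis bounds
  the transversal factor for all but finitely many \<open>k\<close>; for those it remains to see that an
  eigenfunction of the Dirichlet Laplacian cannot vanish on an open set. This is
  \<open>unique_continuation\<close>: a mollified solution \<open>w\<close> of the Helmholtz equation satisfies the interior
  estimate \<open>\<bar>\<partial>\<^sup>n w\<bar> \<le> C\<^sup>n n!\<close> in \<open>L\<^sup>2\<close> (\<open>iterated_derivative_bound\<close>), where \<open>C\<close> depends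
  only on the equation and on the radius of a ball inside the domain. Taylor expansion then moves a zero set by a distance that
  depends on this radius but not on the size of the zero set, and connectedness concludes.

  The weak formulations are made classical by the fundamental lemma of the calculus of variations,
  proved with explicit bump functions, and by the du Bois-Reymond argument of \<open>H1_primitive\<close>.
\<close>

section \<open>Smooth functions and test functions\<close>

lemma partial_deriv_eqI:
  assumes "(f has_derivative f') (at x)"
  shows "partial_deriv i f x = f' i"
  using assms frechet_derivative_at unfolding partial_deriv_def by metis

text \<open>A form of the recursive definition of \<open>Ck_on\<close> adapted to the rules for \<open>has_derivative\<close>:
  closure of \<open>Ck_on\<close> under an operation becomes an induction on the order whose step reads off the
  derivative of the result.\<close>

lemma Ck_on_SucI:
  fixes f :: "'a::euclidean_space \<Rightarrow> real"
  assumes "\<And>x. (f has_derivative D x) (at x)"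
    and "\<And>i. i \<in> Basis \<Longrightarrow> Ck_on k UNIV (\<lambda>x. D x i)"
  shows "Ck_on (Suc k) UNIV f"
proof -
  have "partial_deriv i f = (\<lambda>x. D x i)" for i
    using partial_deriv_eqI[OF assms(1)] by auto
  moreover have "f differentiable_on UNIV"
    using assms(1) by (auto simp: differentiable_on_def differentiable_def intro: exI)
  ultimately show ?thesis using assms(2) by simp
qed

lemma Ck_on_SucD:
  fixes f :: "'a::euclidean_space \<Rightarrow> real"
  assumes "Ck_on (Suc k) UNIV f"
  shows "(f has_derivative frechet_derivative f (at x)) (at x)"
    and "i \<in> Basis \<Longrightarrow> Ck_on k UNIV (\<lambda>x. frechet_derivative f (at x) i)"
proof -
  show "(f has_derivative frechet_derivative f (at x)) (at x)"
    using assms by (auto simp: differentiable_on_def frechet_derivative_works)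
  have "partial_deriv i f = (\<lambda>x. frechet_derivative f (at x) i)"
    by (auto simp: partial_deriv_def)
  then show "i \<in> Basis \<Longrightarrow> Ck_on k UNIV (\<lambda>x. frechet_derivative f (at x) i)"
    using assms by auto
qed

lemma Ck_on_Suc_imp:
  "Ck_on (Suc k) UNIV f \<Longrightarrow> Ck_on k UNIV f"
proof (induction k arbitrary: f)
  case 0
  then show ?case by (auto intro: differentiable_imp_continuous_on)
next
  case (Suc k)
  have "f differentiable_on UNIV" "\<And>i. i \<in> Basis \<Longrightarrow> Ck_on (Suc k) UNIV (partial_deriv i f)"
    using Suc.prems by auto
  then show ?case using Suc.IH by simp
qed

lemma Ck_on_const: "Ck_on k UNIV (\<lambda>x. c)"
proof (induction k arbitrary: c)
  case (Suc k)
  show ?case by (rule Ck_on_SucI[where D="\<lambda>x i. 0"]) (auto intro: Suc)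
qed auto

lemma Ck_on_add:
  "Ck_on k UNIV f \<Longrightarrow> Ck_on k UNIV g \<Longrightarrow> Ck_on k UNIV (\<lambda>x. f x + g x)"
proof (induction k arbitrary: f g)
  case (Suc k)
  show ?case
    by (rule Ck_on_SucI[OF has_derivative_add[OF Ck_on_SucD(1)[OF Suc.prems(1)] Ck_on_SucD(1)[OF Suc.prems(2)]]])
      (intro Suc.IH Ck_on_SucD(2)[OF Suc.prems(1)] Ck_on_SucD(2)[OF Suc.prems(2)])
qed (auto intro: continuous_on_add)

lemma Ck_on_mult:
  "Ck_on k UNIV f \<Longrightarrow> Ck_on k UNIV g \<Longrightarrow> Ck_on k UNIV (\<lambda>x. f x * g x)"
proof (induction k arbitrary: f g)
  case (Suc k)
  show ?case
    by (rule Ck_on_SucI[OF has_derivative_mult[OF Ck_on_SucD(1)[OF Suc.prems(1)] Ck_on_SucD(1)[OF Suc.prems(2)]]])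
      (intro Ck_on_add Suc.IH Ck_on_SucD(2)[OF Suc.prems(1)] Ck_on_SucD(2)[OF Suc.prems(2)]
        Ck_on_Suc_imp[OF Suc.prems(1)] Ck_on_Suc_imp[OF Suc.prems(2)])
qed (auto intro: continuous_on_mult)

lemma Ck_on_prod:
  assumes "finite I" "\<And>i. i \<in> I \<Longrightarrow> Ck_on k UNIV (f i)"
  shows "Ck_on k UNIV (\<lambda>x. \<Prod>i\<in>I. f i x)"
  using assms by (induction I rule: finite_induct) (auto intro: Ck_on_const Ck_on_mult)

lemma Ck_on_affine:
  fixes g :: "'b::euclidean_space \<Rightarrow> real" and L :: "'a::euclidean_space \<Rightarrow> 'b"
  assumes "bounded_linear L"
  shows "Ck_on k UNIV g \<Longrightarrow> Ck_on k UNIV (\<lambda>x. g (L x + b))"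
proof (induction k arbitrary: g)
  case 0
  then have "continuous_on UNIV g" by simp
  moreover have "continuous_on UNIV (\<lambda>x. L x + b)"
    by (intro continuous_intros linear_continuous_on assms)
  ultimately show ?case
    using continuous_on_compose2[of UNIV g UNIV "\<lambda>x. L x + b"] by simp
next
  case (Suc k)
  let ?D = "\<lambda>x i. frechet_derivative g (at (L x + b)) (L i)"
  have eq: "?D x i = (\<Sum>j\<in>Basis. (L i \<bullet> j) * frechet_derivative g (at (L x + b)) j)" for x i
  proof -
    have l: "linear (frechet_derivative g (at (L x + b)))"
      by (rule has_derivative_linear[OF Ck_on_SucD(1)[OF Suc.prems]])
    have "?D x i = frechet_derivative g (at (L x + b)) (\<Sum>j\<in>Basis. (L i \<bullet> j) *\<^sub>R j)"
      by (simp add: euclidean_representation)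
    also have "\<dots> = (\<Sum>j\<in>Basis. (L i \<bullet> j) * frechet_derivative g (at (L x + b)) j)"
      by (simp add: linear_sum[OF l] linear_cmul[OF l])
    finally show ?thesis .
  qed
  have sum: "Ck_on k UNIV (\<lambda>x. \<Sum>j\<in>J. (L i \<bullet> j) * frechet_derivative g (at (L x + b)) j)"
    if "finite J" "J \<subseteq> Basis" for J i
    using that
  proof (induction J rule: finite_induct)
    case (insert j J)
    then show ?case
      by (auto intro!: Ck_on_add Ck_on_mult Ck_on_const Suc.IH[OF Ck_on_SucD(2)[OF Suc.prems]])
  qed (simp add: Ck_on_const)
  show ?case
  proof (rule Ck_on_SucI)
    show "((\<lambda>x. g (L x + b)) has_derivative ?D x) (at x)" for x
      by (rule has_derivative_compose[where g=g and f="\<lambda>x. L x + b" and f'=L])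
        (auto intro!: derivative_eq_intros bounded_linear.has_derivative[OF assms] Ck_on_SucD(1)[OF Suc.prems])
    show "Ck_on k UNIV (\<lambda>x. ?D x i)" for i
      unfolding eq by (rule sum) auto
  qed
qed

text \<open>The functions \<open>s\<^sup>-\<^sup>n exp (- 1 / s)\<close> on \<open>s > 0\<close>, extended by \<open>0\<close>. Differentiation keeps the
  span of this family, which makes its members smooth by induction on the order; \<open>n = 0\<close> is the
  usual flat function.\<close>

definition flat_exp :: "nat \<Rightarrow> real \<Rightarrow> real" where
  "flat_exp n s = (if 0 < s then (inverse s) ^ n * exp (- inverse s) else 0)"

lemma flat_exp_tendsto: "((\<lambda>s. flat_exp n s) \<longlongrightarrow> 0) (at 0)"
proof -
  have "((\<lambda>s. flat_exp n s) \<longlongrightarrow> 0) (at_right 0)"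
  proof -
    have "((\<lambda>x::real. x ^ n / exp x) \<longlongrightarrow> 0) at_top"
      by (rule tendsto_power_div_exp_0)
    then have "((\<lambda>s::real. (inverse s) ^ n / exp (inverse s)) \<longlongrightarrow> 0) (at_right 0)"
      by (rule filterlim_compose) (rule filterlim_inverse_at_top_right)
    then show ?thesis
      by (rule Lim_transform_eventually)
        (auto simp: eventually_at_filter flat_exp_def exp_minus divide_inverse)
  qed
  moreover have "((\<lambda>s. flat_exp n s) \<longlongrightarrow> 0) (at_left 0)"
    by (rule tendsto_eventually) (auto simp: eventually_at_filter flat_exp_def)
  ultimately show ?thesis by (simp add: filterlim_split_at)
qed

lemma flat_exp_deriv:
  "(flat_exp n has_real_derivative flat_exp (Suc (Suc n)) s - n * flat_exp (Suc n) s) (at s)"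
proof -
  consider "s < 0" | "s = 0" | "0 < s" by linarith
  then show ?thesis
  proof cases
    case 1
    have "((\<lambda>_. 0) has_real_derivative 0) (at s)" by simp
    then have "(flat_exp n has_real_derivative 0) (at s)"
      by (rule has_field_derivative_transform_within_open[where S="{..<0}"])
         (use 1 in \<open>auto simp: flat_exp_def\<close>)
    then show ?thesis using 1 by (simp add: flat_exp_def)
  next
    case 2
    have "((\<lambda>h. flat_exp n h / h) \<longlongrightarrow> 0) (at 0)"
      by (rule Lim_transform_eventually[OF flat_exp_tendsto[of "Suc n"]])
        (auto simp: eventually_at_filter flat_exp_def divide_inverse)
    then have "(flat_exp n has_real_derivative 0) (at 0)"
      by (simp add: DERIV_def) (simp add: flat_exp_def)
    then show ?thesis using 2 by (simp add: flat_exp_def)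
  next
    case 3
    have "((\<lambda>s. (inverse s) ^ n * exp (- inverse s)) has_real_derivative
       flat_exp (Suc (Suc n)) s - n * flat_exp (Suc n) s) (at s)"
      using 3 by (auto intro!: derivative_eq_intros simp: flat_exp_def divide_simps algebra_simps
          split: nat.splits nat_diff_split)
    then show ?thesis
      by (rule has_field_derivative_transform_within_open[where S="{0<..}"])
         (use 3 in \<open>auto simp: flat_exp_def\<close>)
  qed
qed

lemma Ck_on_flat_exp: "Ck_on k UNIV (flat_exp n)"
proof (induction k arbitrary: n)
  case 0
  then show ?case
    using DERIV_continuous_on[OF has_field_derivative_at_within[OF flat_exp_deriv], of UNIV n] by simp
next
  case (Suc k)
  have *: "(\<lambda>x. (flat_exp (Suc (Suc n)) x - real n * flat_exp (Suc n) x) * i)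
     = (\<lambda>x. flat_exp (Suc (Suc n)) x * i + flat_exp (Suc n) x * (- real n * i))" for i
    by (auto simp: algebra_simps)
  show ?case
    by (rule Ck_on_SucI[OF flat_exp_deriv[unfolded has_field_derivative_def]])
       (unfold *, intro Ck_on_add Ck_on_mult Suc Ck_on_const)
qed

text \<open>Positive exactly on the open box and increasing with \<open>n\<close> to its indicator function: the
  arguments of the flat function are stretched by the factor \<open>n + 1\<close> (not \<open>n\<close>, so that the first
  member is nontrivial too).\<close>

definition box_bump :: "'a::euclidean_space \<Rightarrow> 'a \<Rightarrow> nat \<Rightarrow> 'a \<Rightarrow> real" where
  "box_bump a b n x = (\<Prod>i\<in>Basis.
     flat_exp 0 (Suc n * (x \<bullet> i - a \<bullet> i)) * flat_exp 0 (Suc n * (b \<bullet> i - x \<bullet> i)))"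

lemma flat_exp_0_bounds: "0 \<le> flat_exp 0 s" "flat_exp 0 s \<le> 1" "0 < s \<Longrightarrow> 0 < flat_exp 0 s"
  by (auto simp: flat_exp_def)

lemma box_bump_bounds: "0 \<le> box_bump a b n x" "box_bump a b n x \<le> 1"
  unfolding box_bump_def
  by (auto intro!: prod_nonneg prod_le_1 mult_nonneg_nonneg mult_le_one flat_exp_0_bounds)

lemma box_bump_outside: "x \<notin> box a b \<Longrightarrow> box_bump a b n x = 0"
  by (auto simp: mem_box box_bump_def flat_exp_def not_less zero_less_mult_iff intro!: bexI)

lemma box_bump_pos: "x \<in> box a b \<Longrightarrow> 0 < box_bump a b n x"
  by (auto simp: mem_box box_bump_def intro!: prod_pos mult_pos_pos flat_exp_0_bounds)

lemma box_bump_tendsto: "(\<lambda>n. box_bump a b n x) \<longlonglongrightarrow> indicator (box a b) x"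
proof (cases "x \<in> box a b")
  case True
  have *: "(\<lambda>n. flat_exp 0 (real (Suc n) * s)) \<longlonglongrightarrow> 1" if "0 < s" for s
  proof -
    have "(\<lambda>n. exp (- (inverse (real (Suc n)) * inverse s))) \<longlonglongrightarrow> exp (- (0 * inverse s))"
      by (intro tendsto_intros LIMSEQ_inverse_real_of_nat)
    moreover have "exp (- (inverse (real (Suc n)) * inverse s)) = flat_exp 0 (real (Suc n) * s)" for n
      using that by (simp add: flat_exp_def)
    ultimately show ?thesis by simp
  qed
  have "(\<lambda>n. box_bump a b n x) \<longlonglongrightarrow> (\<Prod>i\<in>(Basis::'a set). 1 * 1)"
    unfolding box_bump_def
    by (intro tendsto_prod tendsto_mult *) (use True in \<open>auto simp: mem_box\<close>)
  then show ?thesis using True by simp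
next
  case False
  then show ?thesis by (simp add: box_bump_outside)
qed

lemma Ck_on_box_bump: "Ck_on k UNIV (box_bump a b n)"
proof -
  have 1: "Ck_on k UNIV (\<lambda>x::'a. flat_exp 0 (real (Suc n) * (x \<bullet> i - a \<bullet> i)))" for i
    using Ck_on_affine[OF _ Ck_on_flat_exp[of k 0], of "\<lambda>x. Suc n * (x \<bullet> i)" "- (Suc n * (a \<bullet> i))"]
    by (simp add: bounded_linear_const_mult bounded_linear_inner_left right_diff_distrib)
  have 2: "Ck_on k UNIV (\<lambda>x::'a. flat_exp 0 (real (Suc n) * (b \<bullet> i - x \<bullet> i)))" for i
    using Ck_on_affine[OF _ Ck_on_flat_exp[of k 0], of "\<lambda>x. - (Suc n * (x \<bullet> i))" "(Suc n * (b \<bullet> i))"]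
    by (simp add: bounded_linear_const_mult bounded_linear_inner_left bounded_linear_minus right_diff_distrib)
  show ?thesis unfolding box_bump_def
    by (intro Ck_on_prod Ck_on_mult 1 2) auto
qed

lemma box_bump_test_fun:
  assumes "cbox a b \<subseteq> U"
  shows "test_fun U (box_bump a b n)"
proof -
  have "{x. box_bump a b n x \<noteq> 0} \<subseteq> cbox a b"
    using box_bump_outside[of _ a b n] box_subset_cbox[of a b] by auto
  then have sub: "closure {x. box_bump a b n x \<noteq> 0} \<subseteq> cbox a b"
    by (rule closure_minimal) (rule closed_cbox)
  have "bounded {x. box_bump a b n x \<noteq> 0}"
    by (rule bounded_subset[OF bounded_cbox subset_trans[OF closure_subset sub]])
  then have "compact (closure {x. box_bump a b n x \<noteq> 0})"
    by (simp add: compact_closure)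
  with sub show ?thesis using assms
    by (auto simp: test_fun_def smooth_on_def Ck_on_box_bump)
qed

lemma test_fun_has_derivative:
  assumes "test_fun U \<psi>"
  shows "(\<psi> has_derivative frechet_derivative \<psi> (at x)) (at x)"
proof -
  have "Ck_on (Suc 0) UNIV \<psi>" using assms unfolding test_fun_def smooth_on_def by blast
  then show ?thesis by (rule Ck_on_SucD)
qed

lemma test_fun_continuous: "test_fun U \<psi> \<Longrightarrow> continuous_on UNIV \<psi>"
  unfolding test_fun_def smooth_on_def by (metis Ck_on.simps(1))

lemma test_fun_partial_deriv:
  assumes "test_fun U \<psi>" "i \<in> Basis"
  shows "test_fun U (partial_deriv i \<psi>)"
proof -
  let ?S = "closure {x. \<psi> x \<noteq> 0}"
  have sm: "\<And>k. Ck_on (Suc k) UNIV \<psi>" and c: "compact ?S" and s: "?S \<subseteq> U"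
    using assms(1) unfolding test_fun_def smooth_on_def by blast+
  have "{x. partial_deriv i \<psi> x \<noteq> 0} \<subseteq> ?S"
  proof (rule ccontr)
    assume "\<not> ?thesis"
    then obtain x where x: "partial_deriv i \<psi> x \<noteq> 0" "x \<notin> ?S" by auto
    have "(\<psi> has_derivative (\<lambda>h. 0)) (at x)"
      by (rule has_derivative_transform_within_open[where s="- ?S" and f="\<lambda>_. 0"])
        (use x closure_subset[of "{x. \<psi> x \<noteq> 0}"] in \<open>auto simp: open_Compl\<close>)
    then have "partial_deriv i \<psi> x = 0" by (rule partial_deriv_eqI)
    with x show False by simp
  qed
  then have sub: "closure {x. partial_deriv i \<psi> x \<noteq> 0} \<subseteq> ?S"
    by (rule closure_minimal) (rule closed_closure)
  have "bounded {x. partial_deriv i \<psi> x \<noteq> 0}"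
    by (rule bounded_subset[OF compact_imp_bounded[OF c] subset_trans[OF closure_subset sub]])
  then have "compact (closure {x. partial_deriv i \<psi> x \<noteq> 0})"
    by (simp add: compact_closure)
  moreover have "smooth_on UNIV (partial_deriv i \<psi>)"
    using sm assms(2) by (auto simp: smooth_on_def)
  ultimately show ?thesis using sub s by (auto simp: test_fun_def)
qed

lemma test_fun_zero_outside: "test_fun U \<psi> \<Longrightarrow> x \<notin> U \<Longrightarrow> \<psi> x = 0"
  using closure_subset[of "{x. \<psi> x \<noteq> 0}"] by (auto simp: test_fun_def)

lemma test_fun_bounded:
  assumes "test_fun U \<psi>"
  obtains B where "0 < B" "\<And>x. \<bar>\<psi> x\<bar> \<le> B"
proof -
  let ?S = "closure {x. \<psi> x \<noteq> 0}"
  have "compact (\<psi> ` ?S)"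
    by (rule compact_continuous_image[OF continuous_on_subset[OF test_fun_continuous[OF assms]]])
      (use assms in \<open>auto simp: test_fun_def\<close>)
  then have "bounded (\<psi> ` ?S)" by (rule compact_imp_bounded)
  then obtain B where B: "B > 0" "\<And>y. y \<in> \<psi> ` ?S \<Longrightarrow> norm y \<le> B"
    unfolding bounded_pos by metis
  have "\<bar>\<psi> x\<bar> \<le> B" for x
  proof (cases "\<psi> x = 0")
    case False
    then have "x \<in> ?S" using closure_subset[of "{x. \<psi> x \<noteq> 0}"] by auto
    then show ?thesis using B(2)[of "\<psi> x"] by simp
  qed (use B(1) in simp)
  then show ?thesis by (rule that[OF B(1)])
qed

section \<open>The fundamental lemma of the calculus of variations\<close>

lemma continuous_imp_lebesgue_measurable:
  "continuous_on UNIV f \<Longrightarrow> f \<in> borel_measurable lebesgue"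
  by (intro measurable_completion) (simp add: borel_measurable_continuous_onI)

text \<open>The sets over which \<open>h\<close> has vanishing integral are stable under complements (this is where
  the total integral enters) and countable disjoint unions. Boxes form an intersection stable
  generator, so all Borel sets have this property.\<close>

lemma integral_zero_on_boxes_imp_AE_zero:
  fixes h :: "'a::euclidean_space \<Rightarrow> real"
  assumes h: "integrable lebesgue h"
    and total: "(\<integral>x. h x \<partial>lebesgue) = 0"
    and boxes: "\<And>a b. (\<integral>x. indicator (box a b) x * h x \<partial>lebesgue) = 0"
  shows "AE x in lebesgue. h x = 0"
proof -
  have "h \<in> borel_measurable (completion lborel)" using h by simp
  then obtain g where g: "g \<in> borel_measurable lborel" "AE x in lborel. h x = g x"
    using completion_ex_borel_measurable_real by blast
  have hg: "AE x in lebesgue. h x = g x" using AE_completion[OF g(2)] .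
  have gm: "g \<in> borel_measurable lebesgue" using g(1) by (simp add: measurable_completion)
  have gi: "integrable lborel g"
    using integrable_cong_AE[OF _ gm hg] h g(1) integrable_completion[of g lborel] by auto
  have eq: "(\<integral>x. indicator A x * g x \<partial>lborel) = (\<integral>x. indicator A x * h x \<partial>lebesgue)" if A: "A \<in> sets borel" for A
  proof -
    have "(\<integral>x. indicator A x * g x \<partial>lborel) = (\<integral>x. indicator A x * g x \<partial>lebesgue)"
      by (rule integral_completion[symmetric]) (use g(1) A in measurable)
    also have "\<dots> = (\<integral>x. indicator A x * h x \<partial>lebesgue)"
    proof (rule integral_cong_AE)
      have A': "A \<in> sets lebesgue" using A by simp
      show "(\<lambda>x. indicator A x * g x) \<in> borel_measurable lebesgue"
        "(\<lambda>x. indicator A x * h x) \<in> borel_measurable lebesgue"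
        using gm h A' by (auto intro!: borel_measurable_times borel_measurable_indicator)
    qed (use hg in auto)
    finally show ?thesis .
  qed
  have P: "(\<integral>x. indicator A x * g x \<partial>lborel) = 0" if "A \<in> sets (borel::'a measure)" for A
  proof -
    have A: "A \<in> sigma_sets UNIV (range (\<lambda>(a, b). box a b :: 'a set))"
      using that by (subst (asm) borel_eq_box) (simp add: sets_measure_of)
    have bo: "sigma_sets UNIV (range (\<lambda>(a, b). box a b :: 'a set)) = sets borel"
      by (subst borel_eq_box) (simp add: sets_measure_of)
    have int: "integrable lborel (\<lambda>x. indicator B x * g x)" if "B \<in> sets borel" for B
      using integrable_mult_indicator[of B lborel g] gi that by simp
    show ?thesis
    proof (rule sigma_sets_induct_disjoint[OF _ _ A])
      show "Int_stable (range (\<lambda>(a, b). box a b :: 'a set))"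
        by (auto simp: Int_stable_def box_Int_box)
      show "(\<integral>x. indicator B x * g x \<partial>lborel) = 0" if "B \<in> range (\<lambda>(a, b). box a b)" for B
        using that boxes eq by auto
      show "(\<integral>x. indicator (UNIV - B) x * g x \<partial>lborel) = 0"
        if "B \<in> sigma_sets UNIV (range (\<lambda>(a, b). box a b))" "(\<integral>x. indicator B x * g x \<partial>lborel) = 0" for B
      proof -
        have "(\<integral>x. indicator (UNIV - B) x * g x \<partial>lborel) = (\<integral>x. g x - indicator B x * g x \<partial>lborel)"
          by (rule Bochner_Integration.integral_cong) (auto simp: indicator_def)
        also have "\<dots> = (\<integral>x. g x \<partial>lborel) - (\<integral>x. indicator B x * g x \<partial>lborel)"
          using that(1) by (intro Bochner_Integration.integral_diff gi int) (simp add: bo)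
        also have "(\<integral>x. g x \<partial>lborel) = 0" using eq[of UNIV] total by simp
        finally show ?thesis using that(2) by simp
      qed
      show "(\<integral>x. indicator (\<Union>i. B i) x * g x \<partial>lborel) = 0"
        if B: "disjoint_family B" "range B \<subseteq> sigma_sets UNIV (range (\<lambda>(a, b). box a b))"
          "\<And>i. (\<integral>x. indicator (B i) x * g x \<partial>lborel) = 0" for B :: "nat \<Rightarrow> 'a set"
      proof -
        have Bm: "B i \<in> sets lborel" for i using B(2) bo by auto
        have "(LINT x:(\<Union>i. B i)|lborel. g x) = (\<Sum>i. (LINT x:(B i)|lborel. g x))"
        proof (rule lebesgue_integral_countable_add[OF Bm])
          show "i \<noteq> j \<Longrightarrow> B i \<inter> B j = {}" for i j using B(1) by (auto simp: disjoint_family_on_def)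
          show "set_integrable lborel (\<Union>i. B i) g"
            using int[of "\<Union>i. B i"] Bm by (auto simp: set_integrable_def)
        qed
        then show ?thesis using B(3) by (simp add: set_lebesgue_integral_def)
      qed
    qed auto
  qed
  have "AE x in lborel. g x = 0"
    by (rule density_unique_real[OF gi]) (use P in \<open>auto simp: set_lebesgue_integral_def\<close>)
  then have "AE x in lebesgue. g x = 0" by (rule AE_completion)
  with hg show ?thesis by (auto elim: eventually_elim2)
qed

text \<open>Testing with bumps that increase to the indicator of a box shows that \<open>f\<close> has vanishing
  integral over every box with closure inside \<open>U\<close>. Countably many closed boxes cover \<open>U\<close>.\<close>

lemma fundamental_lemma:
  fixes f :: "'a::euclidean_space \<Rightarrow> real"
  assumes U: "open U" and f: "integrable (lebesgue_on U) f"
    and zero: "\<And>\<psi>. test_fun U \<psi> \<Longrightarrow> L2_inner U f \<psi> = 0"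
  shows "AE x in lebesgue_on U. f x = 0"
proof -
  have Um: "U \<in> sets lebesgue" using U by auto
  define g where "g x = indicator U x * f x" for x
  have g: "integrable lebesgue g"
    using f Um by (simp add: g_def[abs_def] integrable_restrict_space)
  have box0: "(\<integral>x. indicator (box a b) x * g x \<partial>lebesgue) = 0" if "cbox a b \<subseteq> U" for a b
  proof -
    have lim: "(\<lambda>n. \<integral>x. box_bump a b n x * g x \<partial>lebesgue) \<longlonglongrightarrow> (\<integral>x. indicator (box a b) x * g x \<partial>lebesgue)"
    proof (rule integral_dominated_convergence[where w="\<lambda>x. \<bar>g x\<bar>"])
      show "(\<lambda>x. indicator (box a b) x * g x) \<in> borel_measurable lebesgue"
        using g by (auto intro!: borel_measurable_times borel_measurable_indicator)
      have "continuous_on UNIV (box_bump a b n)" for n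
        using Ck_on_box_bump[of 0] by simp
      then have "box_bump a b n \<in> borel_measurable lebesgue" for n
        by (rule continuous_imp_lebesgue_measurable)
      then show "(\<lambda>x. box_bump a b n x * g x) \<in> borel_measurable lebesgue" for n
        using g by (auto intro!: borel_measurable_times)
      show "integrable lebesgue (\<lambda>x. \<bar>g x\<bar>)" using g by simp
      show "AE x in lebesgue. (\<lambda>n. box_bump a b n x * g x) \<longlonglongrightarrow> indicator (box a b) x * g x"
        by (intro AE_I2 tendsto_intros box_bump_tendsto)
      show "AE x in lebesgue. norm (box_bump a b n x * g x) \<le> \<bar>g x\<bar>" for n
        by (intro AE_I2) (auto simp: abs_mult box_bump_bounds intro!: mult_left_le_one_le)
    qed
    have "(\<integral>x. box_bump a b n x * g x \<partial>lebesgue) = L2_inner U f (box_bump a b n)" for n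
      unfolding L2_inner_def using Um
      by (subst integral_restrict_space) (auto simp: g_def ac_simps)
    then have "(\<lambda>n. \<integral>x. box_bump a b n x * g x \<partial>lebesgue) = (\<lambda>n. 0)"
      using zero[OF box_bump_test_fun[OF that]] by simp
    with lim have "(\<lambda>n::nat. 0) \<longlonglongrightarrow> (\<integral>x. indicator (box a b) x * g x \<partial>lebesgue)" by simp
    then show ?thesis by (simp add: LIMSEQ_const_iff)
  qed
  \<comment> \<open>Inside a fixed box \<open>g\<close> can be tested on all boxes, as intersections of boxes are boxes.\<close>
  have cb: "AE x in lebesgue. x \<in> cbox p q \<longrightarrow> g x = 0" if pq: "cbox p q \<subseteq> U" for p q
  proof -
    let ?h = "\<lambda>x. indicator (box p q) x * g x"
    have "AE x in lebesgue. ?h x = 0"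
    proof (rule integral_zero_on_boxes_imp_AE_zero)
      show "integrable lebesgue ?h"
        using integrable_mult_indicator[of "box p q" lebesgue g] g by simp
      show "integral\<^sup>L lebesgue ?h = 0" by (rule box0[OF pq])
      show "(\<integral>x. indicator (box a b) x * ?h x \<partial>lebesgue) = 0" for a b
      proof -
        obtain a' b' where ab: "box a b \<inter> box p q = box a' b'" by (rule that[OF box_Int_box])
        have "(\<integral>x. indicator (box a b) x * ?h x \<partial>lebesgue) = (\<integral>x. indicator (box a' b') x * g x \<partial>lebesgue)"
          unfolding ab[symmetric] by (rule Bochner_Integration.integral_cong) (auto simp: indicator_def)
        also have "\<dots> = 0"
        proof (cases "box a' b' = {}")
          case False
          then have "cbox a' b' \<subseteq> cbox p q"
            using closure_minimal[OF _ closed_cbox[of p q], of "box a' b'"] box_subset_cbox[of p q] ab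
            by (auto simp: closure_box)
          then show ?thesis using box0 pq by blast
        qed simp
        finally show ?thesis .
      qed
    qed
    moreover have "AE x in lebesgue. x \<notin> cbox p q - box p q"
      by (rule AE_not_in) (meson negligible_frontier_interval negligible_iff_null_sets)
    ultimately show ?thesis by eventually_elim (auto simp: indicator_def split: if_splits)
  qed
  obtain D where D: "countable D" "D \<subseteq> Pow U" "\<And>X. X \<in> D \<Longrightarrow> \<exists>a b. X = cbox a b" "\<Union>D = U"
    using open_countable_Union_open_cbox[OF U] by metis
  have "AE x in lebesgue. \<forall>X\<in>D. x \<in> X \<longrightarrow> g x = 0"
    unfolding AE_ball_countable[OF D(1)]
  proof
    fix X assume X: "X \<in> D"
    then obtain a b where "X = cbox a b" using D(3) by blast
    then show "AE x in lebesgue. x \<in> X \<longrightarrow> g x = 0" using cb D(2) X by blast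
  qed
  then have "AE x in lebesgue. x \<in> U \<longrightarrow> f x = 0"
    by eventually_elim (metis D(4) UnionE g_def indicator_simps(1) mult_1)
  then show ?thesis using Um by (simp add: AE_restrict_space_iff)
qed


section \<open>Primitives of integrable functions\<close>

text \<open>An increment bounded by a product of two increments of monotone functions, one of them
  continuous, is of second order: summed over a fine partition the bounds become arbitrarily small.
  This replaces differentiation almost everywhere; it serves both for the product rule for
  primitives, where \<open>M\<close> and \<open>N\<close> are integrals, and for the energy, where \<open>M\<close> is the identity and
  \<open>N\<close> may jump.\<close>

lemma quadratic_increment_imp_le:
  fixes F M N :: "real \<Rightarrow> real"
  assumes ab: "a \<le> b" and M: "continuous_on {a..b} M" "mono_on {a..b} M" and N: "mono_on {a..b} N"
    and inc: "\<And>s t. a \<le> s \<Longrightarrow> s \<le> t \<Longrightarrow> t \<le> b \<Longrightarrow> F t - F s \<le> K * (M t - M s) * (N t - N s)"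
  shows "F b \<le> F a"
proof (rule field_le_epsilon)
  fix e :: real assume e: "0 < e"
  \<comment> \<open>With \<open>M\<close>-increments below \<open>\<delta>\<close> the bounds sum up to at most \<open>e\<close>; the summand \<open>1\<close> covers
      the case that \<open>K\<close> or the increment of \<open>N\<close> vanishes.\<close>
  define \<delta> where "\<delta> = e / (\<bar>K\<bar> * (N b - N a) + 1)"
  have Nab: "0 \<le> N b - N a" using mono_onD[OF N, of a b] ab by simp
  have \<delta>: "0 < \<delta>" using e Nab by (simp add: \<delta>_def add_nonneg_pos)
  have "uniformly_continuous_on {a..b} M" by (rule compact_uniformly_continuous[OF M(1)]) simp
  then obtain d where d: "d > 0" "\<And>x y. x \<in> {a..b} \<Longrightarrow> y \<in> {a..b} \<Longrightarrow> dist x y < d \<Longrightarrow> dist (M x) (M y) < \<delta>"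
    using \<delta> unfolding uniformly_continuous_on_def by metis
  obtain n :: nat where n: "(b - a) / d < n" using reals_Archimedean2 by blast
  moreover have "0 \<le> (b - a) / d" using ab d by simp
  ultimately have n0: "0 < real n" by linarith
  define t where "t i = a + real i * ((b - a) / n)" for i
  have step: "t (Suc i) - t i = (b - a) / n" for i using n0 by (simp add: t_def field_simps)
  have small: "(b - a) / n < d" using n d n0 by (simp add: field_simps)
  have mono: "a \<le> t i" for i using ab by (simp add: t_def)
  have tn: "t n = b" using n0 by (simp add: t_def)
  have le_b: "t i \<le> b" if "i \<le> n" for i
  proof -
    have "real i * ((b - a) / n) \<le> real n * ((b - a) / n)"
      using that ab n0 by (intro mult_right_mono) auto
    then show ?thesis using n0 by (simp add: t_def)
  qed
  have "F (t i) - F a \<le> \<bar>K\<bar> * \<delta> * (N (t i) - N a)" if "i \<le> n" for i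
    using that
  proof (induction i)
    case (Suc i)
    have in1: "t i \<in> {a..b}" and in2: "t (Suc i) \<in> {a..b}"
      using mono le_b Suc.prems by auto
    have le: "t i \<le> t (Suc i)" using step[of i] ab n0 by (metis diff_ge_0_iff_ge divide_nonneg_pos)
    have Mi: "0 \<le> M (t (Suc i)) - M (t i)" using mono_onD[OF M(2) in1 in2 le] by simp
    have Ni: "0 \<le> N (t (Suc i)) - N (t i)" using mono_onD[OF N in1 in2 le] by simp
    have "dist (M (t i)) (M (t (Suc i))) < \<delta>"
      by (rule d(2)[OF in1 in2]) (use step[of i] small le in \<open>simp add: dist_real_def\<close>)
    then have M\<delta>: "M (t (Suc i)) - M (t i) \<le> \<delta>" by (simp add: dist_real_def)
    have "F (t (Suc i)) - F (t i) \<le> K * (M (t (Suc i)) - M (t i)) * (N (t (Suc i)) - N (t i))"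
      using inc in1 in2 le by auto
    also have "\<dots> \<le> \<bar>K\<bar> * \<delta> * (N (t (Suc i)) - N (t i))"
      by (intro mult_right_mono mult_mono Ni M\<delta>) (use Mi in auto)
    finally show ?case using Suc by (simp add: algebra_simps)
  qed (simp add: t_def)
  from this[of n] have "F b - F a \<le> \<delta> * (\<bar>K\<bar> * (N b - N a))" by (simp add: tn ac_simps)
  also have "\<dots> \<le> \<delta> * (\<bar>K\<bar> * (N b - N a) + 1)" using \<delta> by simp
  also have "\<dots> = e"
  proof -
    have "0 \<le> \<bar>K\<bar> * (N b - N a)" using Nab by simp
    then have "\<bar>K\<bar> * (N b - N a) + 1 \<noteq> 0" by linarith
    then show ?thesis by (simp add: \<delta>_def)
  qed
  finally show "F b \<le> F a + e" by simp
qed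

text \<open>Absolutely continuous functions, presented by the integral equation that they satisfy. No
  derivative of \<open>F\<close> is mentioned, so \<open>f\<close> may be changed on null sets.\<close>

definition primitive_on :: "real \<Rightarrow> real \<Rightarrow> (real \<Rightarrow> real) \<Rightarrow> (real \<Rightarrow> real) \<Rightarrow> bool" where
  "primitive_on a b F f \<longleftrightarrow> f absolutely_integrable_on {a..b} \<and>
     (\<forall>s t. a \<le> s \<and> s \<le> t \<and> t \<le> b \<longrightarrow> F t - F s = integral {s..t} f)"

lemma primitive_onD:
  assumes "primitive_on a b F f" "a \<le> s" "s \<le> t" "t \<le> b"
  shows "F t - F s = integral {s..t} f" "f absolutely_integrable_on {s..t}" "f integrable_on {s..t}"
proof -
  show "F t - F s = integral {s..t} f" using assms by (auto simp: primitive_on_def)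
  show "f absolutely_integrable_on {s..t}"
    by (rule absolutely_integrable_on_subinterval[where S="{a..b}"]) (use assms in \<open>auto simp: primitive_on_def\<close>)
  then show "f integrable_on {s..t}" by (rule set_lebesgue_integral_eq_integral)
qed

lemma primitive_on_integral:
  assumes "f absolutely_integrable_on {a..b}"
  shows "primitive_on a b (\<lambda>y. C + integral {a..y} f) f"
  unfolding primitive_on_def
proof (intro conjI allI impI assms)
  fix s t assume st: "a \<le> s \<and> s \<le> t \<and> t \<le> b"
  have "f integrable_on {a..t}"
    by (intro set_lebesgue_integral_eq_integral(1) absolutely_integrable_on_subinterval[OF assms]) (use st in auto)
  then have "integral {a..s} f + integral {s..t} f = integral {a..t} f"
    using st by (intro Henstock_Kurzweil_Integration.integral_combine) auto
  then show "C + integral {a..t} f - (C + integral {a..s} f) = integral {s..t} f" by simp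
qed

lemma primitive_on_continuous:
  assumes "primitive_on a b F f" shows "continuous_on {a..b} F"
proof (cases "a \<le> b")
  case True
  have "continuous_on {a..b} (\<lambda>y. F a + integral {a..y} f)"
    by (intro continuous_intros indefinite_integral_continuous_1 primitive_onD(3)[OF assms])
       (use True in auto)
  moreover have "F a + integral {a..y} f = F y" if "y \<in> {a..b}" for y
    using primitive_onD(1)[OF assms, of a y] that by auto
  ultimately show ?thesis by (metis (no_types, lifting) continuous_on_cong)
qed simp

text \<open>The error of the product formula on \<open>[s, t]\<close> consists of terms such as
  \<open>(F t - F s) (G t - G s)\<close>, and is therefore bounded by the square of an increment of
  \<open>M y = \<integral> \<bar>f\<bar> + \<bar>g\<bar>\<close> over \<open>[a, y]\<close>.\<close>

lemma primitive_on_mult: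
  assumes F: "primitive_on a b F f" and G: "primitive_on a b G g" and ab: "a \<le> b"
  shows "primitive_on a b (\<lambda>y. F y * G y) (\<lambda>y. f y * G y + F y * g y)"
proof -
  have fi: "f absolutely_integrable_on {a..b}" and gi: "g absolutely_integrable_on {a..b}"
    using F G by (auto simp: primitive_on_def)
  note cF = primitive_on_continuous[OF F] and cG = primitive_on_continuous[OF G]
  have prod: "(\<lambda>y. k y * h y) absolutely_integrable_on {s..t}"
    if "k absolutely_integrable_on {s..t}" "continuous_on {s..t} h" for k h :: "real \<Rightarrow> real" and s t :: real
  proof -
    have "(\<lambda>y. h y * k y) absolutely_integrable_on {s..t}"
      by (rule absolutely_integrable_bounded_measurable_product_real[OF _ _ _ that(1)])
        (use that(2) in \<open>auto intro!: continuous_imp_measurable_on_sets_lebesgue compact_imp_bounded compact_continuous_image\<close>)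
    then show ?thesis by (simp add: mult.commute)
  qed
  let ?p = "\<lambda>y. f y * G y + F y * g y"
  have pi: "?p absolutely_integrable_on {a..b}"
    using set_integral_add(1)[OF prod[OF fi cG] prod[OF gi cF]] by (simp add: mult.commute)
  define M where "M y = integral {a..y} (\<lambda>x. \<bar>f x\<bar> + \<bar>g x\<bar>)" for y
  have ai: "(\<lambda>x. \<bar>f x\<bar>) absolutely_integrable_on {a..b}" "(\<lambda>x. \<bar>g x\<bar>) absolutely_integrable_on {a..b}"
    using absolutely_integrable_norm[OF fi] absolutely_integrable_norm[OF gi] by (auto simp: o_def)
  have Mi: "(\<lambda>x. \<bar>f x\<bar> + \<bar>g x\<bar>) absolutely_integrable_on {a..b}"
    by (rule set_integral_add(1)[OF ai])
  have Mp: "primitive_on a b M (\<lambda>x. \<bar>f x\<bar> + \<bar>g x\<bar>)"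
    using primitive_on_integral[OF Mi, of 0] by (simp add: M_def[abs_def])
  define E where "E y = F y * G y - integral {a..y} ?p" for y
  have Pp: "primitive_on a b (\<lambda>y. integral {a..y} ?p) ?p"
    using primitive_on_integral[OF pi, of 0] by simp
  have step: "\<bar>E t - E s\<bar> \<le> 3 * (M t - M s) * (M t - M s)" if st: "a \<le> s" "s \<le> t" "t \<le> b" for s t
  proof -
    note I = primitive_onD(3)[OF F st] primitive_onD(3)[OF G st]
    have fi': "f absolutely_integrable_on {s..t}" and gi': "g absolutely_integrable_on {s..t}"
      using primitive_onD(2)[OF F st] primitive_onD(2)[OF G st] .
    have ai': "(\<lambda>x. \<bar>f x\<bar>) absolutely_integrable_on {s..t}" "(\<lambda>x. \<bar>g x\<bar>) absolutely_integrable_on {s..t}"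
      using absolutely_integrable_norm[OF fi'] absolutely_integrable_norm[OF gi'] by (auto simp: o_def)
    have ni: "(\<lambda>x. \<bar>f x\<bar>) integrable_on {s..t}" "(\<lambda>x. \<bar>g x\<bar>) integrable_on {s..t}"
      using ai' set_lebesgue_integral_eq_integral(1) by auto
    have MM: "M t - M s = integral {s..t} (\<lambda>x. \<bar>f x\<bar>) + integral {s..t} (\<lambda>x. \<bar>g x\<bar>)"
      using primitive_onD(1)[OF Mp st] Henstock_Kurzweil_Integration.integral_add[OF ni] by simp
    have nn: "0 \<le> integral {s..t} (\<lambda>x. \<bar>f x\<bar>)" "0 \<le> integral {s..t} (\<lambda>x. \<bar>g x\<bar>)"
      by (auto intro!: Henstock_Kurzweil_Integration.integral_nonneg ni)
    have bd: "\<bar>L y - L s\<bar> \<le> M t - M s"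
      if L: "primitive_on a b L l" and l: "\<And>y. \<bar>l y\<bar> \<le> \<bar>f y\<bar> + \<bar>g y\<bar>" and y: "y \<in> {s..t}" for L l y
    proof -
      have sy: "a \<le> s" "s \<le> y" "y \<le> b" and yt: "a \<le> y" "y \<le> t" "t \<le> b" using y st by auto
      have "\<bar>L y - L s\<bar> = norm (integral {s..y} l)" using primitive_onD(1)[OF L sy] by simp
      also have "\<dots> \<le> integral {s..y} (\<lambda>x. \<bar>f x\<bar> + \<bar>g x\<bar>)"
        by (rule integral_norm_bound_integral[OF primitive_onD(3)[OF L sy] primitive_onD(3)[OF Mp sy]])
          (use l in auto)
      also have "\<dots> = M y - M s" using primitive_onD(1)[OF Mp sy] by simp
      also have "\<dots> \<le> M t - M s"
        using primitive_onD(1)[OF Mp yt] Henstock_Kurzweil_Integration.integral_nonneg[OF primitive_onD(3)[OF Mp yt]] by auto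
      finally show ?thesis .
    qed
    have b1: "\<bar>F y - F s\<bar> \<le> M t - M s" if "y \<in> {s..t}" for y using bd[OF F _ that] by auto
    have b2: "\<bar>G y - G s\<bar> \<le> M t - M s" if "y \<in> {s..t}" for y using bd[OF G _ that] by auto
    have cF': "continuous_on {s..t} (\<lambda>y. F y - F s)" and cG': "continuous_on {s..t} (\<lambda>y. G y - G s)"
      using continuous_on_subset[OF cF, of "{s..t}"] continuous_on_subset[OF cG, of "{s..t}"] st
      by (auto intro!: continuous_intros)
    have i1: "(\<lambda>y. f y * (G y - G s)) integrable_on {s..t}" and i2: "(\<lambda>y. g y * (F y - F s)) integrable_on {s..t}"
      using prod[OF fi' cG'] prod[OF gi' cF'] set_lebesgue_integral_eq_integral(1) by auto
    have B1: "\<bar>integral {s..t} (\<lambda>y. f y * (G y - G s))\<bar> \<le> integral {s..t} (\<lambda>x. \<bar>f x\<bar> * (M t - M s))"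
      unfolding real_norm_def[symmetric]
      by (rule integral_norm_bound_integral[OF i1 integrable_on_mult_left])
        (use b2 ni in \<open>auto simp: abs_mult intro!: mult_left_mono\<close>)
    have B2: "\<bar>integral {s..t} (\<lambda>y. g y * (F y - F s))\<bar> \<le> integral {s..t} (\<lambda>x. \<bar>g x\<bar> * (M t - M s))"
      unfolding real_norm_def[symmetric]
      by (rule integral_norm_bound_integral[OF i2 integrable_on_mult_left])
        (use b1 ni in \<open>auto simp: abs_mult intro!: mult_left_mono\<close>)
    have "integral {s..t} ?p = integral {s..t} (\<lambda>y. f y * (G y - G s) + g y * (F y - F s) + (f y * G s + g y * F s))"
      by (rule Henstock_Kurzweil_Integration.integral_cong) (simp add: algebra_simps)
    also have "\<dots> = integral {s..t} (\<lambda>y. f y * (G y - G s)) + integral {s..t} (\<lambda>y. g y * (F y - F s))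
        + (integral {s..t} f * G s + integral {s..t} g * F s)"
      using i1 i2 I by (simp add: Henstock_Kurzweil_Integration.integral_add Henstock_Kurzweil_Integration.integrable_add integrable_on_mult_left)
    finally have "E t - E s = (F t - F s) * (G t - G s)
        - integral {s..t} (\<lambda>y. f y * (G y - G s)) - integral {s..t} (\<lambda>y. g y * (F y - F s))"
      using primitive_onD(1)[OF Pp st] primitive_onD(1)[OF F st] primitive_onD(1)[OF G st]
      by (simp add: E_def algebra_simps)
    moreover have "\<bar>(F t - F s) * (G t - G s)\<bar> \<le> (M t - M s) * (M t - M s)"
      unfolding abs_mult by (intro mult_mono b1 b2) (use st nn MM in auto)
    moreover have "integral {s..t} (\<lambda>x. \<bar>f x\<bar> * (M t - M s)) + integral {s..t} (\<lambda>x. \<bar>g x\<bar> * (M t - M s))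
        = (M t - M s) * (M t - M s)"
    proof -
      have "integral {s..t} (\<lambda>x. \<bar>f x\<bar> * (M t - M s)) + integral {s..t} (\<lambda>x. \<bar>g x\<bar> * (M t - M s))
        = (integral {s..t} (\<lambda>x. \<bar>f x\<bar>) + integral {s..t} (\<lambda>x. \<bar>g x\<bar>)) * (M t - M s)"
        by (simp add: distrib_right)
      then show ?thesis using MM by simp
    qed
    ultimately have "\<bar>E t - E s\<bar> \<le> (M t - M s) * (M t - M s) + (M t - M s) * (M t - M s)"
      using B1 B2 by linarith
    moreover have "0 \<le> (M t - M s) * (M t - M s)" by simp
    ultimately show ?thesis by linarith
  qed
  have mono: "mono_on {a..b} M"
  proof (rule mono_onI)
    fix r s assume rs: "r \<in> {a..b}" "s \<in> {a..b}" "r \<le> s"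
    then show "M r \<le> M s"
      using primitive_onD(1)[OF Mp, of r s] Henstock_Kurzweil_Integration.integral_nonneg[OF primitive_onD(3)[OF Mp, of r s]] by auto
  qed
  have Ec: "E t = E s" if st: "a \<le> s" "s \<le> t" "t \<le> b" for s t
  proof -
    have c: "continuous_on {s..t} M" by (rule continuous_on_subset[OF primitive_on_continuous[OF Mp]]) (use st in auto)
    have m: "mono_on {s..t} M" by (rule mono_on_subset[OF mono]) (use st in auto)
    have "E t \<le> E s"
      by (rule quadratic_increment_imp_le[OF st(2) c m m, where K=3]) (use step st in \<open>force simp: abs_le_iff\<close>)
    moreover have "- E t \<le> - E s"
      by (rule quadratic_increment_imp_le[OF st(2) c m m, where K=3]) (use step st in \<open>force simp: abs_le_iff\<close>)
    ultimately show ?thesis by simp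
  qed
  show ?thesis
    unfolding primitive_on_def
  proof (intro conjI pi allI impI)
    fix s t assume st: "a \<le> s \<and> s \<le> t \<and> t \<le> b"
    then show "F t * G t - F s * G s = integral {s..t} ?p"
      using Ec[of s t] primitive_onD(1)[OF Pp, of s t] by (simp add: E_def)
  qed
qed

lemma primitive_on_cmult: 
  assumes "primitive_on a b F f" shows "primitive_on a b (\<lambda>y. k * F y) (\<lambda>y. k * f y)"
  unfolding primitive_on_def
proof (intro conjI allI impI)
  show "(\<lambda>y. k * f y) absolutely_integrable_on {a..b}"
    using assms by (auto simp: primitive_on_def)
  fix s t assume "a \<le> s \<and> s \<le> t \<and> t \<le> b"
  then show "k * F t - k * F s = integral {s..t} (\<lambda>y. k * f y)"
    using primitive_onD[OF assms, of s t] by (simp add: right_diff_distrib[symmetric])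
qed

lemma primitive_on_add:
  assumes F: "primitive_on a b F f" and G: "primitive_on a b G g"
  shows "primitive_on a b (\<lambda>y. F y + G y) (\<lambda>y. f y + g y)"
  unfolding primitive_on_def
proof (intro conjI allI impI)
  show "(\<lambda>y. f y + g y) absolutely_integrable_on {a..b}"
    using assms by (auto simp: primitive_on_def)
  fix s t assume st: "a \<le> s \<and> s \<le> t \<and> t \<le> b"
  then show "F t + G t - (F s + G s) = integral {s..t} (\<lambda>y. f y + g y)"
    using primitive_onD[OF F, of s t] primitive_onD[OF G, of s t]
    by (simp add: Henstock_Kurzweil_Integration.integral_add)
qed

lemma primitive_on_cong:
  assumes F: "primitive_on a b F f" and eq: "\<And>y. y \<in> {a..b} \<Longrightarrow> G y = F y"
    and ae: "AE y in lebesgue_on {a<..<b}. g y = f y"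
  shows "primitive_on a b G g"
proof -
  have "AE y in lebesgue. y \<in> {a<..<b} \<longrightarrow> g y = f y"
    using ae by (simp add: AE_restrict_space_iff)
  then obtain N where N: "{y. \<not> (y \<in> {a<..<b} \<longrightarrow> g y = f y)} \<subseteq> N" "N \<in> null_sets lebesgue"
    using AE_E2 by (auto simp: eventually_ae_filter)
  have neg: "negligible (N \<union> {a, b})" using N(2) by (simp add: negligible_iff_null_sets)
  have e: "y \<in> {a..b} - (N \<union> {a,b}) \<Longrightarrow> g y = f y" for y using N(1) by force
  show ?thesis unfolding primitive_on_def
  proof (intro conjI allI impI)
    show "g absolutely_integrable_on {a..b}"
      by (rule absolutely_integrable_spike[OF _ neg e]) (use F in \<open>auto simp: primitive_on_def\<close>)
    fix s t assume st: "a \<le> s \<and> s \<le> t \<and> t \<le> b"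
    have "integral {s..t} f = integral {s..t} g"
      by (rule integral_spike[OF neg]) (use e st in auto)
    then show "G t - G s = integral {s..t} g"
      using primitive_onD(1)[OF F, of s t] st eq by auto
  qed
qed

section \<open>Square integrable functions and weak gradients\<close>

text \<open>The quadratic polynomial \<open>\<integral> (t f - g)\<^sup>2\<close> in \<open>t\<close> is nonnegative, so its discriminant is not
  positive.\<close>

lemma integral_Cauchy_Schwarz:
  fixes f g :: "'a \<Rightarrow> real"
  assumes [measurable]: "f \<in> borel_measurable M" "g \<in> borel_measurable M"
    and f2: "integrable M (\<lambda>x. (f x)\<^sup>2)" and g2: "integrable M (\<lambda>x. (g x)\<^sup>2)"
  shows "integrable M (\<lambda>x. f x * g x)"
    and "(\<integral>x. f x * g x \<partial>M)\<^sup>2 \<le> (\<integral>x. (f x)\<^sup>2 \<partial>M) * (\<integral>x. (g x)\<^sup>2 \<partial>M)"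
proof -
  show fg: "integrable M (\<lambda>x. f x * g x)"
  proof (rule Bochner_Integration.integrable_bound[OF Bochner_Integration.integrable_add[OF f2 g2]])
    have "\<bar>a * b\<bar> \<le> \<bar>a\<^sup>2 + b\<^sup>2\<bar>" for a b :: real
    proof -
      have "2 * (\<bar>a\<bar> * \<bar>b\<bar>) \<le> a\<^sup>2 + b\<^sup>2" using sum_squares_bound[of "\<bar>a\<bar>" "\<bar>b\<bar>"] by simp
      moreover have "0 \<le> \<bar>a\<bar> * \<bar>b\<bar>" by simp
      ultimately have "\<bar>a\<bar> * \<bar>b\<bar> \<le> a\<^sup>2 + b\<^sup>2" by linarith
      then show ?thesis by (simp add: abs_mult)
    qed
    then show "AE x in M. norm (f x * g x) \<le> norm ((f x)\<^sup>2 + (g x)\<^sup>2)" by simp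
  qed simp
  define A B C where "A = (\<integral>x. (f x)\<^sup>2 \<partial>M)" "B = (\<integral>x. f x * g x \<partial>M)" "C = (\<integral>x. (g x)\<^sup>2 \<partial>M)"
  have q: "0 \<le> t\<^sup>2 * A - 2 * t * B + C" for t
  proof -
    have "0 \<le> (\<integral>x. (t * f x - g x)\<^sup>2 \<partial>M)" by simp
    also have "\<dots> = (\<integral>x. t\<^sup>2 * (f x)\<^sup>2 - 2 * t * (f x * g x) + (g x)\<^sup>2 \<partial>M)"
      by (rule Bochner_Integration.integral_cong) (auto simp: power2_eq_square algebra_simps)
    also have "\<dots> = t\<^sup>2 * A - 2 * t * B + C"
      unfolding A_B_C_def using f2 g2 fg by simp
    finally show ?thesis .
  qed
  have A0: "0 \<le> A" by (simp add: A_B_C_def)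
  have "B\<^sup>2 \<le> A * C"
  proof (cases "A = 0")
    case True
    have "B = 0"
    proof (rule ccontr)
      assume "B \<noteq> 0"
      then show False using q[of "(C + 1) / (2 * B)"] True by simp
    qed
    then show ?thesis using True by simp
  next
    case False
    then have "0 < A" using A0 by simp
    have "(B/A)\<^sup>2 * A - 2 * (B/A) * B + C = C - B\<^sup>2 / A"
      using False by (simp add: power2_eq_square field_simps)
    then have "0 \<le> C - B\<^sup>2 / A" using q[of "B/A"] by simp
    then show ?thesis using \<open>0 < A\<close> by (simp add: field_simps)
  qed
  then show "(\<integral>x. f x * g x \<partial>M)\<^sup>2 \<le> (\<integral>x. (f x)\<^sup>2 \<partial>M) * (\<integral>x. (g x)\<^sup>2 \<partial>M)"
    by (simp add: A_B_C_def)
qed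

lemma square_integrable_imp_integrable:
  fixes f :: "'a::euclidean_space \<Rightarrow> real"
  assumes "square_integrable U f" "bounded U" "U \<in> sets lebesgue"
  shows "integrable (lebesgue_on U) f"
proof -
  have "U \<in> lmeasurable" using assms(2,3) by (rule bounded_set_imp_lmeasurable)
  then have fin: "finite_measure (lebesgue_on U)" by (rule finite_measure_lebesgue_on)
  have c: "integrable (lebesgue_on U) (\<lambda>x. (1::real)\<^sup>2)"
    by (rule finite_measure.integrable_const[OF fin])
  have "integrable (lebesgue_on U) (\<lambda>x. f x * 1)"
    by (rule integral_Cauchy_Schwarz(1)[OF _ _ _ c]) (use assms(1) in \<open>simp_all add: square_integrable_def\<close>)
  then show ?thesis by simp
qed

lemma test_fun_measurable: "test_fun U \<psi> \<Longrightarrow> \<psi> \<in> borel_measurable (lebesgue_on S)"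
  by (intro measurable_restrict_space1 continuous_imp_lebesgue_measurable test_fun_continuous)

lemma test_fun_mult_integrable:
  assumes f: "integrable (lebesgue_on S) f" and t: "test_fun U \<psi>"
  shows "integrable (lebesgue_on S) (\<lambda>x. f x * \<psi> x)"
proof -
  obtain B where B: "0 < B" "\<And>x. \<bar>\<psi> x\<bar> \<le> B" using test_fun_bounded[OF t] by metis
  show ?thesis
  proof (rule Bochner_Integration.integrable_bound[OF Bochner_Integration.integrable_mult_right[OF f, of B]])
    show "(\<lambda>x. f x * \<psi> x) \<in> borel_measurable (lebesgue_on S)"
      using f test_fun_measurable[OF t] by (intro borel_measurable_times) auto
    show "AE x in lebesgue_on S. norm (f x * \<psi> x) \<le> norm (B * f x)"
    proof (rule AE_I2)
      fix x have "\<bar>f x\<bar> * \<bar>\<psi> x\<bar> \<le> \<bar>f x\<bar> * B" by (intro mult_left_mono B) simp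
      then show "norm (f x * \<psi> x) \<le> norm (B * f x)" using B(1) by (simp add: abs_mult mult.commute)
    qed
  qed
qed

lemma weak_gradient_unique:
  fixes U :: "'a::euclidean_space set"
  assumes U: "open U" "bounded U" and G: "H1_gradient U u G" "H1_gradient U u G'" and i: "i \<in> Basis"
  shows "AE x in lebesgue_on U. G x \<bullet> i = G' x \<bullet> i"
proof -
  have Um: "U \<in> sets lebesgue" using U(1) by auto
  have int: "integrable (lebesgue_on U) (\<lambda>x. G x \<bullet> i)" "integrable (lebesgue_on U) (\<lambda>x. G' x \<bullet> i)"
    using G i by (auto simp: H1_gradient_def intro!: square_integrable_imp_integrable U Um)
  have "AE x in lebesgue_on U. G x \<bullet> i - G' x \<bullet> i = 0"
  proof (rule fundamental_lemma[OF U(1)])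
    show "integrable (lebesgue_on U) (\<lambda>x. G x \<bullet> i - G' x \<bullet> i)" using int by simp
    fix \<psi> :: "'a \<Rightarrow> real" assume t: "test_fun U \<psi>"
    have "L2_inner U (\<lambda>x. G x \<bullet> i) \<psi> = L2_inner U (\<lambda>x. G' x \<bullet> i) \<psi>"
      using G i t by (auto simp: H1_gradient_def)
    then show "L2_inner U (\<lambda>x. G x \<bullet> i - G' x \<bullet> i) \<psi> = 0"
      using test_fun_mult_integrable[OF int(1) t] test_fun_mult_integrable[OF int(2) t]
      by (simp add: L2_inner_def left_diff_distrib)
  qed
  then show ?thesis by simp
qed


section \<open>Sobolev functions of one variable\<close>

lemma integrable_open_interval:
  fixes f :: "real \<Rightarrow> real"
  assumes "integrable (lebesgue_on {a<..<b}) f"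
  shows "f absolutely_integrable_on {a..b}" "(\<integral>x. f x \<partial>lebesgue_on {a<..<b}) = integral {a..b} f"
proof -
  have "f absolutely_integrable_on {a<..<b}"
    using assms by (simp add: set_integrable_def integrable_restrict_space)
  then show "f absolutely_integrable_on {a..b}"
    using absolutely_integrable_on_open_interval[of a b f] by simp
  show "(\<integral>x. f x \<partial>lebesgue_on {a<..<b}) = integral {a..b} f"
    using lebesgue_integral_eq_integral[OF assms] by (simp add: integral_open_interval_real)
qed

lemma integrable_open_intervalI:
  fixes f :: "real \<Rightarrow> real"
  assumes "f absolutely_integrable_on {a..b}"
  shows "integrable (lebesgue_on {a<..<b}) f"
proof -
  have "f absolutely_integrable_on {a<..<b}"
    using assms absolutely_integrable_on_open_interval[of a b f] by simp
  then show ?thesis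
    by (simp add: set_integrable_def integrable_restrict_space)
qed

lemma primitive_on_C1:
  assumes "\<And>x. (F has_field_derivative f x) (at x)" "continuous_on {a..b} f"
  shows "primitive_on a b F f"
  unfolding primitive_on_def
proof (intro conjI allI impI)
  show "f absolutely_integrable_on {a..b}"
    using assms(2) by (rule absolutely_integrable_continuous_real)
  fix s t assume st: "a \<le> s \<and> s \<le> t \<and> t \<le> b"
  have "(f has_integral F t - F s) {s..t}"
    by (rule fundamental_theorem_of_calculus)
      (use st assms(1) in \<open>auto simp: has_real_derivative_iff_has_vector_derivative[symmetric] intro: has_field_derivative_at_within\<close>)
  then show "F t - F s = integral {s..t} f" by (simp add: integral_unique)
qed

lemma test_fun_deriv_real:
  fixes \<psi> :: "real \<Rightarrow> real"
  assumes "test_fun U \<psi>"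
  shows "(\<psi> has_field_derivative partial_deriv 1 \<psi> x) (at x)"
proof -
  have "(\<psi> has_derivative frechet_derivative \<psi> (at x)) (at x)" by (rule test_fun_has_derivative[OF assms])
  moreover from has_derivative_linear[OF this] have "frechet_derivative \<psi> (at x) = (*) (partial_deriv 1 \<psi> x)"
    by (auto simp: partial_deriv_def linear_iff fun_eq_iff) (metis mult.commute mult.right_neutral real_scaleR_def)
  ultimately show ?thesis by (simp add: has_field_derivative_def)
qed

lemma test_fun_primitive:
  fixes \<psi> :: "real \<Rightarrow> real"
  assumes "test_fun U \<psi>"
  shows "primitive_on a b \<psi> (partial_deriv 1 \<psi>)"
proof (rule primitive_on_C1)
  show "continuous_on {a..b} (partial_deriv 1 \<psi>)"
    using continuous_on_subset[OF test_fun_continuous[OF test_fun_partial_deriv[OF assms, of 1]]] by simp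
qed (rule test_fun_deriv_real[OF assms])

text \<open>An antiderivative of a test function with vanishing integral is constant on both sides of the
  support, and the two constants agree. These are the test functions whose derivatives are used in
  the du Bois-Reymond argument.\<close>

lemma test_fun_antiderivative:
  fixes \<zeta> :: "real \<Rightarrow> real"
  assumes t: "test_fun {a<..<b} \<zeta>" and z: "integral {a..b} \<zeta> = 0" and ab: "a < b"
  obtains \<psi> where "test_fun {a<..<b} \<psi>" "partial_deriv 1 \<psi> = \<zeta>"
proof -
  have sm: "\<And>k. Ck_on k UNIV \<zeta>" using t by (auto simp: test_fun_def smooth_on_def)
  then have c: "continuous_on UNIV \<zeta>" using Ck_on.simps(1) by blast
  then have "\<exists>F. \<forall>x :: real. -\<infinity> < ereal x \<longrightarrow> ereal x < \<infinity> \<longrightarrow> (F has_vector_derivative \<zeta> x) (at x)"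
    by (intro einterval_antiderivative) (auto simp: continuous_on_eq_continuous_at)
  then obtain F where F: "\<And>x. (F has_field_derivative \<zeta> x) (at x)"
    by (auto simp: has_real_derivative_iff_has_vector_derivative)
  define \<psi> where "\<psi> x = F x - F a" for x
  have d: "(\<psi> has_field_derivative \<zeta> x) (at x)" for x
    unfolding \<psi>_def by (auto intro!: derivative_eq_intros F)
  have D: "partial_deriv 1 \<psi> x = \<zeta> x" for x
    using partial_deriv_eqI[OF d[unfolded has_field_derivative_def]] by simp
  have pr: "primitive_on a b \<psi> \<zeta>"
    using d c by (intro primitive_on_C1) (auto intro: continuous_on_subset)
  have ba: "\<psi> a = 0" "\<psi> b = 0"
    using primitive_onD(1)[OF pr, of a b] ab z by (auto simp: \<psi>_def)
  obtain p q where pq: "a < p" "p < q" "q < b" "{x. \<zeta> x \<noteq> 0} \<subseteq> {p..q}"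
  proof -
    let ?S = "insert ((a+b)/2) (closure {x. \<zeta> x \<noteq> 0})"
    have S: "compact ?S" "?S \<noteq> {}" "?S \<subseteq> {a<..<b}"
      using t ab by (auto simp: test_fun_def)
    obtain s where s: "s \<in> ?S" "\<And>x. x \<in> ?S \<Longrightarrow> s \<le> x" using compact_attains_inf[OF S(1,2)] by metis
    obtain r where r: "r \<in> ?S" "\<And>x. x \<in> ?S \<Longrightarrow> x \<le> r" using compact_attains_sup[OF S(1,2)] by metis
    have sr: "a < s" "s \<le> r" "r < b" using S(3) s r by auto
    have "{x. \<zeta> x \<noteq> 0} \<subseteq> {(a+s)/2..(r+b)/2}"
    proof
      fix x assume "x \<in> {x. \<zeta> x \<noteq> 0}"
      then have "x \<in> ?S" using closure_subset[of "{x. \<zeta> x \<noteq> 0}"] by auto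
      then have "s \<le> x" "x \<le> r" using s(2) r(2) by auto
      then show "x \<in> {(a+s)/2..(r+b)/2}" using sr by auto
    qed
    then show ?thesis using sr by (intro that[of "(a+s)/2" "(r+b)/2"]) auto
  qed
  have out: "\<psi> x = 0" if x: "x \<notin> {p..q}" for x
  proof -
    have z: "\<zeta> y = 0" if "y < p \<or> q < y" for y using pq(4) that by auto
    consider "x < p" | "q < x" using x by force
    then show ?thesis
    proof cases
      case 1
      obtain k where "\<forall>y\<in>{..<p}. \<psi> y = k"
        using has_field_derivative_zero_constant[of "{..<p}" \<psi>] d z
        by (metis convex_real_interval(4) has_field_derivative_at_within lessThan_iff)
      then show ?thesis using 1 pq(1) ba(1) by auto
    next
      case 2
      obtain k where "\<forall>y\<in>{q<..}. \<psi> y = k"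
        using has_field_derivative_zero_constant[of "{q<..}" \<psi>] d z
        by (metis convex_real_interval(3) has_field_derivative_at_within greaterThan_iff)
      then show ?thesis using 2 pq(3) ba(2) by auto
    qed
  qed
  have Ck: "Ck_on k UNIV \<psi>" for k
  proof (rule Ck_on_Suc_imp, rule Ck_on_SucI[OF d[unfolded has_field_derivative_def]])
    show "Ck_on k UNIV (\<lambda>x. \<zeta> x * i)" for i by (intro Ck_on_mult sm Ck_on_const)
  qed
  have sub: "{x. \<psi> x \<noteq> 0} \<subseteq> {p..q}" using out by blast
  then have cl: "closure {x. \<psi> x \<noteq> 0} \<subseteq> {p..q}" by (rule closure_minimal) simp
  have "bounded {x. \<psi> x \<noteq> 0}" by (rule bounded_subset[OF bounded_closed_interval sub])
  then have "test_fun {a<..<b} \<psi>"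
    using Ck cl pq by (auto simp: test_fun_def smooth_on_def compact_closure)
  then show ?thesis by (rule that) (use D in auto)
qed

lemma test_fun_lincomb:
  fixes f g :: "real \<Rightarrow> real"
  assumes "test_fun U f" "test_fun U g"
  shows "test_fun U (\<lambda>x. f x + k * g x)"
proof -
  have c: "\<And>k. Ck_on k UNIV f" "\<And>k. Ck_on k UNIV g" using assms by (auto simp: test_fun_def smooth_on_def)
  let ?S = "closure {x. f x \<noteq> 0} \<union> closure {x. g x \<noteq> 0}"
  have S: "compact ?S" "?S \<subseteq> U" using assms by (auto simp: test_fun_def)
  have sub: "{x. f x + k * g x \<noteq> 0} \<subseteq> ?S"
  proof
    fix x assume "x \<in> {x. f x + k * g x \<noteq> 0}"
    then have "f x \<noteq> 0 \<or> g x \<noteq> 0" by auto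
    then show "x \<in> ?S"
      using closure_subset[of "{x. f x \<noteq> 0}"] closure_subset[of "{x. g x \<noteq> 0}"] by auto
  qed
  have cl: "closure {x. f x + k * g x \<noteq> 0} \<subseteq> ?S" by (rule closure_minimal[OF sub]) auto
  have "bounded {x. f x + k * g x \<noteq> 0}" by (rule bounded_subset[OF compact_imp_bounded[OF S(1)] sub])
  then show ?thesis using cl S(2) c
    by (auto simp: test_fun_def smooth_on_def compact_closure intro!: Ck_on_add Ck_on_mult Ck_on_const)
qed

text \<open>The du Bois-Reymond argument. With \<open>W\<close> a primitive of the weak derivative, \<open>g - W\<close> is
  orthogonal to the derivatives of all test functions, hence to every test function with integral
  zero. Subtracting from an arbitrary test function a multiple of a fixed bump \<open>\<theta>\<close> reduces it to
  this case, so \<open>g - W\<close> minus a constant is orthogonal to all test functions.\<close>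

lemma H1_primitive:
  fixes g w :: "real \<Rightarrow> real"
  assumes ab: "a < b" and h: "H1_gradient {a<..<b} g w"
  shows "\<exists>W. primitive_on a b W w \<and> (AE y in lebesgue_on {a<..<b}. g y = W y)"
proof -
  have si: "square_integrable {a<..<b} g" "square_integrable {a<..<b} w"
    and weak: "\<And>\<psi>. test_fun {a<..<b} \<psi> \<Longrightarrow> L2_inner {a<..<b} g (partial_deriv 1 \<psi>) = - L2_inner {a<..<b} w \<psi>"
    using h by (auto simp: H1_gradient_def)
  have gi: "integrable (lebesgue_on {a<..<b}) g" and wi: "integrable (lebesgue_on {a<..<b}) w"
    using si by (auto intro!: square_integrable_imp_integrable)
  define W where "W y = 0 + integral {a..y} w" for y
  have W: "primitive_on a b W w"
    using primitive_on_integral[OF integrable_open_interval(1)[OF wi], of 0] by (simp add: W_def[abs_def])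
  have Wi: "integrable (lebesgue_on {a<..<b}) W"
    by (intro integrable_open_intervalI absolutely_integrable_continuous_real primitive_on_continuous[OF W])
  let ?L = "L2_inner {a<..<b}"
  have lin: "?L f (\<lambda>x. \<eta> x + k * \<theta> x) = ?L f \<eta> + k * ?L f \<theta>"
    if "integrable (lebesgue_on {a<..<b}) f" "test_fun {a<..<b} \<eta>" "test_fun {a<..<b} \<theta>" for f \<eta> \<theta> k
  proof -
    have "?L f (\<lambda>x. \<eta> x + k * \<theta> x) = (\<integral>x. f x * \<eta> x + k * (f x * \<theta> x) \<partial>lebesgue_on {a<..<b})"
      unfolding L2_inner_def by (rule Bochner_Integration.integral_cong) (auto simp: algebra_simps)
    also have "\<dots> = ?L f \<eta> + k * ?L f \<theta>"
      unfolding L2_inner_def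
      using test_fun_mult_integrable[OF that(1,2)] test_fun_mult_integrable[OF that(1,3)] by simp
    finally show ?thesis .
  qed
  define f where "f y = g y - W y" for y
  have fi: "integrable (lebesgue_on {a<..<b}) f" using gi Wi by (simp add: f_def[abs_def])
  have f': "?L f (partial_deriv 1 \<psi>) = 0" if t: "test_fun {a<..<b} \<psi>" for \<psi>
  proof -
    have t': "test_fun {a<..<b} (partial_deriv 1 \<psi>)" by (rule test_fun_partial_deriv[OF t]) simp
    have "?L f (partial_deriv 1 \<psi>) = ?L g (partial_deriv 1 \<psi>) - ?L W (partial_deriv 1 \<psi>)"
      using test_fun_mult_integrable[OF gi t'] test_fun_mult_integrable[OF Wi t']
      by (simp add: L2_inner_def f_def left_diff_distrib)
    also have "?L W (partial_deriv 1 \<psi>) = - ?L w \<psi>"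
    proof -
      have "\<psi> a = 0" "\<psi> b = 0" using test_fun_zero_outside[OF t] by auto
      then have "integral {a..b} (\<lambda>y. w y * \<psi> y + W y * partial_deriv 1 \<psi> y) = 0"
        using primitive_onD(1)[OF primitive_on_mult[OF W test_fun_primitive[OF t]], of a b] ab by simp
      moreover have "?L w \<psi> + ?L W (partial_deriv 1 \<psi>) = (\<integral>y. w y * \<psi> y + W y * partial_deriv 1 \<psi> y \<partial>lebesgue_on {a<..<b})"
        using test_fun_mult_integrable[OF wi t] test_fun_mult_integrable[OF Wi t'] by (simp add: L2_inner_def)
      moreover have "\<dots> = integral {a..b} (\<lambda>y. w y * \<psi> y + W y * partial_deriv 1 \<psi> y)"
        by (rule integrable_open_interval(2))
          (use test_fun_mult_integrable[OF wi t] test_fun_mult_integrable[OF Wi t'] in simp)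
      ultimately show ?thesis by simp
    qed
    finally show ?thesis using weak[OF t] by simp
  qed
  \<comment> \<open>The bump \<open>\<theta>\<close> lives on the middle half of the interval.\<close>
  define p q where "p = a + (b-a)/4" and "q = b - (b-a)/4"
  have pq: "a < p" "p < q" "q < b" using ab by (auto simp: p_def q_def field_simps)
  define \<theta> where "\<theta> = box_bump p q 0"
  have t\<theta>: "test_fun {a<..<b} \<theta>" unfolding \<theta>_def by (rule box_bump_test_fun) (use pq in auto)
  have c\<theta>: "continuous_on S \<theta>" for S by (rule continuous_on_subset[OF test_fun_continuous[OF t\<theta>]]) simp
  define I where "I = integral {a..b} \<theta>"
  have I: "0 < I"
  proof -
    have "0 \<le> I" unfolding I_def
      by (rule Henstock_Kurzweil_Integration.integral_nonneg[OF integrable_continuous_real[OF c\<theta>]])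
        (simp add: \<theta>_def box_bump_bounds)
    moreover have "I \<noteq> 0"
    proof
      assume "I = 0"
      have nn: "0 \<le> \<theta> x" for x by (simp add: \<theta>_def box_bump_bounds)
      have "\<forall>x\<in>{a..b}. \<theta> x = 0"
        using integral_eq_0_iff[OF c\<theta> ab nn] \<open>I = 0\<close> unfolding I_def by blast
      then have "\<theta> ((p+q)/2) = 0" using pq by auto
      then show False using box_bump_pos[of "(p+q)/2" p q 0] pq by (auto simp: \<theta>_def mem_box)
    qed
    ultimately show ?thesis by simp
  qed
  define K where "K = ?L f \<theta> / I"
  have "AE y in lebesgue_on {a<..<b}. f y - K = 0"
  proof (rule fundamental_lemma)
    have ki: "integrable (lebesgue_on {a<..<b}) (\<lambda>y. K)"
      by (intro integrable_open_intervalI) (rule absolutely_integrable_on_const, simp)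
    then show "integrable (lebesgue_on {a<..<b}) (\<lambda>y. f y - K)" using fi by simp
    fix \<eta> :: "real \<Rightarrow> real" assume t\<eta>: "test_fun {a<..<b} \<eta>"
    have c\<eta>: "continuous_on S \<eta>" for S by (rule continuous_on_subset[OF test_fun_continuous[OF t\<eta>]]) simp
    let ?J = "integral {a..b} \<eta>"
    \<comment> \<open>The multiple of \<open>\<theta>\<close> that makes the integral of \<open>?z\<close> vanish.\<close>
    let ?z = "\<lambda>x. \<eta> x + (- (?J / I)) * \<theta> x"
    have tz: "test_fun {a<..<b} ?z" by (rule test_fun_lincomb[OF t\<eta> t\<theta>])
    have "integral {a..b} ?z = ?J + (- (?J / I)) * I"
      unfolding I_def Henstock_Kurzweil_Integration.integral_mult_right[symmetric]
      by (rule Henstock_Kurzweil_Integration.integral_add)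
        (intro integrable_continuous_real continuous_on_mult_left c\<eta> c\<theta>)+
    also have "\<dots> = 0" using I by simp
    finally have iz: "integral {a..b} ?z = 0" .
    obtain \<psi> where \<psi>: "test_fun {a<..<b} \<psi>" "partial_deriv 1 \<psi> = ?z"
      using test_fun_antiderivative[OF tz iz ab] by blast
    have "?L f \<eta> = ?J * K"
      using f'[OF \<psi>(1)] lin[OF fi t\<eta> t\<theta>, of "- (?J / I)"] by (simp add: \<psi>(2) K_def)
    moreover have "?L (\<lambda>y. f y - K) \<eta> = ?L f \<eta> - ?L (\<lambda>y. K) \<eta>"
      using test_fun_mult_integrable[OF fi t\<eta>] test_fun_mult_integrable[OF ki t\<eta>]
      by (simp add: L2_inner_def left_diff_distrib)
    moreover have "?L (\<lambda>y. K) \<eta> = K * ?J"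
      using integrable_open_interval(2)[OF test_fun_mult_integrable[OF ki t\<eta>]] by (simp add: L2_inner_def)
    ultimately show "?L (\<lambda>y. f y - K) \<eta> = 0" by simp
  qed simp
  then have "AE y in lebesgue_on {a<..<b}. g y = K + W y" by eventually_elim (simp add: f_def)
  moreover have "primitive_on a b (\<lambda>y. K + W y) w"
    using primitive_on_integral[OF integrable_open_interval(1)[OF wi], of K] by (simp add: W_def[abs_def])
  ultimately show ?thesis by blast
qed

lemma continuous_AE_eq_imp_eq:
  fixes f g :: "real \<Rightarrow> real"
  assumes ab: "a < b" and f: "continuous_on {a..b} f" and g: "continuous_on {a..b} g"
    and ae: "AE y in lebesgue_on {a<..<b}. f y = g y" and y: "y \<in> {a..b}"
  shows "f y = g y"
proof -
  let ?S = "{y\<in>{a<..<b}. f y - g y \<noteq> 0}"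
  have "continuous_on {a<..<b} (\<lambda>y. f y - g y)"
    by (intro continuous_on_diff continuous_on_subset[OF f] continuous_on_subset[OF g]) auto
  then have "open ({a<..<b} \<inter> (\<lambda>y. f y - g y) -` (- {0}))"
    by (rule continuous_open_preimage) auto
  moreover have "?S = {a<..<b} \<inter> (\<lambda>y. f y - g y) -` (- {0})" by auto
  ultimately have op: "open ?S" by simp
  have "AE y in lebesgue. y \<in> {a<..<b} \<longrightarrow> f y = g y"
    using ae by (simp add: AE_restrict_space_iff)
  then have "AE y in lebesgue. y \<notin> ?S" by eventually_elim auto
  then have "?S \<in> null_sets lebesgue"
    using op by (subst (asm) AE_iff_null_sets[symmetric]) auto
  then have "negligible ?S" by (simp add: negligible_iff_null_sets)
  then have "?S = {}" using open_not_negligible[OF op] by blast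
  then have eq: "f y - g y = 0" if "y \<in> {a<..<b}" for y using that by auto
  have "f y - g y = 0"
    by (rule continuous_constant_on_closure[of "{a<..<b}" "\<lambda>y. f y - g y"])
      (use eq ab y f g in \<open>auto intro!: continuous_intros\<close>)
  then show ?thesis by simp
qed

lemma test_fun_square_integrable:
  assumes t: "test_fun V \<psi>" and U: "bounded U" "U \<in> sets lebesgue"
  shows "square_integrable U \<psi>"
proof -
  have "finite_measure (lebesgue_on U)"
    by (rule finite_measure_lebesgue_on[OF bounded_set_imp_lmeasurable[OF U]])
  then have "integrable (lebesgue_on U) (\<lambda>x. 1)" by (rule finite_measure.integrable_const)
  from test_fun_mult_integrable[OF test_fun_mult_integrable[OF this t] t]
  show ?thesis using test_fun_measurable[OF t] by (simp add: square_integrable_def power2_eq_square)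
qed

lemma square_integrable_diff:
  assumes "square_integrable U f" "square_integrable U g"
  shows "square_integrable U (\<lambda>x. f x - g x)"
proof -
  have "integrable (lebesgue_on U) (\<lambda>x. f x * g x)"
    by (rule integral_Cauchy_Schwarz(1)) (use assms in \<open>auto simp: square_integrable_def\<close>)
  then have "integrable (lebesgue_on U) (\<lambda>x. (f x)\<^sup>2 + (g x)\<^sup>2 - 2 * (f x * g x))"
    using assms by (simp add: square_integrable_def)
  then show ?thesis using assms
    by (auto simp: square_integrable_def power2_diff mult.assoc intro!: borel_measurable_diff)
qed

lemma L2_tendsto_L2_inner:
  assumes f: "\<And>n. square_integrable U (f n)" and g: "square_integrable U g" and h: "square_integrable U h"
    and lim: "(\<lambda>n. L2_norm U (\<lambda>x. f n x - g x)) \<longlonglongrightarrow> 0"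
  shows "(\<lambda>n. L2_inner U (f n) h) \<longlonglongrightarrow> L2_inner U g h"
proof -
  have int: "integrable (lebesgue_on U) (\<lambda>x. k x * h x)" if "square_integrable U k" for k
    by (rule integral_Cauchy_Schwarz(1)) (use that h in \<open>auto simp: square_integrable_def\<close>)
  have b: "\<bar>L2_inner U (f n) h - L2_inner U g h\<bar> \<le> L2_norm U (\<lambda>x. f n x - g x) * L2_norm U h" for n
  proof -
    have d: "square_integrable U (\<lambda>x. f n x - g x)" by (rule square_integrable_diff[OF f g])
    have "L2_inner U (f n) h - L2_inner U g h = (\<integral>x. (f n x - g x) * h x \<partial>lebesgue_on U)"
      using int[OF f] int[OF g] by (simp add: L2_inner_def left_diff_distrib)
    moreover have "(\<integral>x. (f n x - g x) * h x \<partial>lebesgue_on U)\<^sup>2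
      \<le> (\<integral>x. (f n x - g x)\<^sup>2 \<partial>lebesgue_on U) * (\<integral>x. (h x)\<^sup>2 \<partial>lebesgue_on U)"
      by (rule integral_Cauchy_Schwarz(2)) (use d h in \<open>auto simp: square_integrable_def\<close>)
    ultimately have "(L2_inner U (f n) h - L2_inner U g h)\<^sup>2
      \<le> L2_inner U (\<lambda>x. f n x - g x) (\<lambda>x. f n x - g x) * L2_inner U h h"
      by (simp add: L2_inner_def power2_eq_square)
    then show ?thesis
      unfolding L2_norm_def real_sqrt_mult[symmetric] by (intro real_le_rsqrt) simp
  qed
  have "(\<lambda>n. L2_norm U (\<lambda>x. f n x - g x) * L2_norm U h) \<longlonglongrightarrow> 0 * L2_norm U h"
    by (intro tendsto_intros lim)
  then have lim0: "(\<lambda>n. L2_norm U (\<lambda>x. f n x - g x) * L2_norm U h) \<longlonglongrightarrow> 0" by simp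
  have "(\<lambda>n. L2_inner U (f n) h - L2_inner U g h) \<longlonglongrightarrow> 0"
    by (rule Lim_null_comparison[OF _ lim0]) (simp add: b)
  then show ?thesis by (simp add: LIM_zero_iff)
qed

text \<open>The boundary values are read off from the approximating test functions \<open>\<psi> n\<close>. Pairing
  \<open>\<psi> n'\<close> with the constant \<open>1\<close> gives \<open>u b - u a = 0\<close> in the limit. Pairing it with the identity gives
  \<open>- \<integral> \<psi> n\<close>, so in the limit the boundary term \<open>b u b - a u a\<close> of the partial integration
  vanishes as well.\<close>

lemma H10_primitive:
  fixes u u' :: "real \<Rightarrow> real"
  assumes ab: "a < b" and h: "H10_gradient {a<..<b} u u'" and cu: "continuous_on {a..b} u"
  shows "primitive_on a b u u'" "u a = 0" "u b = 0"
proof -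
  let ?U = "{a<..<b}"
  have h1: "H1_gradient ?U u u'" using h by (simp add: H10_gradient_def)
  then have si: "square_integrable ?U u" "square_integrable ?U u'" by (auto simp: H1_gradient_def)
  obtain W where W: "primitive_on a b W u'" "AE y in lebesgue_on ?U. u y = W y"
    using H1_primitive[OF ab h1] by blast
  have eq: "u y = W y" if "y \<in> {a..b}" for y
    by (rule continuous_AE_eq_imp_eq[OF ab cu primitive_on_continuous[OF W(1)] W(2) that])
  show pu: "primitive_on a b u u'"
    by (rule primitive_on_cong[OF W(1) eq]) auto
  obtain \<psi> where \<psi>: "\<And>n. test_fun ?U (\<psi> n)"
    "(\<lambda>n. L2_norm ?U (\<lambda>x. \<psi> n x - u x)) \<longlonglongrightarrow> 0"
    "(\<lambda>n. L2_norm ?U (\<lambda>x. partial_deriv 1 (\<psi> n) x - u' x)) \<longlonglongrightarrow> 0"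
    using h by (auto simp: H10_gradient_def)
  have t': "test_fun ?U (partial_deriv 1 (\<psi> n))" for n by (rule test_fun_partial_deriv[OF \<psi>(1)]) simp
  have s\<psi>: "square_integrable ?U (\<psi> n)" "square_integrable ?U (partial_deriv 1 (\<psi> n))" for n
    by (auto intro: test_fun_square_integrable[OF \<psi>(1)] test_fun_square_integrable[OF t'])
  have ai: "k absolutely_integrable_on {a..b}" if "square_integrable ?U k" for k :: "real \<Rightarrow> real"
    by (intro integrable_open_interval(1) square_integrable_imp_integrable[OF that]) auto
  have inner: "L2_inner ?U k h = integral {a..b} (\<lambda>y. k y * h y)"
    if "square_integrable ?U k" "square_integrable ?U h" for k h :: "real \<Rightarrow> real"
    unfolding L2_inner_def
    by (rule integrable_open_interval(2), rule integral_Cauchy_Schwarz(1)) (use that in \<open>auto simp: square_integrable_def\<close>)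
  have sc: "square_integrable ?U k" if "continuous_on {a..b} k" for k :: "real \<Rightarrow> real"
    unfolding square_integrable_def
    using integrable_open_intervalI[OF absolutely_integrable_continuous_real[OF that]]
      integrable_open_intervalI[OF absolutely_integrable_continuous_real[of a b "\<lambda>x. (k x)\<^sup>2"]] that
    by (auto intro!: continuous_intros)
  have s1: "square_integrable ?U (\<lambda>y. 1)" and sid: "square_integrable ?U (\<lambda>y. y)"
    by (auto intro!: sc continuous_intros)
  have z: "\<psi> n a = 0" "\<psi> n b = 0" for n using test_fun_zero_outside[OF \<psi>(1)] by auto
  have p\<psi>: "primitive_on a b (\<psi> n) (partial_deriv 1 (\<psi> n))" for n by (rule test_fun_primitive[OF \<psi>(1)])
  have pid: "primitive_on a b (\<lambda>y. y) (\<lambda>y. 1)"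
    by (rule primitive_on_C1) (auto intro!: derivative_eq_intros)
  have ii: "k integrable_on {a..b}" if "k absolutely_integrable_on {a..b}" for k :: "real \<Rightarrow> real"
    using that by (rule set_lebesgue_integral_eq_integral(1))
  have "(\<lambda>n. L2_inner ?U (partial_deriv 1 (\<psi> n)) (\<lambda>y. 1)) \<longlonglongrightarrow> L2_inner ?U u' (\<lambda>y. 1)"
    by (rule L2_tendsto_L2_inner[OF s\<psi>(2) si(2) s1 \<psi>(3)])
  moreover have "L2_inner ?U (partial_deriv 1 (\<psi> n)) (\<lambda>y. 1) = 0" for n
    using primitive_onD(1)[OF p\<psi>, of a b n] ab by (simp add: inner[OF s\<psi>(2) s1] z)
  moreover have "L2_inner ?U u' (\<lambda>y. 1) = u b - u a"
    using primitive_onD(1)[OF pu, of a b] ab by (simp add: inner[OF si(2) s1])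
  ultimately have e1: "u b = u a" by (simp add: LIMSEQ_const_iff)
  have by_parts: "integral {a..b} (\<lambda>y. k' y * y) = b * k b - a * k a - integral {a..b} k"
    if "primitive_on a b k k'" "square_integrable ?U k'" for k k' :: "real \<Rightarrow> real"
  proof -
    have "integral {a..b} (\<lambda>y. k' y * y + k y * 1) = b * k b - a * k a"
      using primitive_onD(1)[OF primitive_on_mult[OF that(1) pid], of a b] ab by (simp add: mult.commute)
    moreover have "integral {a..b} (\<lambda>y. k' y * y + k y * 1) = integral {a..b} (\<lambda>y. k' y * y) + integral {a..b} k"
    proof -
      have "(\<lambda>y. k' y * y) integrable_on {a..b}"
        by (intro ii integrable_open_interval(1) integral_Cauchy_Schwarz(1))
          (use that(2) sid in \<open>auto simp: square_integrable_def\<close>)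
      moreover have "k integrable_on {a..b}"
        by (rule integrable_continuous_real[OF primitive_on_continuous[OF that(1)]])
      ultimately show ?thesis by (simp add: Henstock_Kurzweil_Integration.integral_add)
    qed
    ultimately show ?thesis by simp
  qed
  have "(\<lambda>n. L2_inner ?U (partial_deriv 1 (\<psi> n)) (\<lambda>y. y)) \<longlonglongrightarrow> L2_inner ?U u' (\<lambda>y. y)"
    by (rule L2_tendsto_L2_inner[OF s\<psi>(2) si(2) sid \<psi>(3)])
  moreover have "L2_inner ?U (partial_deriv 1 (\<psi> n)) (\<lambda>y. y) = - L2_inner ?U (\<psi> n) (\<lambda>y. 1)" for n
    using by_parts[OF p\<psi> s\<psi>(2)] by (simp add: inner[OF s\<psi>(2) sid] inner[OF s\<psi>(1) s1] z)
  moreover have "(\<lambda>n. - L2_inner ?U (\<psi> n) (\<lambda>y. 1)) \<longlonglongrightarrow> - L2_inner ?U u (\<lambda>y. 1)"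
    by (intro tendsto_minus L2_tendsto_L2_inner[OF s\<psi>(1) si(1) s1 \<psi>(2)])
  ultimately have "L2_inner ?U u' (\<lambda>y. y) = - L2_inner ?U u (\<lambda>y. 1)"
    by (simp add: LIMSEQ_unique)
  then have "b * u b - a * u a = 0"
    using by_parts[OF pu si(2)] by (simp add: inner[OF si(2) sid] inner[OF si(1) s1])
  then have "(b - a) * u a = 0" using e1 by (simp add: algebra_simps)
  then show "u a = 0" using ab by simp
  then show "u b = 0" using e1 by simp
qed

section \<open>Eigenfunctions as solutions of a first order system\<close>

lemma flux_exists:
  assumes H: "0 < H" and u: "A_eigenfunction H c m lam u"
  shows "\<exists>q. flux H c u q"
proof -
  obtain u' w where uw: "H10_gradient {0<..<H} u u'" "H1_gradient {0<..<H} (\<lambda>y. c y * u' y) w"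
    using u by (auto simp: A_eigenfunction_def A_op_def)
  obtain W where W: "primitive_on 0 H W w" "AE y in lebesgue_on {0<..<H}. c y * u' y = W y"
    using H1_primitive[OF H uw(2)] by blast
  have "flux H c u W"
    unfolding flux_def using primitive_on_continuous[OF W(1)] uw(1) W(2)
    by (auto simp: H10_gradient_def)
  then show ?thesis by blast
qed

text \<open>The equations are stated for a representative \<open>f\<close> of \<open>c\<close> that is bounded below everywhere, so
  that their right-hand sides can be estimated pointwise.\<close>

lemma eigenfunction_primitives:
  assumes H: "0 < H" and cm: "0 < cm" and f: "\<And>y. cm \<le> f y"
    and cf: "AE y in lebesgue_on {0<..<H}. c y = f y"
    and u: "A_eigenfunction H c m lam u" and q: "flux H c u q"
  shows "primitive_on 0 H u (\<lambda>y. q y / f y)"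
    and "primitive_on 0 H q (\<lambda>y. (f y * m\<^sup>2 - lam) * u y)"
    and "u 0 = 0" and "u H = 0" and "integral {0..H} (\<lambda>y. (u y)\<^sup>2) = 1"
proof -
  obtain u' w where uw: "H10_gradient {0<..<H} u u'" "H1_gradient {0<..<H} (\<lambda>y. c y * u' y) w"
      "AE y in lebesgue_on {0<..<H}. lam * u y = c y * m\<^sup>2 * u y - w y"
    and n: "L2_norm {0<..<H} u = 1" and cu: "continuous_on {0..H} u"
    using u by (auto simp: A_eigenfunction_def A_op_def)
  have h1: "H1_gradient {0<..<H} u u'" using uw(1) by (simp add: H10_gradient_def)
  note U = H10_primitive[OF H uw(1) cu]
  show "u 0 = 0" "u H = 0" by (fact U(2) U(3))+
  obtain W where W: "primitive_on 0 H W w" "AE y in lebesgue_on {0<..<H}. c y * u' y = W y"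
    using H1_primitive[OF H uw(2)] by blast
  obtain u'' where u'': "H1_gradient {0<..<H} u u''" "AE y in lebesgue_on {0<..<H}. q y = c y * u'' y"
    and cq: "continuous_on {0..H} q" using q by (auto simp: flux_def)
  have "AE y in lebesgue_on {0<..<H}. u' y = u'' y"
    using weak_gradient_unique[OF _ _ h1 u''(1), of 1] by simp
  then have qc: "AE y in lebesgue_on {0<..<H}. q y = c y * u' y"
    using u''(2) by eventually_elim simp
  then have qW: "AE y in lebesgue_on {0<..<H}. q y = W y"
    using W(2) by eventually_elim simp
  have "q y = W y" if "y \<in> {0..H}" for y
    by (rule continuous_AE_eq_imp_eq[OF H cq primitive_on_continuous[OF W(1)] qW that])
  moreover have "AE y in lebesgue_on {0<..<H}. (f y * m\<^sup>2 - lam) * u y = w y"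
    using uw(3) cf by eventually_elim (simp add: algebra_simps)
  ultimately show "primitive_on 0 H q (\<lambda>y. (f y * m\<^sup>2 - lam) * u y)"
    by (rule primitive_on_cong[OF W(1)])
  have f0: "f y \<noteq> 0" for y using f[of y] cm by simp
  have "AE y in lebesgue_on {0<..<H}. q y / f y = u' y"
    using qc cf by eventually_elim (use f0 in simp)
  then show "primitive_on 0 H u (\<lambda>y. q y / f y)"
    by (rule primitive_on_cong[OF U(1) refl])
  have s: "square_integrable {0<..<H} u" using h1 by (simp add: H1_gradient_def)
  have "integral {0..H} (\<lambda>y. (u y)\<^sup>2) = L2_inner {0<..<H} u u"
    using integrable_open_interval(2)[of 0 H "\<lambda>y. (u y)\<^sup>2"] s
    by (simp add: square_integrable_def L2_inner_def power2_eq_square)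
  also have "\<dots> = 1" using n by (simp add: L2_norm_def)
  finally show "integral {0..H} (\<lambda>y. (u y)\<^sup>2) = 1" .
qed

section \<open>Coefficients of bounded variation\<close>

text \<open>The function \<open>v x\<close> is the supremum of the variation sums of \<open>f\<close> over partitions of \<open>[0, x]\<close>.
  Appending \<open>x\<close> and \<open>y\<close> to a partition of \<open>[0, x]\<close> gives the increment estimate.\<close>

lemma variation_function:
  fixes f :: "real \<Rightarrow> real"
  assumes H: "0 \<le> H" and V: "pointwise_variation H f \<le> ereal V"
  obtains v where "\<And>s t. 0 \<le> s \<Longrightarrow> s \<le> t \<Longrightarrow> t \<le> H \<Longrightarrow> \<bar>f t - f s\<bar> \<le> v t - v s" "v H - v 0 \<le> V"
proof -
  define S where "S n t = (\<Sum>i<n. \<bar>f (t (Suc i)) - f (t i)\<bar>)" for n :: nat and t :: "nat \<Rightarrow> real"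
  define P where "P x = {S n t |n t. mono_on {..n} t \<and> t ` {..n} \<subseteq> {0..x}}" for x
  define v where "v x = Sup (P x)" for x
  have le: "r \<le> V" if rP: "r \<in> P x" and xH: "x \<le> H" for r x
  proof -
    obtain n t where nt: "r = S n t" "mono_on {..n} t" "t ` {..n} \<subseteq> {0..x}" using rP unfolding P_def by blast
    have "ereal (S n t) \<le> pointwise_variation H f"
      unfolding pointwise_variation_def S_def
      by (rule SUP_upper2[where i="(n, t)"]) (use nt xH in auto)
    then show ?thesis using V nt(1) by (metis ereal_less_eq(3) order_trans)
  qed
  have bdd: "bdd_above (P x)" if "x \<le> H" for x by (rule bdd_aboveI[of _ V]) (rule le[OF _ that])
  have ne: "0 \<in> P x" if "0 \<le> x" for x
  proof -
    have "0 = S 0 (\<lambda>_. 0) \<and> mono_on {..0::nat} (\<lambda>_. 0::real) \<and> (\<lambda>_. 0) ` {..0::nat} \<subseteq> {0..x}"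
      using that by (auto simp: S_def monotone_on_def)
    then show ?thesis unfolding P_def by blast
  qed
  have inc: "\<bar>f y - f x\<bar> \<le> v y - v x" if xy: "0 \<le> x" "x \<le> y" "y \<le> H" for x y
  proof -
    have "r \<le> v y - \<bar>f y - f x\<bar>" if r: "r \<in> P x" for r
    proof -
      obtain n t where nt: "r = S n t" "mono_on {..n} t" "t ` {..n} \<subseteq> {0..x}" using r unfolding P_def by blast
      \<comment> \<open>The given partition followed by \<open>x\<close> and \<open>y\<close>; the increment from \<open>t n\<close> to \<open>x\<close> is dropped.\<close>
      define t' where "t' i = (if i \<le> n then t i else if i = Suc n then x else y)" for i
      have "S (Suc (Suc n)) t' = (\<Sum>i<n. \<bar>f (t' (Suc i)) - f (t' i)\<bar>) + \<bar>f x - f (t n)\<bar> + \<bar>f y - f x\<bar>"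
        by (simp add: S_def t'_def)
      also have "(\<Sum>i<n. \<bar>f (t' (Suc i)) - f (t' i)\<bar>) = r"
        unfolding nt(1) S_def by (rule sum.cong) (auto simp: t'_def)
      finally have ge: "r + \<bar>f y - f x\<bar> \<le> S (Suc (Suc n)) t'" by simp
      have tb: "0 \<le> t i" "t i \<le> x" if "i \<le> n" for i using nt(3) that by auto
      have "mono_on {..Suc (Suc n)} t'"
      proof (rule mono_onI)
        fix i j :: nat assume "i \<in> {..Suc (Suc n)}" "j \<in> {..Suc (Suc n)}" "i \<le> j"
        then show "t' i \<le> t' j"
          using tb[of i] mono_onD[OF nt(2), of i j] xy by (auto simp: t'_def)
      qed
      moreover have "t' ` {..Suc (Suc n)} \<subseteq> {0..y}"
      proof
        fix z assume "z \<in> t' ` {..Suc (Suc n)}"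
        then obtain i where "z = t' i" by auto
        then show "z \<in> {0..y}" using tb[of i] xy by (auto simp: t'_def)
      qed
      ultimately have "S (Suc (Suc n)) t' \<in> P y" unfolding P_def by blast
      then have "S (Suc (Suc n)) t' \<le> v y" unfolding v_def by (rule cSup_upper[OF _ bdd[OF xy(3)]])
      with ge show ?thesis by simp
    qed
    moreover have "P x \<noteq> {}" using ne[OF xy(1)] by blast
    ultimately have "v x \<le> v y - \<bar>f y - f x\<bar>" unfolding v_def[of x] by (rule cSup_least[rotated])
    then show ?thesis by simp
  qed
  have "v H \<le> V" unfolding v_def using ne[OF H] by (intro cSup_least le) auto
  moreover have "0 \<le> v 0" unfolding v_def using H by (intro cSup_upper ne bdd) auto
  ultimately show ?thesis using inc that[of v] by auto
qed

lemma coeff_class_AE_bounds: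
  assumes c: "c \<in> coeff_class H cm cM"
  shows "AE y in lebesgue_on {0..H}. cm \<le> c y \<and> c y \<le> cM"
proof -
  have 1: "AE y in lebesgue_on {0..H}. ereal (c y) \<le> ereal cM"
    using esssup_AE[of "\<lambda>y. ereal (c y)" "lebesgue_on {0..H}"] c by (simp add: coeff_class_def)
  have "- esssup (lebesgue_on {0..H}) (\<lambda>y. - ereal (c y)) = ereal cm" using c by (simp add: coeff_class_def)
  then have "esssup (lebesgue_on {0..H}) (\<lambda>y. - ereal (c y)) = - ereal cm" 
    by (metis ereal_uminus_uminus)
  then have 2: "AE y in lebesgue_on {0..H}. - ereal (c y) \<le> - ereal cm"
    using esssup_AE[of "\<lambda>y. - ereal (c y)" "lebesgue_on {0..H}"] by simp
  from 1 2 show ?thesis by eventually_elim auto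
qed

text \<open>The total variation is an infimum over representatives that need not be attained, whence
  the bound \<open>V + 1\<close>. Clamping a representative to \<open>[cm, cM]\<close> changes it on a null set only and
  does not increase its increments.\<close>

lemma coeff_class_TV_representative:
  assumes H: "0 < H" and cc: "cm \<le> cM" and c: "c \<in> coeff_class_TV H cm cM V"
  obtains f v where "\<And>y. cm \<le> f y" "\<And>y. f y \<le> cM" "AE y in lebesgue_on {0<..<H}. c y = f y"
    "\<And>s t. 0 \<le> s \<Longrightarrow> s \<le> t \<Longrightarrow> t \<le> H \<Longrightarrow> \<bar>f t - f s\<bar> \<le> v t - v s" "v H - v 0 \<le> V + 1"
proof -
  have cl: "c \<in> coeff_class H cm cM" and tv: "total_variation H c \<le> ereal V"
    using c by (auto simp: coeff_class_TV_def)
  have "total_variation H c < ereal (V + 1)" by (rule le_less_trans[OF tv]) simp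
  then obtain g where g: "AE y in lebesgue_on {0..H}. g y = c y" "pointwise_variation H g < ereal (V + 1)"
    by (auto simp: total_variation_def INF_less_iff)
  obtain v where v: "\<And>s t. 0 \<le> s \<Longrightarrow> s \<le> t \<Longrightarrow> t \<le> H \<Longrightarrow> \<bar>g t - g s\<bar> \<le> v t - v s" "v H - v 0 \<le> V + 1"
    using variation_function[of H g "V + 1"] H g(2) by force
  define f where "f y = max cm (min cM (g y))" for y
  show ?thesis
  proof (rule that[of f v])
    show "cm \<le> f y" "f y \<le> cM" for y using cc by (auto simp: f_def)
    have "AE y in lebesgue_on {0..H}. c y = f y"
      using g(1) coeff_class_AE_bounds[OF cl] by eventually_elim (auto simp: f_def)
    then show "AE y in lebesgue_on {0<..<H}. c y = f y"
      by (simp add: AE_restrict_space_iff) (auto elim: eventually_mono)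
    show "\<bar>f t - f s\<bar> \<le> v t - v s" if "0 \<le> s" "s \<le> t" "t \<le> H" for s t
    proof -
      have "\<bar>f t - f s\<bar> \<le> \<bar>g t - g s\<bar>" by (simp add: f_def max_def min_def)
      then show ?thesis using v(1)[OF that] by simp
    qed
  qed (rule v(2))
qed

section \<open>Energy of an eigenfunction\<close>

lemma primitive_on_ge:
  assumes F: "primitive_on a b F g" and st: "a \<le> s" "s \<le> t" "t \<le> b"
    and k: "\<And>y. s \<le> y \<Longrightarrow> y \<le> t \<Longrightarrow> k \<le> g y"
  shows "k * (t - s) \<le> F t - F s"
proof -
  have "integral {s..t} (\<lambda>y. k) \<le> integral {s..t} g"
    by (rule integral_le) (use primitive_onD(3)[OF F st] k in auto)
  then show ?thesis using primitive_onD(1)[OF F st] st(2) by (simp add: mult.commute)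
qed

lemma primitive_on_abs_le:
  assumes F: "primitive_on a b F g" and st: "a \<le> s" "s \<le> t" "t \<le> b"
    and k: "\<And>y. s \<le> y \<Longrightarrow> y \<le> t \<Longrightarrow> \<bar>g y\<bar> \<le> k"
  shows "\<bar>F t - F s\<bar> \<le> k * (t - s)"
proof -
  have "norm (integral {s..t} g) \<le> integral {s..t} (\<lambda>y. k)"
    by (rule integral_norm_bound_integral) (use primitive_onD(3)[OF F st] k in auto)
  then show ?thesis using primitive_onD(1)[OF F st] st(2) by (simp add: mult.commute)
qed

text \<open>The first order system satisfied by an eigenfunction \<open>u\<close> and its flux \<open>q\<close>, with the coefficient
  \<open>f\<close> bounded pointwise.\<close>

locale eigen_system =
  fixes H cm cM \<epsilon> m lam :: real and f u q :: "real \<Rightarrow> real"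
  assumes H: "0 < H" and cm: "0 < cm" and \<epsilon>: "0 < \<epsilon>" and m: "0 < m"
    and f_ge: "\<And>y. cm \<le> f y" and f_le: "\<And>y. f y \<le> cM"
    and lam: "(cM + \<epsilon>) * m\<^sup>2 \<le> lam"
    and u: "primitive_on 0 H u (\<lambda>y. q y / f y)"
    and q: "primitive_on 0 H q (\<lambda>y. (f y * m\<^sup>2 - lam) * u y)"
    and u0: "u 0 = 0" and uH: "u H = 0"
    and norm_u: "integral {0..H} (\<lambda>y. (u y)\<^sup>2) = 1"
begin

text \<open>The smallest possible value of \<open>(lam - f m\<^sup>2) / lam\<close> under the spectral gap condition
  \<open>lam \<ge> (cM + \<epsilon>) m\<^sup>2\<close>.\<close>

definition \<kappa> where "\<kappa> = \<epsilon> / (cM + \<epsilon>)"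

lemma cM: "0 < cM" using cm f_ge[of 0] f_le[of 0] by linarith

lemma \<kappa>: "0 < \<kappa>" using cM \<epsilon> by (simp add: \<kappa>_def)

lemma lam_pos: "0 < lam"
proof -
  have "0 < (cM + \<epsilon>) * m\<^sup>2" using cM \<epsilon> m by simp
  then show ?thesis using lam by linarith
qed

lemma f_pos: "0 < f y" using cm f_ge[of y] by linarith

lemma p_ge: "\<epsilon> * m\<^sup>2 \<le> lam - f y * m\<^sup>2" "\<kappa> * lam \<le> lam - f y * m\<^sup>2" "lam - f y * m\<^sup>2 \<le> lam"
proof -
  have fm: "f y * m\<^sup>2 \<le> cM * m\<^sup>2" by (intro mult_right_mono f_le) simp
  show "\<epsilon> * m\<^sup>2 \<le> lam - f y * m\<^sup>2" using lam fm by (simp add: algebra_simps)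
  have "cM * m\<^sup>2 * (cM + \<epsilon>) \<le> cM * lam" using lam cM by (simp add: mult.assoc mult.commute)
  then have "cM * m\<^sup>2 \<le> cM * lam / (cM + \<epsilon>)" using cM \<epsilon> by (simp add: field_simps)
  moreover have "\<kappa> * lam = lam - cM * lam / (cM + \<epsilon>)" using cM \<epsilon> by (simp add: \<kappa>_def field_simps)
  ultimately show "\<kappa> * lam \<le> lam - f y * m\<^sup>2" using fm by linarith
  show "lam - f y * m\<^sup>2 \<le> lam" using f_pos[of y] by simp
qed

lemma p_pos: "0 < lam - f y * m\<^sup>2"
proof -
  have "0 < \<kappa> * lam" using \<kappa> lam_pos by simp
  then show ?thesis using p_ge(2)[of y] by linarith
qed

lemma cont_u: "continuous_on {0..H} u" and cont_q: "continuous_on {0..H} q"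
  using primitive_on_continuous u q by auto

text \<open>The symmetry \<open>(u, q) \<mapsto> (- u, - q)\<close> halves the case distinctions on the sign of the flux.\<close>

lemma uminus_system: "eigen_system H cm cM \<epsilon> m lam f (\<lambda>y. - u y) (\<lambda>y. - q y)"
  using primitive_on_cmult[OF u, of "-1"] primitive_on_cmult[OF q, of "-1"]
  by unfold_locales (simp_all add: H cm \<epsilon> m f_ge f_le lam u0 uH norm_u)


text \<open>The energy of \<open>(u, q)\<close>. If \<open>f\<close> is constant, it is conserved.\<close>

definition E where "E y = f y * (lam - f y * m\<^sup>2) * (u y)\<^sup>2 + (q y)\<^sup>2"

text \<open>Between \<open>s\<close> and \<open>t\<close> the weight \<open>G = f (lam - f m\<^sup>2)\<close> in the energy is frozen at its value at
  \<open>x\<close>. The frozen energy has derivative \<open>2 u q (G x - G) / f\<close>, so it changes by a second order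
  term. Unfreezing multiplies the energy by at most \<open>G y / G x\<close>, whose logarithm is bounded by
  the increment of \<open>f\<close>. The shift \<open>\<eta>\<close> keeps the argument of the logarithm away from zero; \<open>K\<close> depends on \<open>u\<close>, \<open>q\<close> and \<open>\<eta>\<close>, but disappears in the limit of fine
  partitions.\<close>

lemma energy_step:
  fixes v :: "real \<Rightarrow> real"
  assumes v: "\<And>s t. 0 \<le> s \<Longrightarrow> s \<le> t \<Longrightarrow> t \<le> H \<Longrightarrow> \<bar>f t - f s\<bar> \<le> v t - v s" and \<eta>: "0 < \<eta>"
  obtains K where "\<And>s t x y. 0 \<le> s \<Longrightarrow> s \<le> t \<Longrightarrow> t \<le> H \<Longrightarrow> x \<in> {s, t} \<Longrightarrow> y \<in> {s, t} \<Longrightarrow>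
     ln (E y + \<eta>) - ln (E x + \<eta>) \<le> (1 / cm + 1 / \<epsilon>) * (v t - v s) + K * (t - s) * (v t - v s)"
proof -
  define G where "G y = f y * (lam - f y * m\<^sup>2)" for y
  note Ppos = p_pos
  have Gpos: "0 < G y" for y using f_pos[of y] Ppos[of y] by (simp add: G_def)
  define L where "L = lam + 2 * cM * m\<^sup>2"
  have Lpos: "0 \<le> L" using lam_pos cM by (simp add: L_def)
  have GL: "\<bar>G x - G y\<bar> \<le> L * \<bar>f x - f y\<bar>" for x y
  proof -
    have "G x - G y = (f x - f y) * (lam - (f x + f y) * m\<^sup>2)"
      by (simp add: G_def algebra_simps power2_eq_square)
    moreover have "\<bar>lam - (f x + f y) * m\<^sup>2\<bar> \<le> L"
    proof -
      have "(f x + f y) * m\<^sup>2 \<le> 2 * cM * m\<^sup>2" using f_le[of x] f_le[of y] by (intro mult_right_mono) auto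
      moreover have "0 \<le> (f x + f y) * m\<^sup>2" using f_pos[of x] f_pos[of y] by simp
      ultimately show ?thesis using lam_pos unfolding L_def by linarith
    qed
    ultimately show ?thesis using mult_left_mono[of "\<bar>lam - (f x + f y) * m\<^sup>2\<bar>" L "\<bar>f x - f y\<bar>"] by (simp add: abs_mult mult.commute)
  qed
  obtain B where B: "0 < B" "\<And>y. y \<in> {0..H} \<Longrightarrow> \<bar>u y\<bar> \<le> B" "\<And>y. y \<in> {0..H} \<Longrightarrow> \<bar>q y\<bar> \<le> B"
  proof -
    have "bounded (u ` {0..H})" "bounded (q ` {0..H})"
      using cont_u cont_q by (auto intro!: compact_imp_bounded compact_continuous_image)
    then obtain B1 B2 where "\<forall>x\<in>u ` {0..H}. norm x \<le> B1" "\<forall>x\<in>q ` {0..H}. norm x \<le> B2"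
      unfolding bounded_iff by metis
    then show ?thesis by (intro that[of "max 1 (max B1 B2)"]) (auto simp: le_max_iff_disj)
  qed
  define K where "K = 2 * B * B / cm * L"
  have Kpos: "0 \<le> K" using B(1) cm Lpos by (simp add: K_def)
  \<comment> \<open>The derivative of \<open>g u\<^sup>2 + q\<^sup>2\<close> is \<open>2 u q (g - G) / f\<close>; with \<open>g\<close> the value of \<open>G\<close> at an end point, the
      last factor is at most \<open>L\<close> times the increment of \<open>v\<close>.\<close>
  have frozen: "\<bar>(g * (u t)\<^sup>2 + (q t)\<^sup>2) - (g * (u s)\<^sup>2 + (q s)\<^sup>2)\<bar> \<le> K * (v t - v s) * (t - s)"
    if st: "0 \<le> s" "s \<le> t" "t \<le> H" and g: "g = G s \<or> g = G t" for s t g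
  proof -
    have pr: "primitive_on 0 H (\<lambda>y. g * (u y * u y) + q y * q y)
       (\<lambda>y. g * (q y / f y * u y + u y * (q y / f y)) + ((f y * m\<^sup>2 - lam) * u y * q y + q y * ((f y * m\<^sup>2 - lam) * u y)))"
      using H by (intro primitive_on_add primitive_on_cmult primitive_on_mult u q) auto
    have "\<bar>(g * (u t * u t) + q t * q t) - (g * (u s * u s) + q s * q s)\<bar> \<le> K * (v t - v s) * (t - s)"
    proof (rule primitive_on_abs_le[OF pr st])
      fix y assume y: "s \<le> y" "y \<le> t"
      have "g * (q y / f y * u y + u y * (q y / f y)) + ((f y * m\<^sup>2 - lam) * u y * q y + q y * ((f y * m\<^sup>2 - lam) * u y))
        = 2 * u y * q y / f y * (g - G y)"
        using f_pos[of y] by (simp add: G_def field_simps)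
      also have "\<bar>\<dots>\<bar> = 2 * \<bar>u y\<bar> * \<bar>q y\<bar> / f y * \<bar>g - G y\<bar>"
        using f_pos[of y] by (simp add: abs_mult)
      also have "\<dots> \<le> 2 * B * B / cm * (L * (v t - v s))"
      proof (intro mult_mono frac_le)
        show "\<bar>g - G y\<bar> \<le> L * (v t - v s)"
        proof -
          have "\<bar>f s - f y\<bar> \<le> v t - v s" "\<bar>f t - f y\<bar> \<le> v t - v s"
            using v[of s y] v[of y t] st y by auto
          then have "L * \<bar>f s - f y\<bar> \<le> L * (v t - v s)" "L * \<bar>f t - f y\<bar> \<le> L * (v t - v s)"
            using Lpos by (auto intro: mult_left_mono)
          then show ?thesis using g GL[of s y] GL[of t y] by auto
        qed
      qed (use B y st cm f_ge in auto)
      finally show "\<bar>g * (q y / f y * u y + u y * (q y / f y)) + ((f y * m\<^sup>2 - lam) * u y * q y + q y * ((f y * m\<^sup>2 - lam) * u y))\<bar> \<le> K * (v t - v s)"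
        by (simp add: K_def)
    qed
    then show ?thesis by (simp add: power2_eq_square)
  qed
  have ratio: "G y \<le> G x * exp ((1 / cm + 1 / \<epsilon>) * \<bar>f y - f x\<bar>)" for x y
  proof -
    let ?d = "\<bar>f y - f x\<bar>"
    have 1: "f y \<le> f x * exp (1 / cm * ?d)"
    proof -
      have "1 + ?d / cm \<le> exp (1 / cm * ?d)" using exp_ge_add_one_self[of "1 / cm * ?d"] by simp
      then have "f x * (1 + ?d / cm) \<le> f x * exp (1 / cm * ?d)"
        using f_pos[of x] by (intro mult_left_mono) auto
      moreover have "?d \<le> f x * (?d / cm)"
        using f_ge[of x] cm by (simp add: field_simps mult_right_mono)
      ultimately show ?thesis by (simp add: algebra_simps)
    qed
    have 2: "lam - f y * m\<^sup>2 \<le> (lam - f x * m\<^sup>2) * exp (1 / \<epsilon> * ?d)"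
    proof -
      have "1 + ?d / \<epsilon> \<le> exp (1 / \<epsilon> * ?d)" using exp_ge_add_one_self[of "1 / \<epsilon> * ?d"] by simp
      then have "(lam - f x * m\<^sup>2) * (1 + ?d / \<epsilon>) \<le> (lam - f x * m\<^sup>2) * exp (1 / \<epsilon> * ?d)"
        using Ppos[of x] by (intro mult_left_mono) auto
      moreover have "(\<epsilon> * m\<^sup>2) * (?d / \<epsilon>) \<le> (lam - f x * m\<^sup>2) * (?d / \<epsilon>)"
        using p_ge(1)[of x] \<epsilon> by (intro mult_right_mono) auto
      moreover have "(\<epsilon> * m\<^sup>2) * (?d / \<epsilon>) = ?d * m\<^sup>2" using \<epsilon> by simp
      moreover have "(f x - f y) * m\<^sup>2 \<le> ?d * m\<^sup>2" by (intro mult_right_mono) auto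
      ultimately show ?thesis by (simp add: algebra_simps)
    qed
    have "G y \<le> (f x * exp (1 / cm * ?d)) * ((lam - f x * m\<^sup>2) * exp (1 / \<epsilon> * ?d))"
      unfolding G_def by (intro mult_mono 1 2) (use f_pos Ppos in \<open>auto intro: less_imp_le\<close>)
    also have "\<dots> = G x * exp ((1 / cm + 1 / \<epsilon>) * ?d)"
      by (simp add: G_def distrib_right exp_add)
    finally show ?thesis .
  qed
  have EG: "E y = G y * (u y)\<^sup>2 + (q y)\<^sup>2" for y by (simp add: E_def G_def)
  show ?thesis
  proof (rule that[of "K / \<eta>"])
    fix s t x y assume st: "0 \<le> s" "s \<le> t" "t \<le> H" and x: "x \<in> {s, t}" and y: "y \<in> {s, t}"
    let ?C = "1 / cm + 1 / \<epsilon>" and ?dv = "v t - v s"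
    let ?M = "G x * (u y)\<^sup>2 + (q y)\<^sup>2"
    have C: "0 \<le> ?C" using cm \<epsilon> by simp
    have dv: "0 \<le> ?dv" "\<bar>f y - f x\<bar> \<le> ?dv" using v[OF st] x y by (auto simp: abs_minus_commute)
    have nn: "0 \<le> E x" "0 \<le> ?M" using Gpos[of x] by (auto simp: EG)
    have "E y + \<eta> \<le> exp (?C * ?dv) * (?M + \<eta>)"
    proof -
      have e: "exp (?C * \<bar>f y - f x\<bar>) \<le> exp (?C * ?dv)" using dv C by (simp add: mult_left_mono)
      have e1: "1 \<le> exp (?C * ?dv)" using C dv by simp
      have "G y \<le> G x * exp (?C * ?dv)"
        using ratio[of y x] e Gpos[of x] by (meson less_imp_le mult_left_mono order_trans)
      then have "G y * (u y)\<^sup>2 \<le> G x * exp (?C * ?dv) * (u y)\<^sup>2" by (intro mult_right_mono) auto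
      moreover have "1 * ((q y)\<^sup>2 + \<eta>) \<le> exp (?C * ?dv) * ((q y)\<^sup>2 + \<eta>)" using e1 \<eta> by (intro mult_right_mono) auto
      ultimately show ?thesis by (simp add: EG algebra_simps)
    qed
    then have "ln (E y + \<eta>) \<le> ln (exp (?C * ?dv) * (?M + \<eta>))"
      using \<eta> Gpos[of y] by (subst ln_le_cancel_iff) (auto simp: EG intro!: add_nonneg_pos mult_pos_pos add_nonneg_nonneg nn)
    also have "\<dots> = ?C * ?dv + ln (?M + \<eta>)" using \<eta> nn by (simp add: ln_mult)
    finally have 1: "ln (E y + \<eta>) \<le> ?C * ?dv + ln (?M + \<eta>)" .
    have "?M - E x \<le> K * ?dv * (t - s)"
    proof -
      have "G x = G s \<or> G x = G t" using x by auto
      from frozen[OF st this] have "\<bar>?M - E x\<bar> \<le> K * ?dv * (t - s)"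
        using x y st dv Kpos by (auto simp: EG abs_minus_commute)
      then show ?thesis by simp
    qed
    then have "(?M - E x) / (E x + \<eta>) \<le> K * ?dv * (t - s) / \<eta>"
      using nn \<eta> Kpos dv st by (intro frac_le) auto
    moreover have "ln (?M + \<eta>) - ln (E x + \<eta>) \<le> (?M - E x) / (E x + \<eta>)"
      using ln_diff_le[of "?M + \<eta>" "E x + \<eta>"] nn \<eta> by simp
    ultimately have "ln (?M + \<eta>) - ln (E x + \<eta>) \<le> K / \<eta> * (t - s) * ?dv"
      by (simp add: ac_simps)
    with 1 show "ln (E y + \<eta>) - ln (E x + \<eta>) \<le> ?C * ?dv + K / \<eta> * (t - s) * ?dv" by linarith
  qed
qed

lemma E_nonneg: "0 \<le> E y"
proof -
  show ?thesis using f_pos[of y] p_pos[of y] by (simp add: E_def)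
qed

text \<open>Summing \<open>energy_step\<close> over fine partitions, in both directions, and letting the shift \<open>\<eta>\<close> tend
  to zero. The constant is independent of \<open>m\<close> and \<open>lam\<close>: the logarithm of \<open>f\<close> has Lipschitz
  constant \<open>1 / cm\<close>, and that of \<open>lam - f m\<^sup>2 \<ge> \<epsilon> m\<^sup>2\<close> has \<open>m\<^sup>2 / (\<epsilon> m\<^sup>2) = 1 / \<epsilon>\<close>, both as
  functions of the value of \<open>f\<close>.\<close>

lemma energy_comparison:
  assumes v: "\<And>s t. 0 \<le> s \<Longrightarrow> s \<le> t \<Longrightarrow> t \<le> H \<Longrightarrow> \<bar>f t - f s\<bar> \<le> v t - v s"
    and y: "y \<in> {0..H}" and z: "z \<in> {0..H}"
  shows "E z \<le> E y * exp ((1 / cm + 1 / \<epsilon>) * (v H - v 0))"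
proof -
  let ?C = "1 / cm + 1 / \<epsilon>"
  have C: "0 \<le> ?C" using cm \<epsilon> by simp
  have mono: "mono_on {0..H} v"
    by (rule mono_onI) (use v in fastforce)
  have \<eta>: "E z + \<eta> \<le> (E y + \<eta>) * exp (?C * (v H - v 0))" if \<eta>: "0 < \<eta>" for \<eta>
  proof -
    obtain K where K: "\<And>s t x y. 0 \<le> s \<Longrightarrow> s \<le> t \<Longrightarrow> t \<le> H \<Longrightarrow> x \<in> {s, t} \<Longrightarrow> y \<in> {s, t} \<Longrightarrow>
      ln (E y + \<eta>) - ln (E x + \<eta>) \<le> ?C * (v t - v s) + K * (t - s) * (v t - v s)"
      using energy_step[OF v \<eta>] by blast
    have both: "ln (E t + \<eta>) - ln (E s + \<eta>) \<le> ?C * (v t - v s) \<and> ln (E s + \<eta>) - ln (E t + \<eta>) \<le> ?C * (v t - v s)"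
      if st: "0 \<le> s" "s \<le> t" "t \<le> H" for s t
    proof -
      have m: "mono_on {s..t} v" by (rule mono_on_subset[OF mono]) (use st in auto)
      have i: "continuous_on {s..t} (\<lambda>y. y)" "mono_on {s..t} (\<lambda>y::real. y)"
        by (auto intro: mono_onI)
      have "ln (E t + \<eta>) - ?C * v t \<le> ln (E s + \<eta>) - ?C * v s"
      proof (rule quadratic_increment_imp_le[OF st(2) i m, where K=K])
        fix s' t' assume "s \<le> s'" "s' \<le> t'" "t' \<le> t"
        then show "ln (E t' + \<eta>) - ?C * v t' - (ln (E s' + \<eta>) - ?C * v s') \<le> K * (t' - s') * (v t' - v s')"
          using K[of s' t' s' t'] st by (simp add: algebra_simps)
      qed
      moreover have "- ln (E t + \<eta>) - ?C * v t \<le> - ln (E s + \<eta>) - ?C * v s"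
      proof (rule quadratic_increment_imp_le[OF st(2) i m, where K=K])
        fix s' t' assume "s \<le> s'" "s' \<le> t'" "t' \<le> t"
        then show "- ln (E t' + \<eta>) - ?C * v t' - (- ln (E s' + \<eta>) - ?C * v s') \<le> K * (t' - s') * (v t' - v s')"
          using K[of s' t' t' s'] st by (simp add: algebra_simps)
      qed
      ultimately show ?thesis by (simp add: algebra_simps)
    qed
    have vv: "v 0 \<le> v x" "v x \<le> v H" if "x \<in> {0..H}" for x
      using v[of 0 x] v[of x H] that by auto
    have "ln (E z + \<eta>) - ln (E y + \<eta>) \<le> ?C * (v (max y z) - v (min y z))"
      using both[of y z] both[of z y] y z by (cases "y \<le> z") auto
    also have "\<dots> \<le> ?C * (v H - v 0)"
      using vv[OF y] vv[OF z] C by (intro mult_left_mono) (auto simp: max_def min_def)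
    finally have "ln (E z + \<eta>) \<le> ln (E y + \<eta>) + ?C * (v H - v 0)" by simp
    then have "exp (ln (E z + \<eta>)) \<le> exp (ln (E y + \<eta>) + ?C * (v H - v 0))" by simp
    then show ?thesis using E_nonneg[of y] E_nonneg[of z] \<eta> by (simp add: exp_add)
  qed
  show ?thesis
  proof (rule field_le_epsilon)
    fix e :: real assume e: "0 < e"
    let ?X = "exp (?C * (v H - v 0))"
    have X: "0 < ?X" by simp
    have "E z + e / ?X \<le> (E y + e / ?X) * ?X" by (rule \<eta>) (use e X in simp)
    also have "\<dots> = E y * ?X + e" by (simp add: distrib_right)
    finally show "E z \<le> E y * ?X + e" using e X by (smt (verit) divide_pos_pos)
  qed
qed

lemma exists_large_value: "\<exists>z\<in>{0..H}. 1 / H \<le> (u z)\<^sup>2"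
proof -
  have c: "continuous_on {0..H} (\<lambda>y. (u y)\<^sup>2)" by (intro continuous_intros cont_u)
  obtain z where z: "z \<in> {0..H}" "\<And>y. y \<in> {0..H} \<Longrightarrow> (u y)\<^sup>2 \<le> (u z)\<^sup>2"
    using continuous_attains_sup[OF _ _ c] H by force
  have "integral {0..H} (\<lambda>y. (u y)\<^sup>2) \<le> integral {0..H} (\<lambda>y. (u z)\<^sup>2)"
    by (rule integral_le) (use z(2) c in \<open>auto intro: integrable_continuous_real\<close>)
  then have "1 \<le> (u z)\<^sup>2 * H" using norm_u H by (simp add: mult.commute)
  then show ?thesis using z(1) H by (auto simp: field_simps intro!: bexI[of _ z])
qed

text \<open>At a point \<open>z\<close> with \<open>u\<^sup>2 \<ge> 1 / H\<close> the energy is at least \<open>cm \<kappa> lam / H\<close>, and it loses at most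
  the exponential factor on the way to \<open>y\<close>, where it is at most \<open>(cM lam + 1) (u\<^sup>2 + q\<^sup>2)\<close>. The
  quotient \<open>lam / (cM lam + 1)\<close> is increasing in \<open>lam\<close>, which allows to replace \<open>lam\<close> by its lower
  bound \<open>l\<close>.\<close>

lemma amplitude_lower_bound:
  assumes v: "\<And>s t. 0 \<le> s \<Longrightarrow> s \<le> t \<Longrightarrow> t \<le> H \<Longrightarrow> \<bar>f t - f s\<bar> \<le> v t - v s" and V: "v H - v 0 \<le> V"
    and l: "0 < l" "l \<le> lam" and y: "y \<in> {0..H}"
  shows "cm * \<kappa> / H * exp (- ((1 / cm + 1 / \<epsilon>) * V)) * (l / (cM * l + 1)) \<le> (u y)\<^sup>2 + (q y)\<^sup>2"
proof -
  let ?C = "1 / cm + 1 / \<epsilon>"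
  let ?S = "(u y)\<^sup>2 + (q y)\<^sup>2"
  have C: "0 \<le> ?C" using cm \<epsilon> by simp
  obtain z where z: "z \<in> {0..H}" "1 / H \<le> (u z)\<^sup>2" using exists_large_value by blast
  have "cm * (\<kappa> * lam) * (1 / H) \<le> f z * (lam - f z * m\<^sup>2) * (u z)\<^sup>2"
    using cm \<kappa> lam_pos H f_pos[of z] p_pos[of z]
    by (intro mult_mono f_ge p_ge z(2)) auto
  also have "\<dots> \<le> E z" by (simp add: E_def)
  also have "\<dots> \<le> E y * exp (?C * (v H - v 0))" by (rule energy_comparison[OF v y z(1)])
  also have "\<dots> \<le> E y * exp (?C * V)"
    using E_nonneg[of y] C V by (intro mult_left_mono) (auto intro: mult_left_mono)
  finally have 1: "cm * \<kappa> / H * lam \<le> E y * exp (?C * V)" by (simp add: ac_simps)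
  have "E y \<le> cM * lam * (u y)\<^sup>2 + (q y)\<^sup>2"
    unfolding E_def using f_le[of y] f_pos[of y] p_ge(3)[of y] cM lam_pos p_pos[of y]
    by (intro add_mono mult_right_mono mult_mono) auto
  also have "\<dots> \<le> (cM * lam + 1) * ?S"
  proof -
    have "0 \<le> (u y)\<^sup>2 + cM * lam * (q y)\<^sup>2" using cM lam_pos by simp
    then show ?thesis by (simp add: algebra_simps)
  qed
  finally have "E y * exp (?C * V) \<le> (cM * lam + 1) * ?S * exp (?C * V)" by (intro mult_right_mono) auto
  with 1 have 2: "cm * \<kappa> / H * lam \<le> (cM * lam + 1) * ?S * exp (?C * V)" by linarith
  have pos: "0 < cM * lam + 1" "0 < cM * l + 1" using cM lam_pos l by (auto intro: add_pos_pos)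
  have "l / (cM * l + 1) \<le> lam / (cM * lam + 1)" using pos l by (simp add: field_simps)
  then have "cm * \<kappa> / H * exp (- (?C * V)) * (l / (cM * l + 1)) \<le> cm * \<kappa> / H * exp (- (?C * V)) * (lam / (cM * lam + 1))"
    using cm \<kappa> H by (intro mult_left_mono) auto
  also have "\<dots> = (cm * \<kappa> / H * lam) / ((cM * lam + 1) * exp (?C * V))"
 
  proof -
    have "exp (- (?C * V)) = 1 / exp (?C * V)" by (simp add: exp_minus divide_inverse)
    then show ?thesis by simp
  qed
  also have "\<dots> \<le> ?S" 
  proof (subst pos_divide_le_eq)
    show "0 < (cM * lam + 1) * exp (?C * V)" using pos by simp
    show "cm * \<kappa> / H * lam \<le> ?S * ((cM * lam + 1) * exp (?C * V))" using 2 by (simp only: ac_simps)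
  qed
  finally show ?thesis .
qed

end

context eigen_system
begin

section \<open>Mass of eigenfunctions on an interval\<close>

lemma no_zero_sign:
  assumes st: "0 \<le> s" "s \<le> t" "t \<le> H" and nz: "\<And>y. y \<in> {s..t} \<Longrightarrow> q y \<noteq> 0"
  shows "(\<forall>y\<in>{s..t}. 0 < q y) \<or> (\<forall>y\<in>{s..t}. q y < 0)"
proof (rule ccontr)
  assume "\<not> ?thesis"
  then obtain x y where xy: "x \<in> {s..t}" "y \<in> {s..t}" "q x \<le> 0" "0 \<le> q y" by (auto simp: not_less)
  have "connected (q ` {s..t})"
    by (rule connected_continuous_image[OF continuous_on_subset[OF cont_q]]) (use st in auto)
  then have "{q x..q y} \<subseteq> q ` {s..t}"
    by (rule connected_contains_Icc) (use xy in auto)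
  then have "0 \<in> q ` {s..t}" using xy(3,4) by auto
  then show False using nz by auto
qed

lemma u_increment_ge:
  assumes st: "0 \<le> s" "s \<le> t" "t \<le> H" and k: "0 < k" "\<And>y. y \<in> {s..t} \<Longrightarrow> k \<le> q y"
  shows "k / cM * (t - s) \<le> u t - u s"
proof (rule primitive_on_ge[OF u st])
  fix y assume "s \<le> y" "y \<le> t"
  then show "k / cM \<le> q y / f y" using k(1) k(2)[of y] f_pos[of y] f_le[of y] by (intro frac_le) auto
qed

lemma u_increment_abs_ge:
  assumes st: "0 \<le> s" "s \<le> t" "t \<le> H" and k: "0 < k" "\<And>y. y \<in> {s..t} \<Longrightarrow> k \<le> \<bar>q y\<bar>"
  shows "k / cM * (t - s) \<le> \<bar>u t - u s\<bar>"
proof -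
  interpret N: eigen_system H cm cM \<epsilon> m lam f "\<lambda>y. - u y" "\<lambda>y. - q y" by (rule uminus_system)
  have "q y \<noteq> 0" if "y \<in> {s..t}" for y using k(2)[OF that] k(1) by auto
  from no_zero_sign[OF st this] consider "\<forall>y\<in>{s..t}. 0 < q y" | "\<forall>y\<in>{s..t}. q y < 0" by blast
  then show ?thesis
  proof cases
    case 1
    then have "k / cM * (t - s) \<le> u t - u s" by (intro u_increment_ge st k(1)) (use k(2) in force)
    then show ?thesis by simp
  next
    case 2
    then have "k / cM * (t - s) \<le> - u t - - u s" by (intro N.u_increment_ge st k(1)) (use k(2) in force)
    then show ?thesis by simp
  qed
qed

text \<open>Otherwise \<open>u\<close> would be strictly monotone, contradicting the boundary values.\<close>

lemma flux_zero_exists: "\<exists>z\<in>{0..H}. q z = 0"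
proof (rule ccontr)
  assume nz: "\<not> ?thesis"
  have c: "continuous_on {0..H} (\<lambda>y. \<bar>q y\<bar>)" by (intro continuous_intros cont_q)
  obtain z where z: "z \<in> {0..H}" "\<And>y. y \<in> {0..H} \<Longrightarrow> \<bar>q z\<bar> \<le> \<bar>q y\<bar>"
    using continuous_attains_inf[OF _ _ c] H by force
  have "0 < \<bar>q z\<bar>" using nz z(1) by auto
  then have "\<bar>q z\<bar> / cM * (H - 0) \<le> \<bar>u H - u 0\<bar>" by (intro u_increment_abs_ge) (use z H in auto)
  moreover have "0 < \<bar>q z\<bar> / cM * (H - 0)" using \<open>0 < \<bar>q z\<bar>\<close> cM H by simp
  ultimately show False by (simp add: u0 uH)
qed

text \<open>Starting from a zero of \<open>q\<close>, the equation \<open>q' = - (lam - f m\<^sup>2) u\<close> bounds \<open>\<bar>q\<bar>\<close> by \<open>lam\<close> times the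
  integral of \<open>\<bar>u\<bar> \<le> 1 + u\<^sup>2\<close>.\<close>

lemma flux_bound: "y \<in> {0..H} \<Longrightarrow> \<bar>q y\<bar> \<le> lam * (H + 1)"
proof -
  assume y: "y \<in> {0..H}"
  obtain z where z: "z \<in> {0..H}" "q z = 0" using flux_zero_exists by blast
  have c: "(\<lambda>y. (u y)\<^sup>2) integrable_on {0..H}"
    by (intro integrable_continuous_real continuous_intros cont_u)
  have "\<bar>q t - q s\<bar> \<le> lam * (H + 1)" if st: "0 \<le> s" "s \<le> t" "t \<le> H" for s t
  proof -
    have i1: "(\<lambda>y. lam * (1 + (u y)\<^sup>2)) integrable_on {a..b}" if "{a..b} \<subseteq> {0..H}" for a b
      using that by (intro integrable_continuous_real continuous_intros continuous_on_subset[OF cont_u])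
    have "\<bar>q t - q s\<bar> = norm (integral {s..t} (\<lambda>y. (f y * m\<^sup>2 - lam) * u y))"
      using primitive_onD(1)[OF q st] by simp
    also have "\<dots> \<le> integral {s..t} (\<lambda>y. lam * (1 + (u y)\<^sup>2))"
    proof (rule integral_norm_bound_integral[OF primitive_onD(3)[OF q st]])
      show "(\<lambda>y. lam * (1 + (u y)\<^sup>2)) integrable_on {s..t}" by (rule i1) (use st in auto)
      fix y
      have "\<bar>f y * m\<^sup>2 - lam\<bar> \<le> lam" using p_pos[of y] p_ge(3)[of y] by simp
      moreover have "\<bar>u y\<bar> \<le> 1 + (u y)\<^sup>2"
        using sum_squares_bound[of 1 "\<bar>u y\<bar>"] by (simp add: abs_le_iff) (smt (verit) zero_le_power2)
      ultimately show "norm ((f y * m\<^sup>2 - lam) * u y) \<le> lam * (1 + (u y)\<^sup>2)"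
        by (simp add: abs_mult) (intro mult_mono, auto)
    qed
    also have "\<dots> \<le> integral {0..H} (\<lambda>y. lam * (1 + (u y)\<^sup>2))"
      by (rule integral_subset_le) (use i1 st lam_pos in auto)
    also have "integral {0..H} (\<lambda>y. lam * (1 + (u y)\<^sup>2)) = lam * (integral {0..H} (\<lambda>y. 1) + integral {0..H} (\<lambda>y. (u y)\<^sup>2))"
      using c by (subst Henstock_Kurzweil_Integration.integral_add[symmetric]) auto
    also have "\<dots> = lam * (H + 1)" using H norm_u by simp
    finally show ?thesis .
  qed
  from this[of y z] this[of z y] show ?thesis using y z by (cases "y \<le> z") auto
qed

text \<open>While \<open>q > 0\<close>, \<open>u\<close> increases, so on one half of \<open>[s, t]\<close> it has a constant sign. Let this be the
  right half and \<open>u \<ge> 0\<close> there; let \<open>d\<close> be a quarter of the length and \<open>y = t - d\<close>. On this half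
  \<open>q\<close> decreases, so \<open>u y\<close> is at least \<open>d q y / cM\<close>; conversely \<open>q\<close> must stay positive although it
  loses at least \<open>\<kappa> lam d u y\<close> between \<open>y\<close> and \<open>t\<close>. Together these give \<open>\<kappa> lam d\<^sup>2 \<le> cM\<close>. The
  left half is the mirror image.\<close>

lemma no_long_positive_flux:
  assumes st: "0 \<le> s" "s \<le> t" "t \<le> H" and pos: "\<And>y. y \<in> {s..t} \<Longrightarrow> 0 < q y"
  shows "\<kappa> * lam * (t - s)\<^sup>2 \<le> 16 * cM"
proof -
  define d where "d = (t - s) / 4"
  have d: "0 \<le> d" using st by (simp add: d_def)
  have tt: "t = s + 4 * d" by (simp add: d_def field_simps)
  have incr: "u x \<le> u y" if "s \<le> x" "x \<le> y" "y \<le> t" for x y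
  proof -
    have "0 * (y - x) \<le> u y - u x"
      by (rule primitive_on_ge[OF u]) (use that st pos f_pos in \<open>auto intro: less_imp_le\<close>)
    then show ?thesis by simp
  qed
  have key: "\<kappa> * lam * d\<^sup>2 \<le> cM"
  proof -
    obtain y where y: "s \<le> y" "y \<le> t" and *: "\<kappa> * lam * (q y / cM * d) * d \<le> q y"
    proof (cases "0 \<le> u (s + 2 * d)")
      case True
      let ?y = "s + 3 * d"
      have up: "0 \<le> u x" if "s + 2 * d \<le> x" "x \<le> t" for x using incr[of "s + 2*d" x] True that d by simp
      have qdec: "q y2 \<le> q y1" if "s + 2 * d \<le> y1" "y1 \<le> y2" "y2 \<le> t" for y1 y2
      proof -
        have "0 * (y2 - y1) \<le> - 1 * q y2 - (- 1 * q y1)"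
        proof (rule primitive_on_ge[OF primitive_on_cmult[OF q, of "-1"]])
          fix x assume "y1 \<le> x" "x \<le> y2"
          then show "0 \<le> - 1 * ((f x * m\<^sup>2 - lam) * u x)"
            using up[of x] p_pos[of x] that by (simp add: mult_nonpos_nonneg)
        qed (use that st d in auto)
        then show ?thesis by simp
      qed
      have "q ?y / cM * (?y - (s + 2 * d)) \<le> u ?y - u (s + 2 * d)"
        by (rule u_increment_ge) (use qdec pos d tt st in auto)
      then have 1: "q ?y / cM * d \<le> u ?y" using True by (simp add: algebra_simps)
      have "(\<kappa> * lam * u ?y) * (t - ?y) \<le> - 1 * q t - (- 1 * q ?y)"
      proof (rule primitive_on_ge[OF primitive_on_cmult[OF q, of "-1"]])
        fix x assume x: "?y \<le> x" "x \<le> t"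
        have "\<kappa> * lam * u ?y \<le> (lam - f x * m\<^sup>2) * u x"
          by (intro mult_mono p_ge incr up) (use x d p_pos[of x] tt in auto)
        then show "\<kappa> * lam * u ?y \<le> - 1 * ((f x * m\<^sup>2 - lam) * u x)" by (simp add: algebra_simps)
      qed (use st d tt in auto)
      then have 2: "\<kappa> * lam * u ?y * (t - ?y) \<le> q ?y - q t" by simp
      have "\<kappa> * lam * (q ?y / cM * d) * d \<le> \<kappa> * lam * u ?y * d"
        using 1 \<kappa> lam_pos d by (intro mult_right_mono mult_left_mono) auto
      also have "\<dots> \<le> q ?y" using 2 pos[of t] tt st by (simp add: algebra_simps)
      finally show ?thesis by (intro that[of ?y]) (use d tt in auto)
    next
      case False
      let ?y = "s + d"
      have un: "u x \<le> 0" if "s \<le> x" "x \<le> s + 2 * d" for x using incr[of x "s + 2*d"] False that d tt by simp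
      have qinc: "q y1 \<le> q y2" if "s \<le> y1" "y1 \<le> y2" "y2 \<le> s + 2 * d" for y1 y2
      proof -
        have "0 * (y2 - y1) \<le> q y2 - q y1"
        proof (rule primitive_on_ge[OF q])
          fix x assume "y1 \<le> x" "x \<le> y2"
          then show "0 \<le> (f x * m\<^sup>2 - lam) * u x"
            using un[of x] p_pos[of x] that by (intro mult_nonpos_nonpos) auto
        qed (use that st d tt in auto)
        then show ?thesis by simp
      qed
      have "q ?y / cM * (s + 2 * d - ?y) \<le> u (s + 2 * d) - u ?y"
        by (rule u_increment_ge) (use qinc pos d tt st in auto)
      then have 1: "q ?y / cM * d \<le> - u ?y" using False by (simp add: algebra_simps)
      have 2: "(\<kappa> * lam * (- u ?y)) * (?y - s) \<le> q ?y - q s"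
      proof (rule primitive_on_ge[OF q])
        fix x assume x: "s \<le> x" "x \<le> ?y"
        have "\<kappa> * lam * (- u ?y) \<le> (lam - f x * m\<^sup>2) * (- u x)"
        proof (intro mult_mono p_ge)
          show "- u ?y \<le> - u x" using incr[of x ?y] x d tt by simp
          show "0 \<le> - u ?y" using un[of ?y] d by simp
        qed (use p_pos[of x] in auto)
        then show "\<kappa> * lam * (- u ?y) \<le> (f x * m\<^sup>2 - lam) * u x" by (simp add: algebra_simps)
      qed (use st d tt in auto)
      have "\<kappa> * lam * (q ?y / cM * d) * d \<le> \<kappa> * lam * (- u ?y) * d"
        using 1 \<kappa> lam_pos d by (intro mult_right_mono mult_left_mono) auto
      also have "\<dots> \<le> q ?y" using 2 pos[of s] tt st by (simp add: algebra_simps)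
      finally show ?thesis by (intro that[of ?y]) (use d tt in auto)
    qed
    have qy: "0 < q y" using pos y by auto
    have "q y * (\<kappa> * lam * d\<^sup>2) \<le> q y * cM" using * cM by (simp add: field_simps power2_eq_square)
    then show ?thesis using qy by simp
  qed
  have "\<kappa> * lam * (t - s)\<^sup>2 = 16 * (\<kappa> * lam * d\<^sup>2)" by (simp add: d_def power2_eq_square)
  then show ?thesis using key by linarith
qed

lemma flux_zero_in_interval:
  assumes st: "0 \<le> s" "s \<le> t" "t \<le> H" and long: "16 * cM < \<kappa> * lam * (t - s)\<^sup>2"
  shows "\<exists>y\<in>{s..t}. q y = 0"
proof (rule ccontr)
  interpret N: eigen_system H cm cM \<epsilon> m lam f "\<lambda>y. - u y" "\<lambda>y. - q y" by (rule uminus_system)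
  assume "\<not> ?thesis"
  then consider "\<forall>y\<in>{s..t}. 0 < q y" | "\<forall>y\<in>{s..t}. q y < 0" using no_zero_sign[OF st] by blast
  then show False
  proof cases
    case 1
    then show False using no_long_positive_flux[OF st] long by force
  next
    case 2
    then have "\<kappa> * lam * (t - s)\<^sup>2 \<le> 16 * cM"
      by (intro N.no_long_positive_flux[OF st]) auto
    then show False using long by simp
  qed
qed

text \<open>On an interval of length \<open>d\<close> after a zero of \<open>q\<close>, the flux is at most \<open>lam M d\<close> with \<open>M\<close> the
  maximum of \<open>\<bar>u\<bar>\<close>, so \<open>u\<close> changes by at most \<open>lam d\<^sup>2 M / cm \<le> M / 4\<close>. This bounds \<open>M\<close> by
  \<open>4 / 3\<close> of the initial value, and \<open>u\<close> from below by half of it.\<close>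

lemma mass_after_flux_zero:
  assumes y: "0 \<le> y" "q y = 0" and d: "0 \<le> d" "y + d \<le> H" "lam * d\<^sup>2 \<le> cm / 4" and r: "r \<le> (u y)\<^sup>2"
  shows "d * r / 4 \<le> integral {y..y + d} (\<lambda>x. (u x)\<^sup>2)"
proof -
  let ?J = "{y..y + d}"
  have sub: "?J \<subseteq> {0..H}" using y d by auto
  have c: "continuous_on ?J (\<lambda>x. \<bar>u x\<bar>)" by (intro continuous_intros continuous_on_subset[OF cont_u sub])
  obtain z where z: "z \<in> ?J" "\<And>x. x \<in> ?J \<Longrightarrow> \<bar>u x\<bar> \<le> \<bar>u z\<bar>"
    using continuous_attains_sup[OF _ _ c] d(1) by force
  define M where "M = \<bar>u z\<bar>"
  have M: "\<bar>u x\<bar> \<le> M" if "x \<in> ?J" for x using z(2)[OF that] by (simp add: M_def)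
  have M0: "0 \<le> M" by (simp add: M_def)
  have qb: "\<bar>q x\<bar> \<le> lam * M * d" if x: "x \<in> ?J" for x
  proof -
    have "\<bar>q x - q y\<bar> \<le> lam * M * (x - y)"
    proof (rule primitive_on_abs_le[OF q])
      fix w assume w: "y \<le> w" "w \<le> x"
      have "\<bar>f w * m\<^sup>2 - lam\<bar> \<le> lam" using p_pos[of w] p_ge(3)[of w] by simp
      then show "\<bar>(f w * m\<^sup>2 - lam) * u w\<bar> \<le> lam * M"
        unfolding abs_mult by (intro mult_mono M) (use w x lam_pos in auto)
    qed (use x y d in auto)
    also have "\<dots> \<le> lam * M * d" using x lam_pos M0 by (intro mult_left_mono) auto
    finally show ?thesis using y by simp
  qed
  have ub: "\<bar>u x - u y\<bar> \<le> M / 4" if x: "x \<in> ?J" for x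
  proof -
    have "\<bar>u x - u y\<bar> \<le> lam * M * d / cm * (x - y)"
    proof (rule primitive_on_abs_le[OF u])
      fix w assume w: "y \<le> w" "w \<le> x"
      have "\<bar>q w / f w\<bar> = \<bar>q w\<bar> / f w" using f_pos[of w] by simp
      also have "\<dots> \<le> lam * M * d / cm"
        by (intro frac_le qb f_ge cm) (use w x M0 d lam_pos in auto)
      finally show "\<bar>q w / f w\<bar> \<le> lam * M * d / cm" .
    qed (use x y d in auto)
    also have "\<dots> \<le> lam * M * d / cm * d" using x lam_pos M0 cm d by (intro mult_left_mono) auto
    also have "\<dots> = M * (lam * d\<^sup>2 / cm)" by (simp add: power2_eq_square)
    also have "\<dots> \<le> M * (1 / 4)" using d(3) cm M0 by (intro mult_left_mono) (auto simp: field_simps)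
    finally show ?thesis by simp
  qed
  have My: "3 * M \<le> 4 * \<bar>u y\<bar>" using ub[OF z(1)] by (simp add: M_def abs_if split: if_splits)
  have sq: "r / 4 \<le> (u x)\<^sup>2" if x: "x \<in> ?J" for x
  proof -
    have "\<bar>u y\<bar> / 2 \<le> \<bar>u x\<bar>" using ub[OF x] My by (simp add: abs_if split: if_splits)
    then have "(\<bar>u y\<bar> / 2)\<^sup>2 \<le> \<bar>u x\<bar>\<^sup>2" by (rule power_mono) simp
    then show ?thesis using r by (simp add: power_divide)
  qed
  have "integral ?J (\<lambda>x. r / 4) \<le> integral ?J (\<lambda>x. (u x)\<^sup>2)"
    by (rule integral_le) (use sq in \<open>auto intro!: integrable_continuous_real continuous_intros continuous_on_subset[OF cont_u sub]\<close>)
  then show ?thesis using d(1) by simp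
qed

lemma mass_int: "0 \<le> s \<Longrightarrow> t \<le> H \<Longrightarrow> (\<lambda>x. (u x)\<^sup>2) integrable_on {s..t}"
  by (intro integrable_continuous_real continuous_intros continuous_on_subset[OF cont_u]) auto

lemma mass_mono:
  assumes "0 \<le> s" "s \<le> s'" "t' \<le> t" "t \<le> H"
  shows "integral {s'..t'} (\<lambda>x. (u x)\<^sup>2) \<le> integral {s..t} (\<lambda>x. (u x)\<^sup>2)"
  by (rule integral_subset_le) (use assms mass_int in auto)

text \<open>Each interval of length \<open>l = (L0 + d0) / sqrt lam\<close> contains a zero of \<open>q\<close> in its first part,
  of length \<open>L0 / sqrt lam\<close>, and then the mass supplied by \<open>mass_after_flux_zero\<close> over a length
  \<open>d0 / sqrt lam\<close>. If at least one such interval fits into \<open>[a, b]\<close>, then the number that fits is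
  at least half of \<open>(b - a) / l\<close>, so the factors \<open>sqrt lam\<close> cancel. The summand \<open>1\<close> in \<open>L0\<close> makes
  the inequality of \<open>flux_zero_in_interval\<close> strict.\<close>

lemma mass_high_energy:
  fixes a b r
  defines "L0 \<equiv> 4 * sqrt (cM / \<kappa>) + 1" and "d0 \<equiv> sqrt cm / 2"
  assumes ab: "0 \<le> a" "a < b" "b \<le> H" and r: "0 \<le> r" "\<And>y. y \<in> {0..H} \<Longrightarrow> r \<le> (u y)\<^sup>2 + (q y)\<^sup>2"
    and large: "((L0 + d0) / (b - a))\<^sup>2 < lam"
  shows "(b - a) * d0 * r / (8 * (L0 + d0)) \<le> integral {a..b} (\<lambda>x. (u x)\<^sup>2)"
proof -
  let ?w = "sqrt lam"
  define l where "l = (L0 + d0) / ?w"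
  have w: "0 < ?w" "?w\<^sup>2 = lam" using lam_pos by auto
  have d0: "0 < d0" using cm by (simp add: d0_def)
  have L0: "0 < L0" using cM \<kappa> by (simp add: L0_def add_nonneg_pos)
  have l: "0 < l" using w L0 d0 by (simp add: l_def)
  \<comment> \<open>The zero of \<open>q\<close> lies in the first part of the interval, the collected mass behind it.\<close>
  have piece: "d0 * r / (4 * ?w) \<le> integral {s..s + l} (\<lambda>x. (u x)\<^sup>2)" if s: "0 \<le> s" "s + l \<le> H" for s
  proof -
    have ll: "l = L0 / ?w + d0 / ?w" by (simp add: l_def add_divide_distrib)
    have p: "0 < L0 / ?w" "0 < d0 / ?w" using L0 d0 w by auto
    have "\<exists>y\<in>{s..s + L0 / ?w}. q y = 0"
    proof (rule flux_zero_in_interval)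
      have "(4 * sqrt (cM / \<kappa>))\<^sup>2 < L0\<^sup>2"
        unfolding L0_def using cM \<kappa> by (intro power_strict_mono) auto
      then have "16 * (cM / \<kappa>) < L0\<^sup>2" using cM \<kappa> by (simp add: power_mult_distrib)
      then have "16 * cM < \<kappa> * L0\<^sup>2" using \<kappa> by (simp add: field_simps)
      also have "\<kappa> * L0\<^sup>2 = \<kappa> * lam * (s + L0 / ?w - s)\<^sup>2"
        using w lam_pos by (simp add: power_divide)
      finally show "16 * cM < \<kappa> * lam * (s + L0 / ?w - s)\<^sup>2" .
    qed (use s ll p in auto)
    then obtain y where y: "s \<le> y" "y \<le> s + L0 / ?w" "q y = 0" by auto
    have yH: "y + d0 / ?w \<le> H" using y s ll by simp
    have "d0 / ?w * r / 4 \<le> integral {y..y + d0 / ?w} (\<lambda>x. (u x)\<^sup>2)"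
    proof (rule mass_after_flux_zero)
      show "lam * (d0 / ?w)\<^sup>2 \<le> cm / 4"
        using w lam_pos cm by (simp add: power_divide d0_def)
      show "r \<le> (u y)\<^sup>2" using r(2)[of y] y s yH p by simp
    qed (use y s yH p in auto)
    also have "\<dots> \<le> integral {s..s + l} (\<lambda>x. (u x)\<^sup>2)"
      by (rule mass_mono) (use y s ll in auto)
    finally show ?thesis by (simp add: mult.commute)
  qed
  have pack: "real n * (d0 * r / (4 * ?w)) \<le> integral {a..a + real n * l} (\<lambda>x. (u x)\<^sup>2)"
    if "a + real n * l \<le> b" for n
    using that
  proof (induction n)
    case (Suc n)
    have al: "a + real n * l \<le> a + real (Suc n) * l" "a \<le> a + real n * l" using l by (auto simp: algebra_simps)
    have e: "a + real (Suc n) * l = (a + real n * l) + l" by (simp add: algebra_simps)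
    have "integral {a..a + real (Suc n) * l} (\<lambda>x. (u x)\<^sup>2)
      = integral {a..a + real n * l} (\<lambda>x. (u x)\<^sup>2) + integral {a + real n * l..a + real (Suc n) * l} (\<lambda>x. (u x)\<^sup>2)"
      using al ab Suc.prems mass_int[of a "a + real (Suc n) * l"]
      by (intro Henstock_Kurzweil_Integration.integral_combine[symmetric]) auto
    moreover have "d0 * r / (4 * ?w) \<le> integral {a + real n * l..a + real (Suc n) * l} (\<lambda>x. (u x)\<^sup>2)"
      unfolding e by (rule piece) (use al ab Suc.prems e in auto)
    moreover have "real n * (d0 * r / (4 * ?w)) \<le> integral {a..a + real n * l} (\<lambda>x. (u x)\<^sup>2)"
      using Suc al by linarith
    moreover have "real (Suc n) * (d0 * r / (4 * ?w)) = real n * (d0 * r / (4 * ?w)) + d0 * r / (4 * ?w)"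
      by (simp add: distrib_right add_divide_distrib)
    ultimately show ?case by linarith
  qed simp
  define n where "n = nat \<lfloor>(b - a) / l\<rfloor>"
  have "(L0 + d0) / (b - a) < ?w"
    using large lam_pos by (intro real_less_rsqrt) 
  then have one: "1 \<le> (b - a) / l" using w ab L0 d0 by (simp add: l_def field_simps)
  then have n1: "real n \<le> (b - a) / l" "(b - a) / l < real n + 1" "1 \<le> real n"
    unfolding n_def by (auto simp: le_nat_floor of_nat_nat)
  then have nl: "a + real n * l \<le> b" using l by (simp add: field_simps)
  have "(b - a) / (2 * l) = (b - a) / l / 2" by simp
  then have "(b - a) / (2 * l) \<le> real n" using n1 by linarith
  then have "(b - a) / (2 * l) * (d0 * r / (4 * ?w)) \<le> real n * (d0 * r / (4 * ?w))"
    using d0 r w by (intro mult_right_mono) auto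
  also have "\<dots> \<le> integral {a..a + real n * l} (\<lambda>x. (u x)\<^sup>2)" by (rule pack[OF nl])
  also have "\<dots> \<le> integral {a..b} (\<lambda>x. (u x)\<^sup>2)" by (rule mass_mono) (use ab nl in auto)
  also have "(b - a) / (2 * l) * (d0 * r / (4 * ?w)) = (b - a) * d0 * r / (8 * (L0 + d0))"
  proof -
    have "(b - a) / (2 * (S / w)) * (d0 * r / (4 * w)) = (b - a) * d0 * r / (8 * S)"
      if "0 < S" "0 < w" for S w :: real
      using that by (simp add: divide_simps)
    from this[of "L0 + d0" ?w] show ?thesis using w(1) L0 d0 by (simp add: l_def)
  qed
  finally show ?thesis .
qed

text \<open>If \<open>\<bar>u\<bar>\<close> did not exceed \<open>th\<close> on \<open>[a, b]\<close>, then \<open>\<bar>q\<bar> \<ge> r / 2\<close> there, and \<open>u\<close> would change by more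
  than \<open>2 th\<close>. So \<open>\<bar>u\<bar> > th\<close> somewhere, and by the Lipschitz bound from \<open>flux_bound\<close> half of this
  value persists on one side.\<close>

lemma mass_low_energy:
  fixes a b r \<Lambda>
  defines "th \<equiv> min (r / 2) ((b - a) * r / (8 * cM))"
  assumes ab: "0 \<le> a" "a < b" "b \<le> H" and r: "0 < r" "\<And>y. y \<in> {0..H} \<Longrightarrow> r\<^sup>2 \<le> (u y)\<^sup>2 + (q y)\<^sup>2"
    and low: "lam \<le> \<Lambda>"
  shows "min ((b - a) / 2) (th * cm / (2 * (\<Lambda> * (H + 1)))) * th\<^sup>2 / 4 \<le> integral {a..b} (\<lambda>x. (u x)\<^sup>2)"
proof -
  have th: "0 < th" using r(1) ab cM by (simp add: th_def)
  have "\<exists>y\<in>{a..b}. th < \<bar>u y\<bar>"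
  proof (rule ccontr)
    assume "\<not> ?thesis"
    then have le: "\<bar>u y\<bar> \<le> th" if "y \<in> {a..b}" for y using that by (auto simp: not_less)
    have "r / 2 \<le> \<bar>q y\<bar>" if y: "y \<in> {a..b}" for y
    proof -
      have "\<bar>u y\<bar> \<le> r / 2" using le[OF y] by (simp add: th_def)
      then have "\<bar>u y\<bar>\<^sup>2 \<le> (r / 2)\<^sup>2" by (rule power_mono) simp
      moreover have "r\<^sup>2 \<le> (u y)\<^sup>2 + (q y)\<^sup>2" using r(2)[of y] y ab by auto
      ultimately have "(r / 2)\<^sup>2 \<le> \<bar>q y\<bar>\<^sup>2" by (simp add: power_divide) (use zero_le_power2[of r] in linarith)
      then show ?thesis by (rule power2_le_imp_le) simp
    qed
    then have "r / 2 / cM * (b - a) \<le> \<bar>u b - u a\<bar>"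
      by (intro u_increment_abs_ge) (use ab r in auto)
    also have "\<dots> \<le> 2 * th" using le[of a] le[of b] ab by (simp add: abs_le_iff)
    also have "\<dots> \<le> 2 * ((b - a) * r / (8 * cM))"
      unfolding th_def by (intro mult_left_mono min.cobounded2) simp
    finally have "(b - a) * r / cM * (1 / 2) \<le> (b - a) * r / cM * (1 / 4)" by (simp add: mult.commute)
    moreover have "0 < (b - a) * r / cM" using ab r cM by simp
    ultimately show False by simp
  qed
  then obtain y where y: "y \<in> {a..b}" "th < \<bar>u y\<bar>" by blast
  let ?Q = "\<Lambda> * (H + 1)"
  have Q: "0 < ?Q" using low lam_pos H by simp
  define d where "d = min ((b - a) / 2) (th * cm / (2 * ?Q))"
  have d: "0 < d" "d \<le> (b - a) / 2" "d * ?Q / cm \<le> th / 2"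
  proof -
    show "0 < d" using ab th cm Q by (simp add: d_def)
    show "d \<le> (b - a) / 2" unfolding d_def by (rule min.cobounded1)
    have "d \<le> th * cm / (2 * ?Q)" unfolding d_def by (rule min.cobounded2)
    then show "d * ?Q / cm \<le> th / 2" using Q cm by (simp add: field_simps)
  qed
  have lip: "\<bar>u t - u s\<bar> \<le> ?Q / cm * (t - s)" if st: "0 \<le> s" "s \<le> t" "t \<le> H" for s t
  proof (rule primitive_on_abs_le[OF u st])
    fix x assume x: "s \<le> x" "x \<le> t"
    have "\<bar>q x\<bar> \<le> lam * (H + 1)" by (rule flux_bound) (use x st in auto)
    also have "\<dots> \<le> ?Q" using low H by (intro mult_right_mono) auto
    finally have "\<bar>q x\<bar> / f x \<le> ?Q / cm" using Q by (intro frac_le f_ge cm) auto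
    then show "\<bar>q x / f x\<bar> \<le> ?Q / cm" using f_pos[of x] by simp
  qed
  \<comment> \<open>An interval of length \<open>d\<close> with end point \<open>y\<close>, directed away from the closer end of \<open>[a, b]\<close>.\<close>
  obtain s where s: "a \<le> s" "s + d \<le> b" "y = s \<or> y = s + d"
  proof (cases "y \<le> (a + b) / 2")
    case True
    then have "y + d \<le> (a + b) / 2 + (b - a) / 2" using d(2) by (rule add_mono)
    also have "\<dots> = b" by (simp add: field_simps)
    finally show ?thesis using that[of y] y by simp
  next
    case False
    then have "(a + b) / 2 - (b - a) / 2 \<le> y - d" using d(2) by linarith
    moreover have "(a + b) / 2 - (b - a) / 2 = a" by (simp add: field_simps)
    ultimately show ?thesis using that[of "y - d"] y by simp
  qed
  have big: "th\<^sup>2 / 4 \<le> (u x)\<^sup>2" if x: "x \<in> {s..s + d}" for x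
  proof -
    have "\<bar>u x - u y\<bar> \<le> ?Q / cm * d"
    proof -
      have "\<bar>u x - u y\<bar> \<le> ?Q / cm * \<bar>x - y\<bar>"
        using lip[of x y] lip[of y x] x s ab d by (cases "x \<le> y") (auto simp: abs_minus_commute)
      also have "\<dots> \<le> ?Q / cm * d" using x s(3) d(1) Q cm by (intro mult_left_mono) auto
      finally show ?thesis .
    qed
    also have "\<dots> \<le> th / 2" using d(3) by (simp add: ac_simps)
    finally have "th / 2 \<le> \<bar>u x\<bar>" using y(2) by linarith
    then have "(th / 2)\<^sup>2 \<le> \<bar>u x\<bar>\<^sup>2" by (rule power_mono) (use th in simp)
    then show ?thesis by (simp add: power_divide)
  qed
  have "d * th\<^sup>2 / 4 = integral {s..s + d} (\<lambda>x. th\<^sup>2 / 4)" using d(1) by simp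
  also have "\<dots> \<le> integral {s..s + d} (\<lambda>x. (u x)\<^sup>2)"
    by (rule integral_le) (use big mass_int[of s "s + d"] s ab in auto)
  also have "\<dots> \<le> integral {a..b} (\<lambda>x. (u x)\<^sup>2)"
    by (rule mass_mono) (use s ab in auto)
  finally show ?thesis by (simp add: d_def)
qed

end

section \<open>Mollified solutions of the Helmholtz equation\<close>

lemma test_fun_reflect:
  fixes \<rho> :: "'a::euclidean_space \<Rightarrow> real"
  assumes t: "test_fun V \<rho>" and sub: "\<And>z. z \<in> V \<Longrightarrow> x - z \<in> U"
  shows "test_fun U (\<lambda>y. \<rho> (x - y))"
proof -
  let ?S = "closure {z. \<rho> z \<noteq> 0}"
  have ck: "Ck_on k UNIV (\<lambda>y. \<rho> (x - y))" for k
    using Ck_on_affine[of "\<lambda>y. - y" k \<rho> x] t bounded_linear_minus[OF bounded_linear_ident]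
    by (simp add: test_fun_def smooth_on_def)
  have c: "compact ((\<lambda>z. x - z) ` ?S)"
    by (rule compact_continuous_image) (use t in \<open>auto simp: test_fun_def intro!: continuous_intros\<close>)
  have sub1: "{y. \<rho> (x - y) \<noteq> 0} \<subseteq> (\<lambda>z. x - z) ` ?S"
  proof
    fix y assume "y \<in> {y. \<rho> (x - y) \<noteq> 0}"
    then have "x - y \<in> ?S" using closure_subset[of "{z. \<rho> z \<noteq> 0}"] by auto
    then show "y \<in> (\<lambda>z. x - z) ` ?S" by (rule rev_image_eqI) simp
  qed
  have cl: "closure {y. \<rho> (x - y) \<noteq> 0} \<subseteq> (\<lambda>z. x - z) ` ?S"
    by (rule closure_minimal[OF sub1 compact_imp_closed[OF c]])
  moreover have "(\<lambda>z. x - z) ` ?S \<subseteq> U" using t sub by (auto simp: test_fun_def)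
  moreover have "compact (closure {y. \<rho> (x - y) \<noteq> 0})"
    unfolding compact_closure by (rule bounded_subset[OF compact_imp_bounded[OF c] sub1])
  ultimately show ?thesis using ck by (auto simp: test_fun_def smooth_on_def)
qed

lemma partial_deriv_reflect:
  fixes \<rho> :: "'a::euclidean_space \<Rightarrow> real"
  assumes t: "test_fun V \<rho>"
  shows "partial_deriv i (\<lambda>y. a * \<rho> (x - y)) = (\<lambda>y. - a * partial_deriv i \<rho> (x - y))"
proof
  fix y
  let ?D = "frechet_derivative \<rho> (at (x - y))"
  have d: "(\<rho> has_derivative ?D) (at (x - y))" by (rule test_fun_has_derivative[OF t])
  have "((\<lambda>y. \<rho> (x - y)) has_derivative (\<lambda>h. ?D (- h))) (at y)"
    by (rule has_derivative_compose[where g=\<rho> and f="\<lambda>y. x - y" and f'=uminus]) (auto intro!: derivative_eq_intros d)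
  then have "((\<lambda>y. a * \<rho> (x - y)) has_derivative (\<lambda>h. a * ?D (- h))) (at y)"
    by (rule has_derivative_mult_right)
  then have "partial_deriv i (\<lambda>y. a * \<rho> (x - y)) y = a * ?D (- i)" by (rule partial_deriv_eqI)
  also have "?D (- i) = - ?D i" by (rule linear_neg[OF has_derivative_linear[OF d]])
  finally show "partial_deriv i (\<lambda>y. a * \<rho> (x - y)) y = - a * partial_deriv i \<rho> (x - y)"
    by (simp add: partial_deriv_def)
qed

lemma test_fun_directional:
  assumes t: "test_fun V \<rho>"
  shows "((\<lambda>t. \<rho> (z + t *\<^sub>R e)) has_real_derivative partial_deriv e \<rho> (z + t *\<^sub>R e)) (at t)"
proof -
  let ?D = "frechet_derivative \<rho> (at (z + t *\<^sub>R e))"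
  have d: "(\<rho> has_derivative ?D) (at (z + t *\<^sub>R e))" by (rule test_fun_has_derivative[OF assms])
  have "((\<lambda>t. \<rho> (z + t *\<^sub>R e)) has_derivative (\<lambda>h. ?D (h *\<^sub>R e))) (at t)"
    by (rule has_derivative_compose[where g=\<rho> and f="\<lambda>t. z + t *\<^sub>R e"]) (auto intro!: derivative_eq_intros d)
  moreover have "(\<lambda>h. ?D (h *\<^sub>R e)) = (*) (partial_deriv e \<rho> (z + t *\<^sub>R e))"
    by (auto simp: partial_deriv_def linear_cmul[OF has_derivative_linear[OF d]])
  ultimately show ?thesis by (simp add: has_field_derivative_def)
qed

definition mollify :: "'a::euclidean_space set \<Rightarrow> ('a \<Rightarrow> real) \<Rightarrow> ('a \<Rightarrow> real) \<Rightarrow> 'a \<Rightarrow> real" where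
  "mollify U \<phi> \<rho> x = L2_inner U \<phi> (\<lambda>y. \<rho> (x - y))"

lemma L2_inner_dominated:
  fixes \<phi> :: "'a::euclidean_space \<Rightarrow> real"
  assumes \<phi>: "integrable (lebesgue_on U) \<phi>"
    and g: "\<And>n. continuous_on UNIV (g n)" "continuous_on UNIV g'"
    and lim: "\<And>y. (\<lambda>n. g n y) \<longlonglongrightarrow> g' y" and B: "\<And>n y. \<bar>g n y\<bar> \<le> B"
  shows "(\<lambda>n. L2_inner U \<phi> (g n)) \<longlonglongrightarrow> L2_inner U \<phi> g'"
  unfolding L2_inner_def
proof (rule integral_dominated_convergence[where w="\<lambda>y. B * \<bar>\<phi> y\<bar>"])
  have m: "f \<in> borel_measurable (lebesgue_on U)" if "continuous_on UNIV f" for f :: "'a \<Rightarrow> real"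
    by (intro measurable_restrict_space1 continuous_imp_lebesgue_measurable that)
  show "(\<lambda>x. \<phi> x * g' x) \<in> borel_measurable (lebesgue_on U)" "(\<lambda>x. \<phi> x * g n x) \<in> borel_measurable (lebesgue_on U)" for n
    using \<phi> m g by (auto intro!: borel_measurable_times)
  show "integrable (lebesgue_on U) (\<lambda>y. B * \<bar>\<phi> y\<bar>)" using \<phi> by simp
  show "AE x in lebesgue_on U. (\<lambda>n. \<phi> x * g n x) \<longlonglongrightarrow> \<phi> x * g' x"
    by (intro AE_I2 tendsto_mult tendsto_const lim)
  show "AE x in lebesgue_on U. norm (\<phi> x * g n x) \<le> B * \<bar>\<phi> x\<bar>" for n
  proof (rule AE_I2)
    fix x
    have "\<bar>g n x\<bar> * \<bar>\<phi> x\<bar> \<le> B * \<bar>\<phi> x\<bar>" by (intro mult_right_mono B) simp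
    then show "norm (\<phi> x * g n x) \<le> B * \<bar>\<phi> x\<bar>" by (simp add: abs_mult mult.commute)
  qed
qed

lemma mollify_continuous:
  fixes \<phi> :: "'a::euclidean_space \<Rightarrow> real"
  assumes \<phi>: "integrable (lebesgue_on U) \<phi>" and t: "test_fun V \<rho>"
  shows "continuous_on S (mollify U \<phi> \<rho>)"
proof -
  have c: "continuous_on UNIV \<rho>" by (rule test_fun_continuous[OF t])
  obtain B where B: "\<And>x. \<bar>\<rho> x\<bar> \<le> B" using test_fun_bounded[OF t] by metis
  have "continuous_on UNIV (mollify U \<phi> \<rho>)"
    unfolding continuous_on_sequentially
  proof (intro ballI allI impI)
    fix X :: "nat \<Rightarrow> 'a" and a assume X: "(\<forall>n. X n \<in> UNIV) \<and> X \<longlonglongrightarrow> a"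
    show "(mollify U \<phi> \<rho> \<circ> X) \<longlonglongrightarrow> mollify U \<phi> \<rho> a"
      unfolding o_def mollify_def
    proof (rule L2_inner_dominated[OF \<phi>])
      show "continuous_on UNIV (\<lambda>y. \<rho> (X n - y))" "continuous_on UNIV (\<lambda>y. \<rho> (a - y))" for n
        using c by (auto intro!: continuous_on_compose2[OF c] continuous_intros)
      show "(\<lambda>n. \<rho> (X n - y)) \<longlonglongrightarrow> \<rho> (a - y)" for y
        by (rule continuous_on_tendsto_compose[OF c]) (use X in \<open>auto intro!: tendsto_intros\<close>)
    qed (rule B)
  qed
  then show ?thesis by (rule continuous_on_subset) simp
qed

text \<open>The difference quotients of \<open>\<rho>\<close> converge pointwise and are bounded by the supremum of
  \<open>\<partial>\<^sub>e \<rho>\<close>, so dominated convergence applies. This single rule gives derivatives of all orders, since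
  \<open>\<partial>\<^sub>e \<rho>\<close> is a test function again.\<close>

lemma mollify_directional:
  fixes \<phi> :: "'a::euclidean_space \<Rightarrow> real"
  assumes \<phi>: "integrable (lebesgue_on U) \<phi>" and t: "test_fun V \<rho>" and e: "e \<in> Basis"
  shows "((\<lambda>t. mollify U \<phi> \<rho> (x + t *\<^sub>R e)) has_real_derivative mollify U \<phi> (partial_deriv e \<rho>) (x + t *\<^sub>R e)) (at t)"
proof -
  let ?m = "mollify U \<phi>"
  have t': "test_fun V (partial_deriv e \<rho>)" by (rule test_fun_partial_deriv[OF t e])
  have c: "continuous_on UNIV \<rho>" by (rule test_fun_continuous[OF t])
  have c': "continuous_on UNIV (partial_deriv e \<rho>)" by (rule test_fun_continuous[OF t'])
  obtain B where B: "\<And>x. \<bar>partial_deriv e \<rho> x\<bar> \<le> B" using test_fun_bounded[OF t'] by metis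
  have int: "integrable (lebesgue_on U) (\<lambda>y. \<phi> y * \<rho> (x - y))" for x
    by (rule test_fun_mult_integrable[OF \<phi> test_fun_reflect[OF t, of x UNIV]]) simp
  have z: "((\<lambda>t. ?m \<rho> (x + t *\<^sub>R e)) has_real_derivative ?m (partial_deriv e \<rho>) x) (at 0)" for x
    unfolding DERIV_def tendsto_at_iff_sequentially
  proof (intro allI impI)
    fix X :: "nat \<Rightarrow> real" assume X: "\<forall>i. X i \<in> UNIV - {0}" "X \<longlonglongrightarrow> 0"
    define g where "g n y = (\<rho> (x - y + X n *\<^sub>R e) - \<rho> (x - y)) / X n" for n y
    have "(\<lambda>n. L2_inner U \<phi> (g n)) \<longlonglongrightarrow> L2_inner U \<phi> (\<lambda>y. partial_deriv e \<rho> (x - y))"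
    proof (rule L2_inner_dominated[OF \<phi>])
      show "continuous_on UNIV (g n)" for n
        unfolding g_def[abs_def] divide_inverse
        by (intro continuous_on_mult_right continuous_on_diff continuous_on_compose2[OF c] continuous_intros) auto
      show "continuous_on UNIV (\<lambda>y. partial_deriv e \<rho> (x - y))"
        by (intro continuous_on_compose2[OF c'] continuous_intros) auto
      show "(\<lambda>n. g n y) \<longlonglongrightarrow> partial_deriv e \<rho> (x - y)" for y
      proof -
        have "((\<lambda>h. (\<rho> (x - y + h *\<^sub>R e) - \<rho> (x - y)) / h) \<longlongrightarrow> partial_deriv e \<rho> (x - y)) (at 0)"
          using test_fun_directional[OF t, of "x - y" e 0] by (simp add: DERIV_def)
        then show ?thesis using X unfolding tendsto_at_iff_sequentially by (auto simp: g_def o_def)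
      qed
      show "\<bar>g n y\<bar> \<le> B" for n y
      proof -
        have "norm (\<rho> (x - y + X n *\<^sub>R e) - \<rho> (x - y + 0 *\<^sub>R e)) \<le> B * norm (X n - 0)"
          by (rule field_differentiable_bound[of UNIV "\<lambda>t. \<rho> (x - y + t *\<^sub>R e)" "\<lambda>t. partial_deriv e \<rho> (x - y + t *\<^sub>R e)" B "X n" 0])
            (auto intro!: test_fun_directional[OF t] B)
        moreover have "X n \<noteq> 0" using X by auto
        ultimately show ?thesis by (simp add: g_def field_simps)
      qed
    qed
    moreover have "L2_inner U \<phi> (g n) = (?m \<rho> (x + X n *\<^sub>R e) - ?m \<rho> x) / X n" for n
    proof -
      have "L2_inner U \<phi> (g n) = (\<integral>y. (\<phi> y * \<rho> (x + X n *\<^sub>R e - y) - \<phi> y * \<rho> (x - y)) / X n \<partial>lebesgue_on U)"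
        unfolding L2_inner_def g_def
        by (rule Bochner_Integration.integral_cong) (auto simp: algebra_simps diff_divide_distrib)
      also have "\<dots> = (?m \<rho> (x + X n *\<^sub>R e) - ?m \<rho> x) / X n"
        using int by (simp add: mollify_def L2_inner_def)
      finally show ?thesis .
    qed
    ultimately show "((\<lambda>h. (?m \<rho> (x + (0 + h) *\<^sub>R e) - ?m \<rho> (x + 0 *\<^sub>R e)) / h) \<circ> X) \<longlonglongrightarrow> ?m (partial_deriv e \<rho>) x"
      by (simp add: o_def mollify_def)
  qed
  have "((\<lambda>s. ?m \<rho> (x + (s + t) *\<^sub>R e)) has_real_derivative ?m (partial_deriv e \<rho>) (x + t *\<^sub>R e)) (at 0)"
    using z[of "x + t *\<^sub>R e"] by (simp add: algebra_simps)
  then show ?thesis using DERIV_shift[of "\<lambda>t. ?m \<rho> (x + t *\<^sub>R e)" _ 0 t] by simp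
qed

lemma mollify_equation:
  fixes \<phi> :: "'a::euclidean_space \<Rightarrow> real"
  assumes weak: "\<And>\<psi>. test_fun U \<psi> \<Longrightarrow>
      (\<Sum>i\<in>Basis. L2_inner U \<phi> (partial_deriv i (partial_deriv i \<psi>))) = - k * L2_inner U \<phi> \<psi>"
    and t: "test_fun (ball 0 d) \<rho>" and x: "ball x d \<subseteq> U"
  shows "(\<Sum>i\<in>Basis. mollify U \<phi> (partial_deriv i (partial_deriv i \<rho>)) x) = - k * mollify U \<phi> \<rho> x"
proof -
  have tU: "test_fun U (\<lambda>y. \<rho> (x - y))"
    by (rule test_fun_reflect[OF t]) (use x in \<open>auto simp: dist_norm\<close>)
  have "partial_deriv i (partial_deriv i (\<lambda>y. \<rho> (x - y))) = (\<lambda>y. partial_deriv i (partial_deriv i \<rho>) (x - y))"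
    if "i \<in> Basis" for i
    using partial_deriv_reflect[OF t, of i 1 x] partial_deriv_reflect[OF test_fun_partial_deriv[OF t that], of i "-1" x]
    by simp
  then show ?thesis using weak[OF tU] by (simp add: mollify_def)
qed

section \<open>Weighted interior estimates\<close>

lemma integral_translate:
  fixes h :: "'a::euclidean_space \<Rightarrow> real"
  assumes "continuous_on UNIV h"
  shows "integral (cbox a b) (\<lambda>x. h (x + c)) = integral (cbox (a + c) (b + c)) h"
proof -
  have "h integrable_on cbox (a + c) (b + c)"
    by (rule integrable_continuous[OF continuous_on_subset[OF assms]]) simp
  then have "(h has_integral integral (cbox (a + c) (b + c)) h) (cbox (a + c) (b + c))"
    by (rule integrable_integral)
  from has_integral_affinity'[OF this, of 1 c] show ?thesis by (simp add: integral_unique)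
qed

lemma integral_eq_of_support:
  fixes h :: "'a::euclidean_space \<Rightarrow> real"
  assumes c: "continuous_on UNIV h" and z: "\<And>x. x \<notin> S \<Longrightarrow> h x = 0"
    and S: "S \<subseteq> cbox a b" "S \<subseteq> cbox a' b'"
  shows "integral (cbox a b) h = integral (cbox a' b') h"
proof -
  have "(h has_integral integral (cbox p q) h) UNIV" if "S \<subseteq> cbox p q" for p q
  proof (rule has_integral_on_superset)
    show "(h has_integral integral (cbox p q) h) (cbox p q)"
      by (intro integrable_integral integrable_continuous continuous_on_subset[OF c]) simp
  qed (use z that in auto)
  from this[OF S(1)] this[OF S(2)] show ?thesis by (rule has_integral_unique)
qed

text \<open>The integral of \<open>F (x + t e)\<close> does not depend on small \<open>t\<close>, by translation invariance; its
  derivative at \<open>t = 0\<close> is the integral of \<open>F'\<close>. Applied to a product it is partial integration.\<close>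

lemma integral_directional_derivative_eq_0:
  fixes F F' :: "'a::euclidean_space \<Rightarrow> real"
  assumes d: "\<And>x t. ((\<lambda>t. F (x + t *\<^sub>R e)) has_real_derivative F' (x + t *\<^sub>R e)) (at t)"
    and c: "continuous_on UNIV F" "continuous_on UNIV F'" and e: "norm e \<le> 1"
    and z: "\<And>x. x \<notin> cball p R \<Longrightarrow> F x = 0" and sub: "cball p (R + 1) \<subseteq> cbox a b"
  shows "integral (cbox a b) F' = 0"
proof -
  define g where "g t = integral (cbox a b) (\<lambda>x. F (x + t *\<^sub>R e))" for t
  have "((\<lambda>t. integral (cbox a b) (\<lambda>x. F (x + t *\<^sub>R e))) has_real_derivative integral (cbox a b) (\<lambda>x. F' (x + 0 *\<^sub>R e))) (at 0 within UNIV)"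
  proof (rule leibniz_rule_field_derivative[where U=UNIV])
    show "((\<lambda>t. F (x + t *\<^sub>R e)) has_real_derivative F' (x + t *\<^sub>R e)) (at t within UNIV)" for t x
      using d by simp
    show "(\<lambda>x. F (x + t *\<^sub>R e)) integrable_on cbox a b" for t
      by (intro integrable_continuous continuous_on_compose2[OF c(1)] continuous_intros) auto
    show "continuous_on (UNIV \<times> cbox a b) (\<lambda>(t, x). F' (x + t *\<^sub>R e))"
      unfolding split_beta by (intro continuous_on_compose2[OF c(2)] continuous_intros) auto
  qed auto
  then have 1: "(g has_real_derivative integral (cbox a b) F') (at 0)" by (simp add: g_def[abs_def])
  have const: "g t = integral (cbox a b) F" if t: "\<bar>t\<bar> < 1" for t
  proof -
    have "integral (cbox a b) F = integral (cbox (a + t *\<^sub>R e) (b + t *\<^sub>R e)) F"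
    proof (rule integral_eq_of_support[OF c(1) z])
      show "cball p R \<subseteq> cbox a b" using sub by (rule order_trans[rotated]) auto
      show "cball p R \<subseteq> cbox (a + t *\<^sub>R e) (b + t *\<^sub>R e)"
      proof
        fix x assume x: "x \<in> cball p R"
        have "norm (t *\<^sub>R e) \<le> 1" using t e by (simp add: mult_le_one)
        then have "dist p (x - t *\<^sub>R e) \<le> R + 1"
          using x norm_triangle_ineq[of "p - x" "t *\<^sub>R e"] by (simp add: dist_norm algebra_simps)
        then have "x - t *\<^sub>R e \<in> cbox a b" using sub by auto
        then show "x \<in> cbox (a + t *\<^sub>R e) (b + t *\<^sub>R e)"
          by (auto simp: mem_box inner_simps)
      qed
    qed
    then show ?thesis by (simp add: g_def integral_translate[OF c(1)])
  qed
  have "((\<lambda>t. integral (cbox a b) F) has_real_derivative 0) (at 0)" by simp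
  then have "(g has_real_derivative 0) (at 0)"
    by (rule has_field_derivative_transform_within_open[where S="ball 0 1"]) (use const in \<open>auto simp: dist_real_def\<close>)
  with 1 show ?thesis by (rule DERIV_unique)
qed

text \<open>At the kink the exponent, which is at least \<open>2\<close>, makes the difference quotient tend to zero.\<close>

lemma pos_part_power_deriv:
  fixes s :: real
  shows "((\<lambda>s. (max 0 s) ^ Suc (Suc k)) has_real_derivative real (Suc (Suc k)) * (max 0 s) ^ Suc k) (at s)"
proof -
  consider "s < 0" | "s = 0" | "0 < s" by linarith
  then show ?thesis
  proof cases
    case 1
    have "((\<lambda>_. 0) has_real_derivative 0) (at s)" by simp
    then have "((\<lambda>s::real. (max 0 s) ^ Suc (Suc k)) has_real_derivative 0) (at s)"
      by (rule has_field_derivative_transform_within_open[where S="{..<0}"]) (use 1 in auto)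
    then show ?thesis using 1 by (simp add: max_def)
  next
    case 2
    have "((\<lambda>h::real. (max 0 h) ^ Suc (Suc k) / h) \<longlongrightarrow> 0) (at 0)"
    proof (rule Lim_null_comparison)
      show "\<forall>\<^sub>F h in at (0::real). norm ((max 0 h) ^ Suc (Suc k) / h) \<le> \<bar>h\<bar> ^ Suc k"
      proof (rule always_eventually, rule allI)
        fix h :: real
        show "norm ((max 0 h) ^ Suc (Suc k) / h) \<le> \<bar>h\<bar> ^ Suc k"
        proof (cases "0 < h")
          case False
          have "0 \<le> \<bar>h\<bar> ^ Suc k" by (rule zero_le_power) simp
          moreover have "max 0 h = 0" using False by simp
          ultimately show ?thesis by (simp only: power_0_Suc div_0 norm_zero)
        qed (simp add: max_def)
      qed
      have "((\<lambda>h::real. \<bar>h\<bar> ^ Suc k) \<longlongrightarrow> \<bar>0\<bar> ^ Suc k) (at 0)" by (intro tendsto_intros)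
      then show "((\<lambda>h::real. \<bar>h\<bar> ^ Suc k) \<longlongrightarrow> 0) (at 0)" by simp
    qed
    then show ?thesis using 2 by (simp add: DERIV_def)
  next
    case 3
    have "((\<lambda>s. s ^ Suc (Suc k)) has_real_derivative Suc (Suc k) * s ^ Suc k) (at s)"
      using DERIV_pow[of "Suc (Suc k)" s UNIV] by simp
    then have "((\<lambda>s::real. (max 0 s) ^ Suc (Suc k)) has_real_derivative Suc (Suc k) * s ^ Suc k) (at s)"
      by (rule has_field_derivative_transform_within_open[where S="{0<..}"]) (use 3 in auto)
    then show ?thesis using 3 by (simp add: max_def)
  qed
qed

definition ball_weight :: "'a::euclidean_space \<Rightarrow> real \<Rightarrow> 'a \<Rightarrow> real" where
  "ball_weight p R x = max 0 (R\<^sup>2 - (norm (x - p))\<^sup>2)"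

lemma ball_weight_bounds: "0 \<le> ball_weight p R x" "ball_weight p R x \<le> R\<^sup>2"
  by (auto simp: ball_weight_def)

lemma ball_weight_outside: "0 < R \<Longrightarrow> x \<notin> ball p R \<Longrightarrow> ball_weight p R x = 0"
  using power_mono[of R "norm (x - p)" 2] by (auto simp: ball_weight_def dist_norm norm_minus_commute)

lemma ball_weight_continuous: "continuous_on S (ball_weight p R)"
  unfolding ball_weight_def[abs_def] by (intro continuous_intros)

lemma ball_weight_directional:
  "((\<lambda>t. ball_weight p R (x + t *\<^sub>R e) ^ Suc (Suc k)) has_real_derivative
     Suc (Suc k) * ball_weight p R (x + t *\<^sub>R e) ^ Suc k * (- 2 * ((x + t *\<^sub>R e - p) \<bullet> e))) (at t)"
proof -
  have "((\<lambda>t. R\<^sup>2 - (norm (x + t *\<^sub>R e - p))\<^sup>2) has_real_derivative - 2 * ((x + t *\<^sub>R e - p) \<bullet> e)) (at t)"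
    unfolding power2_norm_eq_inner has_field_derivative_def
    by (auto intro!: derivative_eq_intros simp: fun_eq_iff inner_commute)
  from DERIV_chain2[OF pos_part_power_deriv[of k] this] show ?thesis
    by (simp add: ball_weight_def)
qed

text \<open>Integrate the divergence of \<open>W\<^sup>2\<^sup>n\<^sup>+\<^sup>2 v \<nabla>v\<close> and absorb the term with \<open>\<nabla>W\<close> by Young's inequality.
  As \<open>\<bar>\<nabla>W\<bar> \<le> 2 R\<close>, each derivative costs one power of the weight and a factor proportional to
  \<open>n + 1\<close>. Putting the powers into the weight makes it possible to iterate on one ball, without
  shrinking radii.\<close>

lemma weighted_Caccioppoli:
  fixes v :: "'a::euclidean_space \<Rightarrow> real" and p :: 'a and R :: real
  defines "W \<equiv> ball_weight p R"
  assumes c: "continuous_on UNIV v" "\<And>i. i \<in> Basis \<Longrightarrow> continuous_on UNIV (D i)" "\<And>i. i \<in> Basis \<Longrightarrow> continuous_on UNIV (DD i)"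
    and d: "\<And>i x t. i \<in> Basis \<Longrightarrow> ((\<lambda>t. v (x + t *\<^sub>R i)) has_real_derivative D i (x + t *\<^sub>R i)) (at t)"
      "\<And>i x t. i \<in> Basis \<Longrightarrow> ((\<lambda>t. D i (x + t *\<^sub>R i)) has_real_derivative DD i (x + t *\<^sub>R i)) (at t)"
    and eq: "\<And>x. x \<in> ball p R \<Longrightarrow> (\<Sum>i\<in>Basis. DD i x) = - k * v x"
    and k: "0 \<le> k" and R: "0 < R" and sub: "cball p (R + 1) \<subseteq> cbox a b"
  shows "integral (cbox a b) (\<lambda>x. W x ^ (2 * n + 2) * (\<Sum>i\<in>Basis. (D i x)\<^sup>2))
    \<le> (real n + 1)\<^sup>2 * (2 * k * R^4 + 16 * R\<^sup>2) * integral (cbox a b) (\<lambda>x. W x ^ (2 * n) * (v x)\<^sup>2)"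
proof -
  define N where "N = real n + 1"
  have N: "1 \<le> N" by (simp add: N_def)
  have cW: "continuous_on S W" for S unfolding W_def by (rule ball_weight_continuous)
  define F where "F i x = W x ^ (2 * n + 2) * (v x * D i x)" for i x
  define F' where "F' i x = 2 * N * W x ^ (2 * n + 1) * (- 2 * ((x - p) \<bullet> i)) * (v x * D i x)
    + W x ^ (2 * n + 2) * (D i x * D i x + v x * DD i x)" for i x
  have cF': "continuous_on UNIV (F' i)" if "i \<in> Basis" for i
    unfolding F'_def[abs_def] by (intro continuous_intros c that cW)
  have int0: "integral (cbox a b) (F' i) = 0" if i: "i \<in> Basis" for i
  proof (rule integral_directional_derivative_eq_0[OF _ _ cF'[OF i] _ _ sub])
    show "continuous_on UNIV (F i)"
      unfolding F_def[abs_def] by (intro continuous_intros c i cW)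
    show "norm i \<le> 1" using i by simp
    show "F i x = 0" if "x \<notin> cball p R" for x
    proof -
      have "x \<notin> ball p R" using that by auto
      then have "W x = 0" unfolding W_def by (rule ball_weight_outside[OF R])
      then show ?thesis by (simp add: F_def)
    qed
    show "((\<lambda>t. F i (x + t *\<^sub>R i)) has_real_derivative F' i (x + t *\<^sub>R i)) (at t)" for x t
    proof -
      have w: "((\<lambda>t. W (x + t *\<^sub>R i) ^ (2 * n + 2)) has_real_derivative
         2 * N * W (x + t *\<^sub>R i) ^ (2 * n + 1) * (- 2 * ((x + t *\<^sub>R i - p) \<bullet> i))) (at t)"
        using ball_weight_directional[of p R x i "2 * n" t] by (simp add: W_def N_def algebra_simps)
      show ?thesis unfolding F_def F'_def
        by (rule DERIV_cong[OF DERIV_mult[OF w DERIV_mult[OF d(1)[OF i] d(2)[OF i]]]]) (simp add: algebra_simps)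
    qed
  qed
  let ?G = "\<lambda>x. W x ^ (2 * n + 2) * (\<Sum>i\<in>Basis. (D i x)\<^sup>2)"
  let ?V = "\<lambda>x. W x ^ (2 * n) * (v x)\<^sup>2"
  have pw: "?G x / 2 - N\<^sup>2 * (k * R^4 + 8 * R\<^sup>2) * ?V x \<le> (\<Sum>i\<in>Basis. F' i x)" for x
  \<comment> \<open>Outside the ball all factors \<open>W\<close> on the right vanish, while \<open>W\<^sup>2\<^sup>n\<close> on the left is \<open>1\<close> for \<open>n = 0\<close>.\<close>
  proof (cases "x \<in> ball p R")
    case False
    then have "W x = 0" unfolding W_def by (rule ball_weight_outside[OF R])
    then show ?thesis using k by (simp add: F'_def)
  next
    case True
    have W: "0 \<le> W x" "W x \<le> R\<^sup>2" by (simp_all add: W_def ball_weight_bounds)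
    have "(norm (x - p))\<^sup>2 \<le> R\<^sup>2"
      using True by (intro power_mono) (auto simp: dist_norm norm_minus_commute)
    then have xp: "(\<Sum>i\<in>Basis. ((x - p) \<bullet> i)\<^sup>2) \<le> R\<^sup>2"
      by (simp add: norm_eq_sqrt_inner euclidean_inner[of "x - p" "x - p"] power2_eq_square sum_nonneg)
    \<comment> \<open>Young's inequality, as the square of \<open>W\<^sup>n\<^sup>+\<^sup>1 D i - 4 N (x - p)\<^sub>i W\<^sup>n v\<close>.\<close>
    have young: "- (W x ^ (2 * n + 2) * (D i x)\<^sup>2 / 2) - 8 * N\<^sup>2 * ?V x * ((x - p) \<bullet> i)\<^sup>2
        \<le> 2 * N * W x ^ (2 * n + 1) * (- 2 * ((x - p) \<bullet> i)) * (v x * D i x)" for i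
    proof -
      have "0 \<le> (W x ^ (n + 1) * D i x - 4 * N * ((x - p) \<bullet> i) * W x ^ n * v x)\<^sup>2" by simp
      also have "\<dots> = W x ^ (2 * n + 2) * (D i x)\<^sup>2 - 8 * N * W x ^ (2 * n + 1) * ((x - p) \<bullet> i) * (v x * D i x)
          + 16 * N\<^sup>2 * ?V x * ((x - p) \<bullet> i)\<^sup>2"
      proof -
        have e: "W x ^ (n + 1) = W x * W x ^ n" "W x ^ (2 * n) = W x ^ n * W x ^ n"
          "W x ^ (2 * n + 1) = W x * (W x ^ n * W x ^ n)" "W x ^ (2 * n + 2) = W x * W x * (W x ^ n * W x ^ n)"
          by (simp_all add: mult_2 power_add)
        have "(z * w * y - 4 * N * r * w * u)\<^sup>2 = z * z * (w * w) * y\<^sup>2 - 8 * N * (z * (w * w)) * r * (u * y)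
          + 16 * N\<^sup>2 * (w * w * u\<^sup>2) * r\<^sup>2" for z w y r u :: real
          by (simp add: power2_eq_square algebra_simps)
        then show ?thesis unfolding e .
      qed
      finally show ?thesis by (simp add: algebra_simps)
    qed
    have "(\<Sum>i\<in>Basis. F' i x) = (\<Sum>i\<in>Basis. 2 * N * W x ^ (2 * n + 1) * (- 2 * ((x - p) \<bullet> i)) * (v x * D i x))
      + W x ^ (2 * n + 2) * (\<Sum>i\<in>Basis. (D i x)\<^sup>2) + W x ^ (2 * n + 2) * (v x * (\<Sum>i\<in>Basis. DD i x))"
      unfolding F'_def sum.distrib distrib_left sum_distrib_left power2_eq_square by (simp only: add.assoc)
    also have "W x ^ (2 * n + 2) * (v x * (\<Sum>i\<in>Basis. DD i x)) = - (k * (W x)\<^sup>2 * ?V x)"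
      unfolding eq[OF True] by (simp add: power_add power2_eq_square algebra_simps)
    finally have 1: "(\<Sum>i\<in>Basis. F' i x) = (\<Sum>i\<in>Basis. 2 * N * W x ^ (2 * n + 1) * (- 2 * ((x - p) \<bullet> i)) * (v x * D i x))
      + ?G x - k * (W x)\<^sup>2 * ?V x" by simp
    have "(\<Sum>i\<in>Basis. - (W x ^ (2 * n + 2) * (D i x)\<^sup>2 / 2) - 8 * N\<^sup>2 * ?V x * ((x - p) \<bullet> i)\<^sup>2)
      \<le> (\<Sum>i\<in>Basis. 2 * N * W x ^ (2 * n + 1) * (- 2 * ((x - p) \<bullet> i)) * (v x * D i x))"
      by (rule sum_mono) (rule young)
    moreover have "(\<Sum>i\<in>Basis. - (W x ^ (2 * n + 2) * (D i x)\<^sup>2 / 2) - 8 * N\<^sup>2 * ?V x * ((x - p) \<bullet> i)\<^sup>2)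
      = - (?G x / 2) - 8 * N\<^sup>2 * ?V x * (\<Sum>i\<in>Basis. ((x - p) \<bullet> i)\<^sup>2)"
      by (simp add: sum_subtractf sum_negf sum_distrib_left sum_divide_distrib)
    moreover have V0: "0 \<le> ?V x" using W by simp
    moreover have "8 * N\<^sup>2 * ?V x * (\<Sum>i\<in>Basis. ((x - p) \<bullet> i)\<^sup>2) \<le> 8 * N\<^sup>2 * ?V x * R\<^sup>2"
      by (intro mult_left_mono xp) (use V0 in simp)
    moreover have "k * (W x)\<^sup>2 * ?V x \<le> N\<^sup>2 * (k * R^4) * ?V x"
    proof (intro mult_right_mono V0)
      have "(W x)\<^sup>2 \<le> (R\<^sup>2)\<^sup>2" by (rule power_mono[OF W(2,1)])
      then have "k * (W x)\<^sup>2 \<le> k * R^4" using k by (intro mult_left_mono) auto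
      also have "\<dots> \<le> N\<^sup>2 * (k * R^4)"
        using mult_right_mono[of 1 "N\<^sup>2" "k * R^4"] N k by (simp add: one_le_power)
      finally show "k * (W x)\<^sup>2 \<le> N\<^sup>2 * (k * R^4)" .
    qed
    ultimately show ?thesis using 1 by (simp add: algebra_simps)
  qed
  have cG: "continuous_on (cbox a b) ?G" "continuous_on (cbox a b) ?V"
    by (intro continuous_intros cW continuous_on_subset[OF c(1)] continuous_on_subset[OF c(2)]; simp)+
  note iG = integrable_continuous[OF cG(1)] and iV = integrable_continuous[OF cG(2)]
  have iF: "F' i integrable_on cbox a b" if "i \<in> Basis" for i
    by (rule integrable_continuous[OF continuous_on_subset[OF cF'[OF that]]]) simp
  have iG': "(\<lambda>x. ?G x / 2) integrable_on cbox a b" by (rule integrable_on_divide[OF iG])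
  have iV': "(\<lambda>x. N\<^sup>2 * (k * R^4 + 8 * R\<^sup>2) * ?V x) integrable_on cbox a b" by (rule integrable_on_mult_right[OF iV])
  have "integral (cbox a b) (\<lambda>x. ?G x / 2 - N\<^sup>2 * (k * R^4 + 8 * R\<^sup>2) * ?V x) \<le> integral (cbox a b) (\<lambda>x. \<Sum>i\<in>Basis. F' i x)"
    by (rule integral_le[OF Henstock_Kurzweil_Integration.integrable_diff[OF iG' iV'] Henstock_Kurzweil_Integration.integrable_sum pw])
      (use iF in auto)
  also have "\<dots> = 0" using int0 iF by (subst Henstock_Kurzweil_Integration.integral_sum) auto
  also have "integral (cbox a b) (\<lambda>x. ?G x / 2 - N\<^sup>2 * (k * R^4 + 8 * R\<^sup>2) * ?V x)
      = integral (cbox a b) ?G / 2 - N\<^sup>2 * (k * R^4 + 8 * R\<^sup>2) * integral (cbox a b) ?V"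
    by (simp only: Henstock_Kurzweil_Integration.integral_diff[OF iG' iV'] integral_mult_right integral_divide)
  finally show ?thesis by (simp add: N_def algebra_simps)
qed

section \<open>Unique continuation\<close>

locale weak_helmholtz =
  fixes U :: "'a::euclidean_space set" and \<phi> :: "'a \<Rightarrow> real" and k :: real
  assumes \<phi>: "integrable (lebesgue_on U) \<phi>" and U: "open U" and k: "0 \<le> k"
    and weak: "\<And>\<psi>. test_fun U \<psi> \<Longrightarrow>
      (\<Sum>i\<in>Basis. L2_inner U \<phi> (partial_deriv i (partial_deriv i \<psi>))) = - k * L2_inner U \<phi> \<psi>"
begin

lemma test_fun_iterated: "test_fun V \<rho> \<Longrightarrow> e \<in> Basis \<Longrightarrow> test_fun V ((partial_deriv e ^^ n) \<rho>)"
  by (induction n) (auto intro: test_fun_partial_deriv)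

text \<open>Iterating \<open>weighted_Caccioppoli\<close>: every derivative of a mollified solution is the mollification
  by a derivative of \<open>\<rho>\<close>, hence a solution again.\<close>

lemma iterated_derivative_bound:
  fixes p e :: 'a and R d :: real and \<rho> :: "'a \<Rightarrow> real" and a b :: 'a
  defines "u \<equiv> (\<lambda>n. mollify U \<phi> ((partial_deriv e ^^ n) \<rho>))"
  assumes t: "test_fun (ball 0 d) \<rho>" and e: "e \<in> Basis" and R: "0 < R" and d: "0 < d"
    and sub: "ball p (R + d) \<subseteq> U" and ab: "cball p (R + 1) \<subseteq> cbox a b"
  shows "integral (cbox a b) (\<lambda>x. ball_weight p R x ^ (2 * n) * (u n x)\<^sup>2)
    \<le> (fact n)\<^sup>2 * (2 * k * R^4 + 16 * R\<^sup>2) ^ n * integral (cbox a b) (\<lambda>x. (u 0 x)\<^sup>2)"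
proof (induction n)
  case (Suc n)
  let ?r = "(partial_deriv e ^^ n) \<rho>" and ?W = "ball_weight p R" and ?K = "2 * k * R^4 + 16 * R\<^sup>2"
  have K: "0 \<le> ?K" using k by simp
  have tr: "test_fun (ball 0 d) ?r" by (rule test_fun_iterated[OF t e])
  define D where "D i = mollify U \<phi> (partial_deriv i ?r)" for i
  define DD where "DD i = mollify U \<phi> (partial_deriv i (partial_deriv i ?r))" for i
  have t1: "test_fun (ball 0 d) (partial_deriv i ?r)" if "i \<in> Basis" for i by (rule test_fun_partial_deriv[OF tr that])
  have t2: "test_fun (ball 0 d) (partial_deriv i (partial_deriv i ?r))" if "i \<in> Basis" for i
    by (rule test_fun_partial_deriv[OF t1[OF that] that])
  have cu: "continuous_on S (u n)" for S unfolding u_def by (rule mollify_continuous[OF \<phi> tr])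
  have cD: "continuous_on S (D i)" if "i \<in> Basis" for S i unfolding D_def by (rule mollify_continuous[OF \<phi> t1[OF that]])
  have cW: "continuous_on S ?W" for S by (rule ball_weight_continuous)
  have C: "integral (cbox a b) (\<lambda>x. ?W x ^ (2 * n + 2) * (\<Sum>i\<in>Basis. (D i x)\<^sup>2))
    \<le> (real n + 1)\<^sup>2 * ?K * integral (cbox a b) (\<lambda>x. ?W x ^ (2 * n) * (u n x)\<^sup>2)"
  proof (rule weighted_Caccioppoli[where DD=DD])
    show "continuous_on UNIV (u n)" by (rule cu)
    show "continuous_on UNIV (D i)" if "i \<in> Basis" for i by (rule cD[OF that])
    show "continuous_on UNIV (DD i)" if "i \<in> Basis" for i unfolding DD_def by (rule mollify_continuous[OF \<phi> t2[OF that]])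
    show "((\<lambda>t. u n (x + t *\<^sub>R i)) has_real_derivative D i (x + t *\<^sub>R i)) (at t)" if "i \<in> Basis" for i x t
      unfolding u_def D_def by (rule mollify_directional[OF \<phi> tr that])
    show "((\<lambda>t. D i (x + t *\<^sub>R i)) has_real_derivative DD i (x + t *\<^sub>R i)) (at t)" if "i \<in> Basis" for i x t
      unfolding D_def DD_def by (rule mollify_directional[OF \<phi> t1[OF that] that])
    show "(\<Sum>i\<in>Basis. DD i x) = - k * u n x" if x: "x \<in> ball p R" for x
      unfolding DD_def u_def
    proof (rule mollify_equation[OF weak tr])
      show "ball x d \<subseteq> U"
      proof
        fix y assume "y \<in> ball x d"
        then have "y \<in> ball p (R + d)" using x dist_triangle[of p y x] by (simp add: dist_commute)
        then show "y \<in> U" using sub by blast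
      qed
    qed
  qed (use k R ab in auto)
  have "integral (cbox a b) (\<lambda>x. ?W x ^ (2 * Suc n) * (u (Suc n) x)\<^sup>2)
    \<le> integral (cbox a b) (\<lambda>x. ?W x ^ (2 * n + 2) * (\<Sum>i\<in>Basis. (D i x)\<^sup>2))"
  proof (rule integral_le)
    have eD: "u (Suc n) = D e" by (simp add: u_def D_def)
    show "(\<lambda>x. ?W x ^ (2 * Suc n) * (u (Suc n) x)\<^sup>2) integrable_on cbox a b"
      unfolding eD by (intro integrable_continuous continuous_intros cW cD e)
    show "(\<lambda>x. ?W x ^ (2 * n + 2) * (\<Sum>i\<in>Basis. (D i x)\<^sup>2)) integrable_on cbox a b"
      by (intro integrable_continuous continuous_intros cW cD)
    fix x
    have "(D e x)\<^sup>2 \<le> (\<Sum>i\<in>Basis. (D i x)\<^sup>2)" by (rule member_le_sum[OF e]) auto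
    then have "?W x ^ (2 * n + 2) * (D e x)\<^sup>2 \<le> ?W x ^ (2 * n + 2) * (\<Sum>i\<in>Basis. (D i x)\<^sup>2)"
      by (rule mult_left_mono) (rule zero_le_power[OF ball_weight_bounds(1)])
    then show "?W x ^ (2 * Suc n) * (u (Suc n) x)\<^sup>2 \<le> ?W x ^ (2 * n + 2) * (\<Sum>i\<in>Basis. (D i x)\<^sup>2)"
      unfolding eD by simp
  qed
  also note C
  also have "(real n + 1)\<^sup>2 * ?K * integral (cbox a b) (\<lambda>x. ?W x ^ (2 * n) * (u n x)\<^sup>2)
    \<le> (real n + 1)\<^sup>2 * ?K * ((fact n)\<^sup>2 * ?K ^ n * integral (cbox a b) (\<lambda>x. (u 0 x)\<^sup>2))"
    by (rule mult_left_mono[OF Suc.IH]) (use K in simp)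
  also have "\<dots> = (fact (Suc n))\<^sup>2 * ?K ^ Suc n * integral (cbox a b) (\<lambda>x. (u 0 x)\<^sup>2)"
  proof -
    have "fact (Suc n) = (real n + 1) * (fact n :: real)" by (simp add: add.commute)
    then show ?thesis by (simp only: power_mult_distrib power_Suc ac_simps)
  qed
  finally show ?case .
qed simp

text \<open>Let \<open>D\<close> be a box around \<open>x\<close> on whose neighbourhood the mollified solution \<open>w\<close> vanishes. The
  function \<open>t \<mapsto> \<integral> w (y + t e) \<eta> y dy\<close> over \<open>D\<close> has vanishing derivatives of all orders at \<open>0\<close>, while
  its \<open>n\<close>-th derivative is at most \<open>C A\<^sup>n n!\<close> by \<open>iterated_derivative_bound\<close>. Hence it vanishes for
  \<open>\<bar>t\<bar> A < 1\<close>. At \<open>t = t0\<close>, with \<open>\<eta> y = w (y + t0 e)\<close>, it is the integral of \<open>w\<^sup>2\<close> over the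
  translated box. The bound on \<open>t0\<close> involves neither \<open>s\<close> nor \<open>d\<close>.\<close>

lemma mollified_zero_propagates:
  fixes p e x :: 'a and R d s t0 :: real and \<rho> :: "'a \<Rightarrow> real"
  assumes t: "test_fun (ball 0 d) \<rho>" and e: "e \<in> Basis" and R: "0 < R" and d: "0 < d"
    and sub: "ball p (R + d) \<subseteq> U" and x: "x \<in> ball p (R / 4)" and s: "0 < s"
    and zero: "\<And>y. y \<in> ball x s \<Longrightarrow> mollify U \<phi> \<rho> y = 0"
    and t0: "\<bar>t0\<bar> \<le> R / 8" "\<bar>t0\<bar> * (4 * sqrt (2 * k * R^4 + 16 * R\<^sup>2) / (3 * R\<^sup>2)) < 1"
  shows "mollify U \<phi> \<rho> (x + t0 *\<^sub>R e) = 0"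
proof -
  define u where "u n = mollify U \<phi> ((partial_deriv e ^^ n) \<rho>)" for n
  define K where "K = 2 * k * R^4 + 16 * R\<^sup>2"
  have K: "0 \<le> K" using k by (simp add: K_def)
  define A where "A = 4 * sqrt K / (3 * R\<^sup>2)"
  have A: "0 < A" using k R by (simp add: A_def K_def add_nonneg_pos)
  have cu: "continuous_on S (u n)" for S n
    unfolding u_def by (rule mollify_continuous[OF \<phi> test_fun_iterated[OF t e]])
  have du: "((\<lambda>t. u n (y + t *\<^sub>R e)) has_real_derivative u (Suc n) (y + t *\<^sub>R e)) (at t)" for n y t
    unfolding u_def using mollify_directional[OF \<phi> test_fun_iterated[OF t e] e] by simp
  have zn: "u n y = 0" if "y \<in> ball x s" for n y
    using that
  proof (induction n arbitrary: y)
    case 0 then show ?case using zero by (simp add: u_def)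
  next
    case (Suc n)
    let ?T = "(\<lambda>t. y + t *\<^sub>R e) -` ball x s"
    have op: "open ?T" by (intro continuous_open_vimage) (auto intro!: continuous_intros)
    have "((\<lambda>t. 0) has_real_derivative 0) (at 0)" by simp
    then have "((\<lambda>t. u n (y + t *\<^sub>R e)) has_real_derivative 0) (at 0)"
      by (rule has_field_derivative_transform_within_open[OF _ op]) (use Suc in auto)
    with du[of n y 0] show ?case by (auto dest: DERIV_unique)
  qed
  obtain a b where ab: "cball p (R + 1) \<subseteq> cbox a b"
    by (rule bounded_subset_cbox_symmetric[OF bounded_cball])
  have "open (ball x (min s (R / 8)))" "x \<in> ball x (min s (R / 8))" using s R by auto
  then obtain l r where lr: "x \<in> box l r" "cbox l r \<subseteq> ball x (min s (R / 8))"
    by (metis open_contains_cbox)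
  have xlr: "x \<in> cbox l r" using lr(1) box_subset_cbox by blast
  define \<eta> where "\<eta> y = u 0 (y + t0 *\<^sub>R e)" for y
  have c\<eta>: "continuous_on S \<eta>" for S
    unfolding \<eta>_def[abs_def] by (intro continuous_on_compose2[OF cu[of UNIV]] continuous_intros) auto
  obtain B where B: "0 < B" "\<And>y. y \<in> cbox l r \<Longrightarrow> \<bar>\<eta> y\<bar> \<le> B"
  proof -
    have "bounded (\<eta> ` cbox l r)" by (intro compact_imp_bounded compact_continuous_image c\<eta>) auto
    then show ?thesis using that unfolding bounded_pos by auto
  qed
  define f where "f n t = integral (cbox l r) (\<lambda>y. u n (y + t *\<^sub>R e) * \<eta> y)" for n t
  have cut: "continuous_on S (\<lambda>y. u n (y + t *\<^sub>R e))" for n t S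
    by (intro continuous_on_compose2[OF cu[of UNIV]] continuous_intros) auto
  have df: "(f n has_real_derivative f (Suc n) t) (at t)" for n t
  proof -
    have "((\<lambda>t. integral (cbox l r) (\<lambda>y. u n (y + t *\<^sub>R e) * \<eta> y)) has_real_derivative
        integral (cbox l r) (\<lambda>y. u (Suc n) (y + t *\<^sub>R e) * \<eta> y)) (at t within UNIV)"
    proof (rule leibniz_rule_field_derivative[where U=UNIV])
      show "((\<lambda>t. u n (y + t *\<^sub>R e) * \<eta> y) has_real_derivative u (Suc n) (y + t *\<^sub>R e) * \<eta> y) (at t within UNIV)" for t y
        using DERIV_mult[OF du[of n y t] DERIV_const[of "\<eta> y"]] by simp
      show "(\<lambda>y. u n (y + t *\<^sub>R e) * \<eta> y) integrable_on cbox l r" for t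
        by (intro integrable_continuous continuous_on_mult cut c\<eta>)
      show "continuous_on (UNIV \<times> cbox l r) (\<lambda>(t, y). u (Suc n) (y + t *\<^sub>R e) * \<eta> y)"
        unfolding split_beta
        by (intro continuous_on_mult continuous_on_compose2[OF cu[of UNIV]] continuous_on_compose2[OF c\<eta>[of UNIV]] continuous_intros) auto
    qed auto
    then show ?thesis by (simp add: f_def[abs_def])
  qed
  have f0: "f n 0 = 0" for n
  proof -
    have "f n 0 = integral (cbox l r) (\<lambda>y. 0 :: real)"
      unfolding f_def by (rule Henstock_Kurzweil_Integration.integral_cong) (use zn lr(2) in auto)
    then show ?thesis by simp
  qed
  define I where "I = integral (cbox a b) (\<lambda>y. (u 0 y)\<^sup>2)"
  have I: "0 \<le> I" unfolding I_def
    by (intro Henstock_Kurzweil_Integration.integral_nonneg integrable_continuous continuous_intros cu) auto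
  define M where "M = integral (cbox l r) (\<lambda>y. 1::real)"
  have M: "0 \<le> M" unfolding M_def by (intro Henstock_Kurzweil_Integration.integral_nonneg) auto
  define C where "C = B * (M + I) / 2"
  have bound: "\<bar>f n t\<bar> \<le> C * (fact n * A ^ n)" if tt: "\<bar>t\<bar> \<le> \<bar>t0\<bar>" for n t
  proof -
    \<comment> \<open>The expected size of \<open>u n\<close>. The inequality \<open>\<bar>z\<bar> \<le> (S + z\<^sup>2 / S) / 2\<close> turns the bound on the integral
        of \<open>(u n)\<^sup>2\<close> by a multiple of \<open>S\<^sup>2\<close> into one on that of \<open>\<bar>u n\<bar>\<close> by a multiple of \<open>S\<close>.\<close>
    define S where "S = fact n * A ^ n"
    have S: "0 < S" using A by (simp add: S_def)
    have in_half: "y + t *\<^sub>R e \<in> cball p (R / 2)" if y: "y \<in> cbox l r" for y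
    proof -
      have "dist x y < R / 8" using lr(2) y by auto
      moreover have "dist y (y + t *\<^sub>R e) \<le> R / 8" using tt t0(1) e by (simp add: dist_norm)
      moreover have "dist p x < R / 4" using x by simp
      ultimately have "dist p (y + t *\<^sub>R e) \<le> R / 2"
        using dist_triangle[of p "y + t *\<^sub>R e" x] dist_triangle[of x "y + t *\<^sub>R e" y] by linarith
      then show ?thesis by simp
    qed
    have L2: "integral (cbox l r) (\<lambda>y. (u n (y + t *\<^sub>R e))\<^sup>2) \<le> S\<^sup>2 * I"
    proof -
      let ?D = "cbox (l + t *\<^sub>R e) (r + t *\<^sub>R e)"
      let ?q = "4 / (3 * R\<^sup>2)"
      have D: "?D \<subseteq> cball p (R / 2)"
      proof
        fix z assume "z \<in> ?D"
        then have "z - t *\<^sub>R e \<in> cbox l r" by (auto simp: mem_box inner_simps)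
        from in_half[OF this] show "z \<in> cball p (R / 2)" by simp
      qed
      have Dab: "?D \<subseteq> cbox a b"
      proof -
        have "cball p (R / 2) \<subseteq> cball p (R + 1)" using R by auto
        then show ?thesis using D ab by blast
      qed
      have iu: "(\<lambda>y. (u n y)\<^sup>2) integrable_on cbox c d" for c d
        by (intro integrable_continuous continuous_intros cu)
      have iw: "(\<lambda>y. ball_weight p R y ^ (2 * n) * (u n y)\<^sup>2) integrable_on cbox c d" for c d
        by (intro integrable_continuous continuous_intros cu ball_weight_continuous)
      have "integral (cbox l r) (\<lambda>y. (u n (y + t *\<^sub>R e))\<^sup>2) = integral ?D (\<lambda>y. (u n y)\<^sup>2)"
        by (rule integral_translate) (intro continuous_intros cu)
      \<comment> \<open>On the ball of half the radius the weight is at least \<open>3 R\<^sup>2 / 4 = 1 / ?q\<close>.\<close>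
      also have "\<dots> \<le> integral ?D (\<lambda>y. ?q ^ (2 * n) * (ball_weight p R y ^ (2 * n) * (u n y)\<^sup>2))"
      proof (rule integral_le[OF iu integrable_on_mult_right[OF iw]])
        fix y assume "y \<in> ?D"
        then have "norm (y - p) \<le> R / 2" using D by (auto simp: dist_norm norm_minus_commute)
        then have "(norm (y - p))\<^sup>2 \<le> (R / 2)\<^sup>2" by (intro power_mono) auto
        moreover have "R\<^sup>2 - (norm (y - p))\<^sup>2 \<le> ball_weight p R y" by (simp add: ball_weight_def)
        ultimately have "3 * R\<^sup>2 / 4 \<le> ball_weight p R y" by (simp add: power_divide)
        then have "1 \<le> ?q * ball_weight p R y" using R by (simp add: field_simps)
        then have "1 \<le> (?q * ball_weight p R y) ^ (2 * n)" by (rule one_le_power)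
        then have "1 * (u n y)\<^sup>2 \<le> (?q * ball_weight p R y) ^ (2 * n) * (u n y)\<^sup>2" by (rule mult_right_mono) simp
        then show "(u n y)\<^sup>2 \<le> ?q ^ (2 * n) * (ball_weight p R y ^ (2 * n) * (u n y)\<^sup>2)"
          by (simp only: power_mult_distrib mult.assoc mult_1_left)
      qed
      also have "\<dots> = ?q ^ (2 * n) * integral ?D (\<lambda>y. ball_weight p R y ^ (2 * n) * (u n y)\<^sup>2)" by simp
      also have "\<dots> \<le> ?q ^ (2 * n) * integral (cbox a b) (\<lambda>y. ball_weight p R y ^ (2 * n) * (u n y)\<^sup>2)"
        by (intro mult_left_mono integral_subset_le Dab iw) (auto simp: ball_weight_bounds)
      also have "\<dots> \<le> ?q ^ (2 * n) * ((fact n)\<^sup>2 * K ^ n * I)"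
        using iterated_derivative_bound[OF t e R d sub ab, of n]
        by (intro mult_left_mono) (auto simp: u_def I_def K_def)
      also have "\<dots> = S\<^sup>2 * I"
      proof -
        have "A\<^sup>2 = ?q\<^sup>2 * K" using K by (simp add: A_def power_divide power_mult_distrib)
        then have "(A\<^sup>2) ^ n = (?q\<^sup>2) ^ n * K ^ n" by (simp add: power_mult_distrib)
        then have "(A ^ n)\<^sup>2 = ?q ^ (2 * n) * K ^ n" by (simp only: power_mult[symmetric] mult.commute[of 2 n])
        then show ?thesis by (simp add: S_def power_mult_distrib)
      qed
      finally show ?thesis .
    qed
    have i2: "(\<lambda>y. (u n (y + t *\<^sub>R e))\<^sup>2) integrable_on cbox l r"
      by (intro integrable_continuous continuous_on_power cut)
    have "norm (f n t) \<le> integral (cbox l r) (\<lambda>y. B / 2 * (S * 1 + 1 / S * (u n (y + t *\<^sub>R e))\<^sup>2))"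
      unfolding f_def
    proof (rule integral_norm_bound_integral)
      show "(\<lambda>y. u n (y + t *\<^sub>R e) * \<eta> y) integrable_on cbox l r"
        by (intro integrable_continuous continuous_on_mult cut c\<eta>)
      show "(\<lambda>y. B / 2 * (S * 1 + 1 / S * (u n (y + t *\<^sub>R e))\<^sup>2)) integrable_on cbox l r"
        by (intro integrable_continuous continuous_on_mult continuous_on_add continuous_on_power continuous_on_const cut)
      fix y assume y: "y \<in> cbox l r"
      let ?z = "\<bar>u n (y + t *\<^sub>R e)\<bar>"
      have "0 \<le> (S - ?z)\<^sup>2" by simp
      then have "2 * ?z * S \<le> S\<^sup>2 + ?z\<^sup>2" by (simp add: power2_diff algebra_simps)
      then have "?z \<le> (S * 1 + 1 / S * ?z\<^sup>2) / 2" using S by (simp add: field_simps power2_eq_square)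
      then have "?z * \<bar>\<eta> y\<bar> \<le> (S * 1 + 1 / S * ?z\<^sup>2) / 2 * B"
        using B(2)[OF y] S by (intro mult_mono) auto
      then show "norm (u n (y + t *\<^sub>R e) * \<eta> y) \<le> B / 2 * (S * 1 + 1 / S * (u n (y + t *\<^sub>R e))\<^sup>2)"
        by (simp add: abs_mult mult.commute)
    qed
    also have "\<dots> = B / 2 * (S * M + 1 / S * integral (cbox l r) (\<lambda>y. (u n (y + t *\<^sub>R e))\<^sup>2))"
    proof -
      have 1: "(\<lambda>y. S * 1) integrable_on cbox l r" by auto
      have 2: "(\<lambda>y. 1 / S * (u n (y + t *\<^sub>R e))\<^sup>2) integrable_on cbox l r" by (rule integrable_on_mult_right[OF i2])
      show ?thesis
        by (simp only: integral_mult_right Henstock_Kurzweil_Integration.integral_add[OF 1 2] M_def)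
    qed
    also have "\<dots> \<le> B / 2 * (S * M + 1 / S * (S\<^sup>2 * I))"
      using B(1) S L2 by (intro mult_left_mono add_left_mono) auto
    also have "\<dots> = C * S" using S by (simp add: C_def field_simps power2_eq_square)
    finally show ?thesis by (simp add: S_def)
  qed
  have "f 0 t0 = 0"
  proof -
    have lt: "\<bar>t0\<bar> * A < 1" using t0(2) by (simp add: A_def K_def)
    have le: "\<bar>f 0 t0\<bar> \<le> C * (\<bar>t0\<bar> * A) ^ n" for n
    proof -
      obtain \<xi> where \<xi>: "\<bar>\<xi>\<bar> \<le> \<bar>t0\<bar>" "f 0 t0 = (\<Sum>m<n. f m 0 / fact m * t0 ^ m) + f n \<xi> / fact n * t0 ^ n"
        using Maclaurin_all_le[of f "f 0" t0 n] df by blast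
      have "\<bar>f 0 t0\<bar> = \<bar>f n \<xi>\<bar> / fact n * \<bar>t0\<bar> ^ n"
        using \<xi>(2) by (simp add: f0 abs_mult power_abs)
      also have "\<dots> \<le> C * (fact n * A ^ n) / fact n * \<bar>t0\<bar> ^ n"
        by (intro mult_right_mono divide_right_mono bound \<xi>(1)) auto
      also have "\<dots> = C * (\<bar>t0\<bar> * A) ^ n" by (simp add: power_mult_distrib)
      finally show ?thesis .
    qed
    have "(\<lambda>n. C * (\<bar>t0\<bar> * A) ^ n) \<longlonglongrightarrow> C * 0"
      by (intro tendsto_intros LIMSEQ_realpow_zero) (use lt A in auto)
    then have "\<bar>f 0 t0\<bar> \<le> C * 0"
      by (rule LIMSEQ_le_const) (use le in auto)
    then show ?thesis by simp
  qed
  then have "integral (cbox l r) (\<lambda>y. (u 0 (y + t0 *\<^sub>R e))\<^sup>2) = 0"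
    by (simp add: f_def \<eta>_def power2_eq_square)
  then have "\<forall>y\<in>cbox l r. (u 0 (y + t0 *\<^sub>R e))\<^sup>2 = 0"
  proof (subst (asm) integral_cbox_eq_0_iff)
    show "continuous_on (cbox l r) (\<lambda>y. (u 0 (y + t0 *\<^sub>R e))\<^sup>2)" by (intro continuous_on_power cut)
  qed (use lr(1) in auto)
  then show ?thesis using xlr by (simp add: u_def)
qed

definition zero_near :: "'a \<Rightarrow> real \<Rightarrow> bool" where
  "zero_near x s \<longleftrightarrow> (AE y in lebesgue_on U. y \<in> ball x s \<longrightarrow> \<phi> y = 0)"

lemma zero_near_subset: "zero_near x s \<Longrightarrow> ball y r \<subseteq> ball x s \<Longrightarrow> zero_near y r"
  unfolding zero_near_def by (erule eventually_mono) auto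

lemma mollify_zero_near:
  assumes z: "zero_near x s" and t: "test_fun (ball 0 d) \<rho>" and d: "d \<le> s / 2" and y: "y \<in> ball x (s / 2)"
  shows "mollify U \<phi> \<rho> y = 0"
proof -
  have "AE w in lebesgue_on U. \<phi> w * \<rho> (y - w) = 0"
    using z unfolding zero_near_def
  proof eventually_elim
    case (elim w)
    show ?case
    proof (cases "w \<in> ball x s")
      case False
      have "y - w \<notin> ball 0 d"
      proof
        assume "y - w \<in> ball 0 d"
        then have "dist x w < s" using y d dist_triangle[of x w y] by (simp add: dist_norm norm_minus_commute)
        then show False using False by simp
      qed
      then show ?thesis using test_fun_zero_outside[OF t] by simp
    qed (use elim in simp)
  qed
  then have "(\<integral>w. \<phi> w * \<rho> (y - w) \<partial>lebesgue_on U) = (\<integral>w. 0 \<partial>lebesgue_on U)"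
  proof (rule integral_cong_AE[rotated 2])
    show "(\<lambda>w. \<phi> w * \<rho> (y - w)) \<in> borel_measurable (lebesgue_on U)"
      using test_fun_mult_integrable[OF \<phi> test_fun_reflect[OF t, of y UNIV]] by simp
  qed simp
  then show ?thesis by (simp add: mollify_def L2_inner_def)
qed

text \<open>Values at \<open>z\<close> of mollifications are pairings with test functions supported near \<open>z\<close>.\<close>

lemma zero_near_of_mollify:
  assumes sub: "ball z d \<subseteq> U" and zero: "\<And>\<rho>. test_fun (ball 0 d) \<rho> \<Longrightarrow> mollify U \<phi> \<rho> z = 0"
  shows "zero_near z d"
proof -
  have Um: "U \<in> sets lebesgue" using U by auto
  have Bm: "ball z d \<in> sets lebesgue" by auto
  have i: "integrable lebesgue (\<lambda>x. indicator U x * \<phi> x)"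
    using \<phi> Um by (simp add: integrable_restrict_space)
  have \<phi>B: "integrable (lebesgue_on (ball z d)) \<phi>"
  proof -
    have "integrable lebesgue (\<lambda>x. indicator (ball z d) x *\<^sub>R (indicator U x * \<phi> x))"
      by (rule integrable_mult_indicator[OF Bm i])
    moreover have "(\<lambda>x. indicator (ball z d) x *\<^sub>R (indicator U x * \<phi> x)) = (\<lambda>x. indicator (ball z d) x *\<^sub>R \<phi> x)"
      using sub by (auto simp: indicator_def fun_eq_iff)
    ultimately show ?thesis using Bm by (simp add: integrable_restrict_space)
  qed
  have "AE x in lebesgue_on (ball z d). \<phi> x = 0"
  proof (rule fundamental_lemma[OF _ \<phi>B])
    fix \<psi> :: "'a \<Rightarrow> real" assume \<psi>: "test_fun (ball z d) \<psi>"
    have t: "test_fun (ball 0 d) (\<lambda>w. \<psi> (z - w))"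
      by (rule test_fun_reflect[OF \<psi>]) (simp add: dist_norm norm_minus_commute)
    have "L2_inner (ball z d) \<phi> \<psi> = (\<integral>x. indicator (ball z d) x *\<^sub>R (\<phi> x * \<psi> x) \<partial>lebesgue)"
      unfolding L2_inner_def using Bm by (simp add: integral_restrict_space)
    also have "\<dots> = (\<integral>x. indicator U x *\<^sub>R (\<phi> x * \<psi> x) \<partial>lebesgue)"
      by (rule Bochner_Integration.integral_cong[OF refl])
        (use sub test_fun_zero_outside[OF \<psi>] in \<open>force simp: indicator_def\<close>)
    also have "\<dots> = mollify U \<phi> (\<lambda>w. \<psi> (z - w)) z"
      unfolding mollify_def L2_inner_def using Um by (simp add: integral_restrict_space)
    also have "\<dots> = 0" by (rule zero[OF t])
    finally show "L2_inner (ball z d) \<phi> \<psi> = 0" .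
  qed simp
  then have "AE x in lebesgue. x \<in> ball z d \<longrightarrow> \<phi> x = 0"
    using Bm by (simp add: AE_restrict_space_iff)
  then show ?thesis unfolding zero_near_def using Um
    by (simp add: AE_restrict_space_iff) (auto elim: eventually_mono)
qed

lemma zero_near_translate:
  assumes R: "0 < R" and sub: "ball p (2 * R) \<subseteq> U" and x: "x \<in> ball p (R / 4)" and s: "0 < s" "zero_near x s"
    and e: "e \<in> Basis"
    and t: "\<bar>t\<bar> \<le> R / 8" "\<bar>t\<bar> * (4 * sqrt (2 * k * R^4 + 16 * R\<^sup>2) / (3 * R\<^sup>2)) < 1"
  shows "\<exists>r>0. zero_near (x + t *\<^sub>R e) r"
proof -
  define d where "d = min (s / 2) R"
  have d: "0 < d" "d \<le> s / 2" "d \<le> R" using s R by (auto simp: d_def)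
  have "zero_near (x + t *\<^sub>R e) d"
  proof (rule zero_near_of_mollify)
    show "ball (x + t *\<^sub>R e) d \<subseteq> U"
    proof
      fix y assume "y \<in> ball (x + t *\<^sub>R e) d"
      moreover have "dist x (x + t *\<^sub>R e) \<le> R / 8" using t(1) e by (simp add: dist_norm)
      ultimately have "dist p y < 2 * R"
        using x d dist_triangle[of p y x] dist_triangle[of x y "x + t *\<^sub>R e"] R by simp
      then show "y \<in> U" using sub by auto
    qed
    fix \<rho> :: "'a \<Rightarrow> real" assume \<rho>: "test_fun (ball 0 d) \<rho>"
    show "mollify U \<phi> \<rho> (x + t *\<^sub>R e) = 0"
    proof (rule mollified_zero_propagates[OF \<rho> e R d(1) _ x _ _ t])
      have "ball p (R + d) \<subseteq> ball p (2 * R)" using d(3) by auto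
      then show "ball p (R + d) \<subseteq> U" using sub by blast
      show "0 < s / 2" using s by simp
      show "mollify U \<phi> \<rho> y = 0" if "y \<in> ball x (s / 2)" for y
        by (rule mollify_zero_near[OF s(2) \<rho> d(2) that])
    qed
  qed
  then show ?thesis using d(1) by blast
qed

text \<open>The point \<open>p\<close> is reached from a nearby \<open>z\<close> by changing one coordinate at a time. The
  intermediate points stay in the ball of radius \<open>R / 4\<close> about \<open>p\<close>: each is at distance at most
  \<open>DIM('a) + 1\<close> times that of \<open>z\<close>.\<close>

lemma zero_set_locally_closed:
  assumes p: "p \<in> U"
  shows "\<exists>r>0. \<forall>z\<in>ball p r. (\<exists>s>0. zero_near z s) \<longrightarrow> (\<exists>s>0. zero_near p s)"
proof -
  obtain R' where R': "0 < R'" "ball p R' \<subseteq> U" using U p by (meson open_contains_ball)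
  define R where "R = R' / 2"
  have R: "0 < R" "ball p (2 * R) \<subseteq> U" using R' by (auto simp: R_def)
  define A where "A = 4 * sqrt (2 * k * R^4 + 16 * R\<^sup>2) / (3 * R\<^sup>2)"
  have A: "0 < A" using k R by (simp add: A_def add_nonneg_pos)
  define n where "n = real DIM('a) + 1"
  have n: "1 \<le> n" by (simp add: n_def)
  \<comment> \<open>The first bound keeps the path from \<open>z\<close> to \<open>p\<close> inside the ball of radius \<open>R / 4\<close>, the second makes
      each step short enough for the Taylor series.\<close>
  define r where "r = min (R / (8 * n)) (1 / A)"
  have r: "0 < r" using R A n by (simp add: r_def)
  have "\<exists>s>0. zero_near p s" if z: "z \<in> ball p r" and s: "0 < s" "zero_near z s" for z s
  proof -
    define w where "w J = z + (\<Sum>i\<in>J. ((p - z) \<bullet> i) *\<^sub>R i)" for J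
    have zp: "norm (p - z) < r" using z by (simp add: dist_norm)
    have co: "\<bar>(p - z) \<bullet> i\<bar> \<le> norm (p - z)" if "i \<in> Basis" for i by (rule Basis_le_norm[OF that])
    have rR: "n * r \<le> R / 8"
    proof -
      have "n * r \<le> n * (R / (8 * n))" using n by (intro mult_left_mono) (auto simp: r_def)
      then show ?thesis using n by simp
    qed
    have wball: "w J \<in> ball p (R / 4)" if J: "J \<subseteq> Basis" for J
    proof -
      have "norm (\<Sum>i\<in>J. ((p - z) \<bullet> i) *\<^sub>R i) \<le> (\<Sum>i\<in>J. norm (p - z))"
        by (rule sum_norm_le) (use J co in auto)
      also have "\<dots> \<le> real DIM('a) * norm (p - z)"
        using card_mono[OF finite_Basis J] by (simp add: mult_right_mono)
      finally have "norm (p - w J) \<le> n * norm (p - z)"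
        using norm_triangle_ineq4[of "p - z" "\<Sum>i\<in>J. ((p - z) \<bullet> i) *\<^sub>R i"]
        by (simp add: w_def n_def algebra_simps)
      also have "\<dots> \<le> n * r" using zp n by (intro mult_left_mono) auto
      finally show ?thesis using rR R by (simp add: dist_norm)
    qed
    have "\<exists>s>0. zero_near (w J) s" if "finite J" "J \<subseteq> Basis" for J
      using that
    proof (induction J rule: finite_induct)
      case empty then show ?case using s by (auto simp: w_def)
    next
      case (insert i J)
      then obtain s' where s': "0 < s'" "zero_near (w J) s'" by auto
      have i: "i \<in> Basis" and J: "J \<subseteq> Basis" using insert.prems by auto
      have ti: "\<bar>(p - z) \<bullet> i\<bar> < r" using co[OF i] zp by linarith
      have "r \<le> n * r" using n r by simp
      then have t1: "\<bar>(p - z) \<bullet> i\<bar> \<le> R / 8" using ti rR by linarith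
      have "\<bar>(p - z) \<bullet> i\<bar> < 1 / A" using ti by (simp add: r_def)
      then have t2: "\<bar>(p - z) \<bullet> i\<bar> * A < 1" using A by (simp add: field_simps)
      have "w (insert i J) = w J + ((p - z) \<bullet> i) *\<^sub>R i"
        using insert.hyps by (simp add: w_def)
      then show ?case
        using zero_near_translate[OF R wball[OF J] s' i t1 t2[unfolded A_def]] by simp
    qed
    from this[of Basis] have "\<exists>s>0. zero_near (w Basis) s" by simp
    moreover have "w Basis = p" by (simp add: w_def euclidean_representation)
    ultimately show ?thesis by simp
  qed
  then show ?thesis using r by blast
qed

text \<open>The set of points near which \<open>\<phi>\<close> vanishes is open by definition and relatively closed by
  \<open>zero_set_locally_closed\<close>.\<close>

theorem unique_continuation:
  assumes conn: "connected U" and \<omega>: "open \<omega>" "\<omega> \<noteq> {}" "\<omega> \<subseteq> U"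
    and zero: "AE y in lebesgue_on U. y \<in> \<omega> \<longrightarrow> \<phi> y = 0"
  shows "AE y in lebesgue_on U. \<phi> y = 0"
proof -
  define Z where "Z = {x\<in>U. \<exists>s>0. zero_near x s}"
  have opZ: "open Z"
    unfolding open_contains_ball
  proof
    fix x assume "x \<in> Z"
    then obtain s where s: "x \<in> U" "0 < s" "zero_near x s" by (auto simp: Z_def)
    obtain r where r: "0 < r" "ball x r \<subseteq> U" using U s(1) by (meson open_contains_ball)
    have "ball x (min r s) \<subseteq> Z"
    proof
      fix y assume y: "y \<in> ball x (min r s)"
      have "zero_near y (s - dist x y)"
      proof (rule zero_near_subset[OF s(3)])
        show "ball y (s - dist x y) \<subseteq> ball x s"
        proof
          fix w assume "w \<in> ball y (s - dist x y)"
          then show "w \<in> ball x s" using dist_triangle[of x w y] by simp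
        qed
      qed
      moreover have "0 < s - dist x y" using y by simp
      ultimately have "\<exists>s>0. zero_near y s" by blast
      then show "y \<in> Z" using y r(2) by (auto simp: Z_def)
    qed
    then show "\<exists>e>0. ball x e \<subseteq> Z" using r s by (intro exI[of _ "min r s"]) auto
  qed
  have opN: "open (U - Z)"
    unfolding open_contains_ball
  proof
    fix p assume p: "p \<in> U - Z"
    obtain r where r: "0 < r" "ball p r \<subseteq> U" using U p by (meson DiffE open_contains_ball)
    obtain r' where r': "0 < r'" "\<forall>z\<in>ball p r'. (\<exists>s>0. zero_near z s) \<longrightarrow> (\<exists>s>0. zero_near p s)"
      using zero_set_locally_closed[of p] p by blast
    have "ball p (min r r') \<subseteq> U - Z"
    proof
      fix z assume z: "z \<in> ball p (min r r')"
      have "z \<in> U" using z r(2) by auto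
      moreover have "z \<notin> Z"
      proof
        assume "z \<in> Z"
        then have "\<exists>s>0. zero_near p s" using r'(2) z by (auto simp: Z_def)
        then show False using p by (auto simp: Z_def)
      qed
      ultimately show "z \<in> U - Z" by blast
    qed
    then show "\<exists>e>0. ball p e \<subseteq> U - Z" using r r' by (intro exI[of _ "min r r'"]) auto
  qed
  obtain x where x: "x \<in> \<omega>" using \<omega>(2) by blast
  obtain s where s: "0 < s" "ball x s \<subseteq> \<omega>" using \<omega>(1) x by (meson open_contains_ball)
  have "zero_near x s" unfolding zero_near_def using zero by eventually_elim (use s in auto)
  then have xZ: "x \<in> Z" using s x \<omega>(3) by (auto simp: Z_def)
  have "Z \<inter> U = {} \<or> (U - Z) \<inter> U = {}"
    by (rule connectedD[OF conn opZ opN]) auto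
  then have UZ: "U \<subseteq> Z" using xZ by (auto simp: Z_def)
  define F where "F = {ball y s |y s. zero_near y s}"
  obtain F' where F': "F' \<subseteq> F" "countable F'" "\<Union>F' = \<Union>F"
    using Lindelof[of F] by (auto simp: F_def)
  have vanish: "AE y in lebesgue_on U. \<forall>B\<in>F'. y \<in> B \<longrightarrow> \<phi> y = 0"
    unfolding AE_ball_countable[OF F'(2)]
  proof
    fix B assume "B \<in> F'"
    then obtain x s where "B = ball x s" "zero_near x s" using F'(1) by (auto simp: F_def)
    then show "AE y in lebesgue_on U. y \<in> B \<longrightarrow> \<phi> y = 0" by (simp add: zero_near_def)
  qed
  have cover: "\<exists>B\<in>F'. y \<in> B" if yU: "y \<in> U" for y
  proof -
    have "y \<in> Z" using UZ yU by blast
    then obtain s where "0 < s" "zero_near y s" unfolding Z_def by blast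
    then have "y \<in> \<Union>F" by (auto simp: F_def intro!: exI[of _ "ball y s"])
    then show ?thesis using F'(3) by auto
  qed
  have "AE y in lebesgue_on U. y \<in> U" by (rule AE_I2) simp
  with vanish show ?thesis by eventually_elim (use cover in blast)
qed

end

section \<open>Tensor products\<close>

lemma null_cylinders:
  assumes "N \<in> null_sets lborel"
  shows "N \<times> UNIV \<in> null_sets (lborel :: ('a::euclidean_space \<times> 'b::euclidean_space) measure)"
    and "UNIV \<times> N \<in> null_sets (lborel :: ('b::euclidean_space \<times> 'a::euclidean_space) measure)"
proof -
  have N: "N \<in> sets lborel" "emeasure lborel N = 0" using assms by auto
  have "N \<times> UNIV \<in> null_sets (lborel \<Otimes>\<^sub>M (lborel :: 'b measure))"
    using N by (auto simp: null_sets_def lborel.emeasure_pair_measure_Times)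
  then show "N \<times> UNIV \<in> null_sets (lborel :: ('a \<times> 'b) measure)" by (simp add: lborel_prod)
  have "UNIV \<times> N \<in> null_sets ((lborel :: 'b measure) \<Otimes>\<^sub>M lborel)"
    using N by (auto simp: null_sets_def lborel.emeasure_pair_measure_Times)
  then show "UNIV \<times> N \<in> null_sets (lborel :: ('b \<times> 'a) measure)" by (simp add: lborel_prod)
qed

lemma AE_cylinders:
  fixes P :: "'a::euclidean_space \<Rightarrow> bool"
  assumes "AE x in lborel. P x"
  shows "AE z in (lborel :: ('a \<times> 'b::euclidean_space) measure). P (fst z)"
    and "AE z in (lborel :: ('b::euclidean_space \<times> 'a) measure). P (snd z)"
proof -
  obtain N where N: "{x. \<not> P x} \<subseteq> N" "N \<in> null_sets lborel"
    using assms by (auto simp: eventually_ae_filter)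
  show "AE z in (lborel :: ('a \<times> 'b) measure). P (fst z)"
    by (rule AE_I'[OF null_cylinders(1)[OF N(2)]]) (use N(1) in auto)
  show "AE z in (lborel :: ('b \<times> 'a) measure). P (snd z)"
    by (rule AE_I'[OF null_cylinders(2)[OF N(2)]]) (use N(1) in auto)
qed

text \<open>Lebesgue measurable factors agree almost everywhere with Borel measurable ones, and Lebesgue
  measure on the product completes the product of the Borel restrictions, where Tonelli's theorem
  applies.\<close>

lemma nn_integral_lebesgue_product:
  fixes F :: "'a::euclidean_space \<Rightarrow> ennreal" and G :: "'b::euclidean_space \<Rightarrow> ennreal"
  assumes F: "F \<in> borel_measurable lebesgue" and G: "G \<in> borel_measurable lebesgue"
  shows "(\<integral>\<^sup>+z. F (fst z) * G (snd z) \<partial>lebesgue) = (\<integral>\<^sup>+x. F x \<partial>lebesgue) * (\<integral>\<^sup>+y. G y \<partial>lebesgue)"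
proof -
  obtain F' where F': "F' \<in> borel_measurable lborel" "AE x in lborel. F x = F' x"
    using completion_ex_borel_measurable[OF F] by blast
  obtain G' where G': "G' \<in> borel_measurable lborel" "AE x in lborel. G x = G' x"
    using completion_ex_borel_measurable[OF G] by blast
  have [measurable]: "F' \<in> borel_measurable borel" "G' \<in> borel_measurable borel" using F' G' by auto
  have "AE z in (lborel :: ('a \<times> 'b) measure). F (fst z) * G (snd z) = F' (fst z) * G' (snd z)"
    using AE_cylinders(1)[OF F'(2)] AE_cylinders(2)[OF G'(2)] by eventually_elim simp
  then have "(\<integral>\<^sup>+z. F (fst z) * G (snd z) \<partial>lebesgue) = (\<integral>\<^sup>+z. F' (fst z) * G' (snd z) \<partial>lborel)"
    unfolding nn_integral_completion by (rule nn_integral_cong_AE)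
  also have "\<dots> = (\<integral>\<^sup>+z. F' (fst z) * G' (snd z) \<partial>(lborel \<Otimes>\<^sub>M lborel))" by (simp add: lborel_prod)
  also have "\<dots> = (\<integral>\<^sup>+x. \<integral>\<^sup>+y. F' x * G' y \<partial>lborel \<partial>lborel)"
    by (subst lborel.nn_integral_fst[symmetric]) auto
  also have "\<dots> = (\<integral>\<^sup>+x. F' x \<partial>lborel) * (\<integral>\<^sup>+y. G' y \<partial>lborel)"
    by (simp add: nn_integral_cmult nn_integral_multc)
  also have "\<dots> = (\<integral>\<^sup>+x. F x \<partial>lebesgue) * (\<integral>\<^sup>+y. G y \<partial>lebesgue)"
    unfolding nn_integral_completion
    using nn_integral_cong_AE[OF F'(2)] nn_integral_cong_AE[OF G'(2)] by simp
  finally show ?thesis .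
qed

lemma L2_inner_eq_nn_integral:
  assumes A: "open A" and f: "f \<in> borel_measurable (lebesgue_on A)"
  shows "(\<lambda>x. indicator A x * (f x)\<^sup>2) \<in> borel_measurable lebesgue"
    and "L2_inner A f f = enn2real (\<integral>\<^sup>+x. ennreal (indicator A x * (f x)\<^sup>2) \<partial>lebesgue)"
proof -
  have Am: "A \<in> sets lebesgue" using A by auto
  have "(\<lambda>x. (f x)\<^sup>2) \<in> borel_measurable (lebesgue_on A)" using f by simp
  then show m: "(\<lambda>x. indicator A x * (f x)\<^sup>2) \<in> borel_measurable lebesgue"
    using Am by (simp add: borel_measurable_restrict_space_iff)
  have "L2_inner A f f = (\<integral>x. indicator A x * (f x)\<^sup>2 \<partial>lebesgue)"
    unfolding L2_inner_def using Am by (subst integral_restrict_space) (auto simp: power2_eq_square)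
  also have "\<dots> = enn2real (\<integral>\<^sup>+x. ennreal (indicator A x * (f x)\<^sup>2) \<partial>lebesgue)"
    by (rule integral_eq_nn_integral[OF m]) simp
  finally show "L2_inner A f f = enn2real (\<integral>\<^sup>+x. ennreal (indicator A x * (f x)\<^sup>2) \<partial>lebesgue)" .
qed

lemma L2_norm_product:
  fixes A :: "'a::euclidean_space set" and B :: "'b::euclidean_space set"
  assumes A: "open A" "f \<in> borel_measurable (lebesgue_on A)" and B: "open B" "g \<in> borel_measurable (lebesgue_on B)"
  shows "L2_norm (A \<times> B) (\<lambda>(x, y). g y * f x) = L2_norm A f * L2_norm B g"
proof -
  let ?F = "\<lambda>x. ennreal (indicator A x * (f x)\<^sup>2)" and ?G = "\<lambda>y. ennreal (indicator B y * (g y)\<^sup>2)"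
  note LA = L2_inner_eq_nn_integral[OF A] and LB = L2_inner_eq_nn_integral[OF B]
  have FG: "?F \<in> borel_measurable lebesgue" "?G \<in> borel_measurable lebesgue" using LA(1) LB(1) by auto
  have ABm: "A \<times> B \<in> sets lebesgue" using open_Times[OF A(1) B(1)] by auto
  have cyl: "(fst :: 'a \<times> 'b \<Rightarrow> 'a) \<in> lebesgue \<rightarrow>\<^sub>M lebesgue" "(snd :: 'a \<times> 'b \<Rightarrow> 'b) \<in> lebesgue \<rightarrow>\<^sub>M lebesgue"
  proof -
    have m: "(fst :: 'a \<times> 'b \<Rightarrow> 'a) \<in> lebesgue \<rightarrow>\<^sub>M lborel" "(snd :: 'a \<times> 'b \<Rightarrow> 'b) \<in> lebesgue \<rightarrow>\<^sub>M lborel"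
      by (auto intro!: measurable_completion simp: borel_prod[symmetric])
    have n: "fst -` N = N \<times> UNIV" "snd -` N' = UNIV \<times> N'" for N :: "'a set" and N' :: "'b set" by auto
    show "(fst :: 'a \<times> 'b \<Rightarrow> 'a) \<in> lebesgue \<rightarrow>\<^sub>M lebesgue"
    proof (rule completion.measurable_completion2[OF m(1)], rule subsetI)
      fix N :: "'a set" assume N: "N \<in> null_sets lborel"
      then show "N \<in> null_sets (distr lebesgue lborel (fst :: 'a \<times> 'b \<Rightarrow> 'a))"
        using null_sets_completionI[OF null_cylinders(1)[OF N, where 'b='b]] m(1)
        by (auto simp: null_sets_def emeasure_distr n)
    qed
    show "(snd :: 'a \<times> 'b \<Rightarrow> 'b) \<in> lebesgue \<rightarrow>\<^sub>M lebesgue"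
    proof (rule completion.measurable_completion2[OF m(2)], rule subsetI)
      fix N :: "'b set" assume N: "N \<in> null_sets lborel"
      then show "N \<in> null_sets (distr lebesgue lborel (snd :: 'a \<times> 'b \<Rightarrow> 'b))"
        using null_sets_completionI[OF null_cylinders(2)[OF N, where 'b='a]] m(2)
        by (auto simp: null_sets_def emeasure_distr n)
    qed
  qed
  let ?h = "\<lambda>z. (indicator A (fst z) * (f (fst z))\<^sup>2) * (indicator B (snd z) * (g (snd z))\<^sup>2)"
  have hm: "?h \<in> borel_measurable lebesgue"
    using measurable_compose[OF cyl(1) LA(1)] measurable_compose[OF cyl(2) LB(1)] by (rule borel_measurable_times)
  have "L2_inner (A \<times> B) (\<lambda>(x, y). g y * f x) (\<lambda>(x, y). g y * f x) = (\<integral>z. ?h z \<partial>lebesgue)"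
    unfolding L2_inner_def using ABm
    by (subst integral_restrict_space)
      (auto intro!: Bochner_Integration.integral_cong simp: indicator_def power2_eq_square split: prod.splits)
  also have "\<dots> = enn2real (\<integral>\<^sup>+z. ennreal (?h z) \<partial>lebesgue)"
    by (rule integral_eq_nn_integral[OF hm]) simp
  also have "(\<integral>\<^sup>+z. ennreal (?h z) \<partial>lebesgue) = (\<integral>\<^sup>+z. ?F (fst z) * ?G (snd z) \<partial>lebesgue)"
    by (simp add: ennreal_mult)
  also have "\<dots> = (\<integral>\<^sup>+x. ?F x \<partial>lebesgue) * (\<integral>\<^sup>+y. ?G y \<partial>lebesgue)"
    by (rule nn_integral_lebesgue_product[OF FG])
  finally have "L2_inner (A \<times> B) (\<lambda>(x, y). g y * f x) (\<lambda>(x, y). g y * f x) = L2_inner A f f * L2_inner B g g"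
    by (simp add: LA(2) LB(2) enn2real_mult)
  then show ?thesis by (simp add: L2_norm_def real_sqrt_mult)
qed

lemma L2_inner_mono_set:
  fixes A :: "'a::euclidean_space set"
  assumes f: "square_integrable A f" and BA: "B \<subseteq> A" "open A" "open B"
  shows "f \<in> borel_measurable (lebesgue_on B)" "0 \<le> L2_inner B f f" "L2_inner B f f \<le> L2_inner A f f"
    "integrable (lebesgue_on B) (\<lambda>x. (f x)\<^sup>2)"
proof -
  have Am: "A \<in> sets lebesgue" and Bm: "B \<in> sets lebesgue" using BA by auto
  have "f \<in> borel_measurable (restrict_space (lebesgue_on A) B)"
    by (rule measurable_restrict_space1) (use f in \<open>simp add: square_integrable_def\<close>)
  moreover have "restrict_space (lebesgue_on A) B = lebesgue_on B"
    using BA Am Bm by (subst restrict_restrict_space) (auto simp: Int_absorb1)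
  ultimately show "f \<in> borel_measurable (lebesgue_on B)" by simp
  show "0 \<le> L2_inner B f f" by (simp add: L2_inner_def)
  have iA: "integrable lebesgue (\<lambda>x. indicator A x *\<^sub>R (f x)\<^sup>2)"
    using f Am by (simp add: square_integrable_def integrable_restrict_space)
  have "integrable lebesgue (\<lambda>x. indicator B x *\<^sub>R (indicator A x *\<^sub>R (f x)\<^sup>2))"
    by (rule integrable_mult_indicator[OF Bm iA])
  moreover have "(\<lambda>x. indicator B x *\<^sub>R (indicator A x *\<^sub>R (f x)\<^sup>2)) = (\<lambda>x. indicator B x *\<^sub>R (f x)\<^sup>2)"
    using BA by (auto simp: indicator_def fun_eq_iff)
  ultimately have iB: "integrable lebesgue (\<lambda>x. indicator B x *\<^sub>R (f x)\<^sup>2)" by simp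
  then show "integrable (lebesgue_on B) (\<lambda>x. (f x)\<^sup>2)" using Bm by (simp add: integrable_restrict_space)
  have L: "L2_inner S f f = (\<integral>x. indicator S x *\<^sub>R (f x)\<^sup>2 \<partial>lebesgue)" if "S \<in> sets lebesgue" for S
    unfolding L2_inner_def using that by (subst integral_restrict_space) (auto simp: power2_eq_square)
  show "L2_inner B f f \<le> L2_inner A f f"
    unfolding L[OF Am] L[OF Bm] by (rule integral_mono[OF iB iA]) (use BA in \<open>auto simp: indicator_def\<close>)
qed


section \<open>Non-concentration of the transversal eigenfunctions\<close>

lemma dirichlet_eigenfunction_mass_pos:
  fixes \<Omega> :: "'a::euclidean_space set"
  assumes \<Omega>: "open \<Omega>" "connected \<Omega>" "bounded \<Omega>" and \<phi>: "dirichlet_laplacian \<Omega> \<phi> (\<lambda>x. \<mu>\<^sup>2 * \<phi> x)"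
    and n: "L2_inner \<Omega> \<phi> \<phi> \<noteq> 0" and \<omega>: "open \<omega>" "\<omega> \<noteq> {}" "\<omega> \<subseteq> \<Omega>"
  shows "0 < L2_inner \<omega> \<phi> \<phi>"
proof -
  have \<Omega>m: "\<Omega> \<in> sets lebesgue" and \<omega>m: "\<omega> \<in> sets lebesgue" using \<Omega> \<omega> by auto
  obtain G where G: "H10_gradient \<Omega> \<phi> G"
    "\<And>\<psi>. test_fun \<Omega> \<psi> \<Longrightarrow> (\<Sum>i\<in>Basis. L2_inner \<Omega> (\<lambda>x. G x \<bullet> i) (partial_deriv i \<psi>)) = L2_inner \<Omega> (\<lambda>x. \<mu>\<^sup>2 * \<phi> x) \<psi>"
    using \<phi> by (auto simp: dirichlet_laplacian_def)
  have H1: "H1_gradient \<Omega> \<phi> G" using G(1) by (simp add: H10_gradient_def)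
  then have si: "square_integrable \<Omega> \<phi>" by (simp add: H1_gradient_def)
  interpret weak_helmholtz \<Omega> \<phi> "\<mu>\<^sup>2"
  proof
    show "integrable (lebesgue_on \<Omega>) \<phi>" by (rule square_integrable_imp_integrable[OF si \<Omega>(3) \<Omega>m])
    show "(\<Sum>i\<in>Basis. L2_inner \<Omega> \<phi> (partial_deriv i (partial_deriv i \<psi>))) = - \<mu>\<^sup>2 * L2_inner \<Omega> \<phi> \<psi>"
      if t: "test_fun \<Omega> \<psi>" for \<psi>
    proof -
      have "L2_inner \<Omega> \<phi> (partial_deriv i (partial_deriv i \<psi>)) = - L2_inner \<Omega> (\<lambda>x. G x \<bullet> i) (partial_deriv i \<psi>)"
        if "i \<in> Basis" for i
        using H1 test_fun_partial_deriv[OF t that] that by (auto simp: H1_gradient_def)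
      then show ?thesis using G(2)[OF t] by (simp add: sum_negf L2_inner_def mult.assoc)
    qed
  qed (use \<Omega> in auto)
  note L = L2_inner_mono_set[OF si \<omega>(3) \<Omega>(1) \<omega>(1)]
  have "L2_inner \<omega> \<phi> \<phi> \<noteq> 0"
  proof
    assume "L2_inner \<omega> \<phi> \<phi> = 0"
    then have "(\<integral>x. (\<phi> x)\<^sup>2 \<partial>lebesgue_on \<omega>) = 0" by (simp add: L2_inner_def power2_eq_square)
    then have "AE x in lebesgue_on \<omega>. (\<phi> x)\<^sup>2 = 0"
      using integral_nonneg_eq_0_iff_AE[OF L(4)] by simp
    then have "AE x in lebesgue. x \<in> \<omega> \<longrightarrow> \<phi> x = 0" using \<omega>m by (simp add: AE_restrict_space_iff)
    then have "AE x in lebesgue_on \<Omega>. x \<in> \<omega> \<longrightarrow> \<phi> x = 0"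
      using \<Omega>m by (simp add: AE_restrict_space_iff) (auto elim: eventually_mono)
    from unique_continuation[OF \<Omega>(2) \<omega> this] have "AE x in lebesgue_on \<Omega>. \<phi> x * \<phi> x = 0" by eventually_elim simp
    then have "L2_inner \<Omega> \<phi> \<phi> = 0" unfolding L2_inner_def by (rule integral_eq_zero_AE)
    then show False using n by simp
  qed
  with L(2) show ?thesis by simp
qed

lemma eventually_and_pointwise_pos_imp_uniform:
  fixes a :: "nat \<Rightarrow> real"
  assumes lim: "0 < liminf (\<lambda>k. ereal (a k))" and pos: "\<And>k. 0 < a k"
  obtains d where "0 < d" "\<And>k. d \<le> a k"
proof -
  obtain y where y: "0 < ereal y" "ereal y < liminf (\<lambda>k. ereal (a k))" using ereal_dense2[OF lim] by auto
  have "\<forall>\<^sub>F k in sequentially. ereal y < ereal (a k)" using less_LiminfD[OF y(2)] .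
  then obtain N where N: "\<And>k. N \<le> k \<Longrightarrow> y < a k" by (auto simp: eventually_sequentially)
  define d where "d = Min (insert y (a ` {..<N}))"
  have "0 < d" unfolding d_def using y pos by (subst Min_gr_iff) auto
  moreover have "d \<le> a k" for k
  proof (cases "k < N")
    case True then show ?thesis unfolding d_def by (intro Min_le) auto
  next
    case False
    have "d \<le> y" unfolding d_def by (intro Min_le) auto
    also have "y < a k" using N False by simp
    finally show ?thesis by simp
  qed
  ultimately show ?thesis by (rule that)
qed

section \<open>Uniform estimates over the coefficient class\<close>

text \<open>Since \<open>\<mu>\<close> is monotone, \<open>lam\<close> is bounded below by a constant that depends on \<open>\<mu> 0\<close> only.\<close>

lemma eigenpair_system:
  assumes H: "0 < H" and c: "0 < cm" "cm < cM" "0 < \<epsilon>" and \<mu>: "mono \<mu>" "0 < \<mu> 0"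
    and cK: "c \<in> coeff_class_TV H cm cM V" and pair: "(m, lam) \<in> A_pairs H \<mu> cM \<epsilon> c"
    and u: "A_eigenfunction H c m lam u" and q: "flux H c u q"
  obtains f v where "eigen_system H cm cM \<epsilon> m lam f u q" "(cM + \<epsilon>) * (\<mu> 0)\<^sup>2 \<le> lam"
    "\<And>s t. 0 \<le> s \<Longrightarrow> s \<le> t \<Longrightarrow> t \<le> H \<Longrightarrow> \<bar>f t - f s\<bar> \<le> v t - v s" "v H - v 0 \<le> V + 1"
proof -
  obtain f v where f: "\<And>y. cm \<le> f y" "\<And>y. f y \<le> cM" "AE y in lebesgue_on {0<..<H}. c y = f y"
    and v: "\<And>s t. 0 \<le> s \<Longrightarrow> s \<le> t \<Longrightarrow> t \<le> H \<Longrightarrow> \<bar>f t - f s\<bar> \<le> v t - v s" "v H - v 0 \<le> V + 1"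
    by (rule coeff_class_TV_representative[OF H less_imp_le[OF c(2)] cK]) (rule that)
  obtain k where k: "m = \<mu> k" "(cM + \<epsilon>) * (\<mu> k)\<^sup>2 \<le> lam" using pair by (auto simp: A_pairs_def)
  have \<mu>k: "\<mu> 0 \<le> \<mu> k" using \<mu>(1) by (simp add: monoD)
  have S: "eigen_system H cm cM \<epsilon> m lam f u q"
    using eigenfunction_primitives[OF H c(1) f(1,3) u q] H c f k \<mu>k \<mu>(2)
    by unfold_locales auto
  have L: "(cM + \<epsilon>) * (\<mu> 0)\<^sup>2 \<le> lam"
  proof -
    have "(\<mu> 0)\<^sup>2 \<le> (\<mu> k)\<^sup>2" using \<mu>k \<mu>(2) by (intro power_mono) auto
    then have "(cM + \<epsilon>) * (\<mu> 0)\<^sup>2 \<le> (cM + \<epsilon>) * (\<mu> k)\<^sup>2" using c by (intro mult_left_mono) auto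
    then show ?thesis using k(2) by linarith
  qed
  show ?thesis by (rule that[OF S L v])
qed

lemma min_amplitude_TV_pos:
  assumes H: "0 < H" and c: "0 < cm" "cm < cM" "0 < \<epsilon>" and \<mu>: "mono \<mu>" "0 < \<mu> 0"
  shows "0 < min_amplitude_TV_sq H \<mu> cm cM \<epsilon> V"
proof -
  define l where "l = (cM + \<epsilon>) * (\<mu> 0)\<^sup>2"
  define r where "r = cm * (\<epsilon> / (cM + \<epsilon>)) / H * exp (- ((1 / cm + 1 / \<epsilon>) * (V + 1))) * (l / (cM * l + 1))"
  have l: "0 < l" using c \<mu> by (simp add: l_def)
  have "0 < cM * l + 1" using c l by (intro add_pos_pos) auto
  then have r: "0 < r" using l c H by (simp add: r_def)
  have "ereal r \<le> min_amplitude_TV_sq H \<mu> cm cM \<epsilon> V"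
    unfolding min_amplitude_TV_sq_def min_amplitude_sq_def
  proof (rule INF_greatest, rule Inf_greatest)
    fix c z assume cK: "c \<in> coeff_class_TV H cm cM V"
      and "z \<in> {ereal ((u y)\<^sup>2 + (q y)\<^sup>2) |y m lam u q. y \<in> {0..H} \<and>
        (m, lam) \<in> A_pairs H \<mu> cM \<epsilon> c \<and> A_eigenfunction H c m lam u \<and> flux H c u q}"
    then obtain y m lam u q where z: "z = ereal ((u y)\<^sup>2 + (q y)\<^sup>2)" and y: "y \<in> {0..H}"
      and p: "(m, lam) \<in> A_pairs H \<mu> cM \<epsilon> c" and u: "A_eigenfunction H c m lam u" and q: "flux H c u q" by blast
    obtain f v where S: "eigen_system H cm cM \<epsilon> m lam f u q" "(cM + \<epsilon>) * (\<mu> 0)\<^sup>2 \<le> lam"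
      and v: "\<And>s t. 0 \<le> s \<Longrightarrow> s \<le> t \<Longrightarrow> t \<le> H \<Longrightarrow> \<bar>f t - f s\<bar> \<le> v t - v s" "v H - v 0 \<le> V + 1"
      by (rule eigenpair_system[OF H assms(2-4) \<mu> cK p u q]) (rule that)
    interpret eigen_system H cm cM \<epsilon> m lam f u q by (rule S(1))
    have "r \<le> (u y)\<^sup>2 + (q y)\<^sup>2"
      using amplitude_lower_bound[OF v l _ y] S(2) by (simp add: r_def l_def \<kappa>_def)
    then show "ereal r \<le> z" by (simp add: z)
  qed
  with r show ?thesis by (metis ereal_less(2) less_le_trans)
qed

lemma min_amplitude_TV_le:
  assumes "c \<in> coeff_class_TV H cm cM V" "(m, lam) \<in> A_pairs H \<mu> cM \<epsilon> c"
    "A_eigenfunction H c m lam u" "flux H c u q" "y \<in> {0..H}"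
  shows "min_amplitude_TV_sq H \<mu> cm cM \<epsilon> V \<le> ereal ((u y)\<^sup>2 + (q y)\<^sup>2)"
proof -
  have "min_amplitude_TV_sq H \<mu> cm cM \<epsilon> V \<le> min_amplitude_sq H \<mu> cM \<epsilon> c"
    unfolding min_amplitude_TV_sq_def by (rule INF_lower[OF assms(1)])
  also have "\<dots> \<le> ereal ((u y)\<^sup>2 + (q y)\<^sup>2)"
    unfolding min_amplitude_sq_def by (rule Inf_lower) (use assms in blast)
  finally show ?thesis .
qed

text \<open>The minimal amplitude is an extended real; as soon as one eigenfunction exists, it is finite
  and its square root bounds that eigenfunction.\<close>

lemma min_amplitude_TV_bound:
  assumes H: "0 < H" and c: "0 < cm" "cm < cM" "0 < \<epsilon>" and \<mu>: "mono \<mu>" "0 < \<mu> 0"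
    and cK: "c \<in> coeff_class_TV H cm cM V" and p: "(m, lam) \<in> A_pairs H \<mu> cM \<epsilon> c"
    and u: "A_eigenfunction H c m lam u" and q: "flux H c u q"
  defines "r \<equiv> min_amplitude_TV H \<mu> cm cM \<epsilon> V"
  shows "0 < r" and "\<And>y. y \<in> {0..H} \<Longrightarrow> r\<^sup>2 \<le> (u y)\<^sup>2 + (q y)\<^sup>2"
proof -
  let ?X = "min_amplitude_TV_sq H \<mu> cm cM \<epsilon> V"
  have pos: "0 < ?X" by (rule min_amplitude_TV_pos[OF H c \<mu>])
  have le: "?X \<le> ereal ((u y)\<^sup>2 + (q y)\<^sup>2)" if "y \<in> {0..H}" for y
    by (rule min_amplitude_TV_le[OF cK p u q that])
  obtain x where x: "?X = ereal x" "0 < x"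
    using pos le[of 0] H by (cases ?X) auto
  have r2: "r\<^sup>2 = x" "0 < r" using x by (auto simp: r_def min_amplitude_TV_def)
  show "0 < r" by (rule r2)
  show "r\<^sup>2 \<le> (u y)\<^sup>2 + (q y)\<^sup>2" if "y \<in> {0..H}" for y using le[OF that] x r2 by simp
qed

text \<open>Multiplied by \<open>1 / sqrt lam\<close>, the length of an interval that is sure to contain a zero of the flux
  followed by a stretch on which \<open>u\<close> stays large.\<close>

definition oscillation_length :: "real \<Rightarrow> real \<Rightarrow> real \<Rightarrow> real" where
  "oscillation_length \<epsilon> cm cM = 4 * sqrt (cM / (\<epsilon> / (cM + \<epsilon>))) + 1 + sqrt cm / 2"

definition high_energy :: "real \<Rightarrow> real \<Rightarrow> real \<Rightarrow> real \<Rightarrow> real" where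
  "high_energy \<epsilon> cm cM L = (oscillation_length \<epsilon> cm cM / L)\<^sup>2"

text \<open>The value \<open>1\<close> for \<open>r = 0\<close> keeps the function positive. It occurs exactly when there is no eigenfunction
  to estimate, since then the infimum defining the minimal amplitude is \<open>\<infinity>\<close>, which
  \<open>real_of_ereal\<close> sends to \<open>0\<close>.\<close>

definition high_energy_mass :: "real \<Rightarrow> real \<Rightarrow> real \<Rightarrow> real \<Rightarrow> real \<Rightarrow> real" where
  "high_energy_mass \<epsilon> cm cM L r =
     (if 0 < r then L * (sqrt cm / 2) * r\<^sup>2 / (8 * oscillation_length \<epsilon> cm cM) else 1)"

lemma oscillation_length_pos: "0 < cm \<Longrightarrow> cm < cM \<Longrightarrow> 0 < \<epsilon> \<Longrightarrow> 0 < oscillation_length \<epsilon> cm cM"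
  by (simp add: oscillation_length_def add_nonneg_pos add_pos_nonneg)

lemma high_energy_mass_pos:
  "0 < cm \<Longrightarrow> cm < cM \<Longrightarrow> 0 < \<epsilon> \<Longrightarrow> 0 < L \<Longrightarrow> 0 < high_energy_mass \<epsilon> cm cM L r"
  using oscillation_length_pos[of cm cM \<epsilon>] by (simp add: high_energy_mass_def)

lemma eigenfunction_mass_eq:
  assumes u: "A_eigenfunction H c m lam u" and ab: "0 \<le> a" "b \<le> H"
  shows "(\<integral>y. (u y)\<^sup>2 \<partial>lebesgue_on {a<..<b}) = integral {a..b} (\<lambda>y. (u y)\<^sup>2)"
proof (intro integrable_open_interval(2) integrable_open_intervalI absolutely_integrable_continuous_real)
  have "continuous_on {0..H} u" using u by (simp add: A_eigenfunction_def)
  then show "continuous_on {a..b} (\<lambda>y. (u y)\<^sup>2)"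
    by (intro continuous_on_power) (rule continuous_on_subset, use ab in auto)
qed

lemma eigenfunction_mass_high:
  assumes H: "0 < H" and c: "0 < cm" "cm < cM" "0 < \<epsilon>" and \<mu>: "mono \<mu>" "0 < \<mu> 0"
    and ab: "0 \<le> a" "a < b" "b \<le> H"
    and cK: "c \<in> coeff_class_TV H cm cM V" and p: "(m, lam) \<in> A_pairs H \<mu> cM \<epsilon> c"
    and ef: "A_eigenfunction H c m lam u" and large: "high_energy \<epsilon> cm cM (b - a) < lam"
  shows "high_energy_mass \<epsilon> cm cM (b - a) (min_amplitude_TV H \<mu> cm cM \<epsilon> V)
    \<le> (\<integral>y. (u y)\<^sup>2 \<partial>lebesgue_on {a<..<b})"
proof -
  obtain q where fl: "flux H c u q" using flux_exists[OF H ef] by blast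
  note r = min_amplitude_TV_bound[OF H c \<mu> cK p ef fl]
  obtain f where S: "eigen_system H cm cM \<epsilon> m lam f u q"
    by (rule eigenpair_system[OF H c \<mu> cK p ef fl]) (rule that)
  interpret eigen_system H cm cM \<epsilon> m lam f u q by (rule S)
  show ?thesis
    using mass_high_energy[OF ab _ r(2)] large r(1)
    by (simp add: eigenfunction_mass_eq[OF ef ab(1,3)] high_energy_mass_def high_energy_def oscillation_length_def \<kappa>_def)
qed

text \<open>Eigenvalues above \<open>high_energy\<close> are covered by \<open>mass_high_energy\<close>; the others are bounded, so
  \<open>mass_low_energy\<close> covers them.\<close>

lemma eigenfunction_mass_uniform:
  assumes H: "0 < H" and c: "0 < cm" "cm < cM" "0 < \<epsilon>" and \<mu>: "mono \<mu>" "0 < \<mu> 0"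
    and ab: "0 \<le> a" "a < b" "b \<le> H"
  obtains d where "0 < d" "\<And>c m lam u. c \<in> coeff_class_TV H cm cM V \<Longrightarrow>
    (m, lam) \<in> A_pairs H \<mu> cM \<epsilon> c \<Longrightarrow> A_eigenfunction H c m lam u \<Longrightarrow>
    d \<le> (\<integral>y. (u y)\<^sup>2 \<partial>lebesgue_on {a<..<b})"
proof (cases "\<exists>c m lam u. c \<in> coeff_class_TV H cm cM V \<and> (m, lam) \<in> A_pairs H \<mu> cM \<epsilon> c \<and> A_eigenfunction H c m lam u")
  case False
  then show ?thesis by (intro that[of 1]) auto
next
  case True
  define r where "r = min_amplitude_TV H \<mu> cm cM \<epsilon> V"
  have r: "0 < r"
    using True flux_exists[OF H] min_amplitude_TV_bound(1)[OF H c \<mu>] unfolding r_def by metis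
  define \<Lambda> where "\<Lambda> = high_energy \<epsilon> cm cM (b - a)"
  have \<Lambda>: "0 < \<Lambda>"
    using oscillation_length_pos[OF c] ab by (simp add: \<Lambda>_def high_energy_def)
  define th where "th = min (r / 2) ((b - a) * r / (8 * cM))"
  have th: "0 < th" using r ab c by (simp add: th_def)
  define d1 where "d1 = min ((b - a) / 2) (th * cm / (2 * (\<Lambda> * (H + 1)))) * th\<^sup>2 / 4"
  have d1: "0 < d1" using th ab c \<Lambda> H by (simp add: d1_def)
  define d2 where "d2 = high_energy_mass \<epsilon> cm cM (b - a) r"
  have d2: "0 < d2" using high_energy_mass_pos[OF c] ab by (simp add: d2_def)
  show ?thesis
  proof (rule that[of "min d1 d2"])
    show "0 < min d1 d2" using d1 d2 by simp
    fix c m lam u assume cK: "c \<in> coeff_class_TV H cm cM V" and p: "(m, lam) \<in> A_pairs H \<mu> cM \<epsilon> c"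
      and ef: "A_eigenfunction H c m lam u"
    show "min d1 d2 \<le> (\<integral>y. (u y)\<^sup>2 \<partial>lebesgue_on {a<..<b})"
    proof (cases "\<Lambda> < lam")
      case True
      then show ?thesis
        using eigenfunction_mass_high[OF H assms(2-4) \<mu> ab cK p ef] by (simp add: \<Lambda>_def d2_def r_def)
    next
      case False
      obtain q where fl: "flux H c u q" using flux_exists[OF H ef] by blast
      note r2 = min_amplitude_TV_bound(2)[OF H assms(2-4) \<mu> cK p ef fl]
      obtain f where S: "eigen_system H cm cM \<epsilon> m lam f u q"
        by (rule eigenpair_system[OF H assms(2-4) \<mu> cK p ef fl]) (rule that)
      interpret eigen_system H cm cM \<epsilon> m lam f u q by (rule S)
      have "d1 \<le> integral {a..b} (\<lambda>x. (u x)\<^sup>2)"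
        using mass_low_energy[OF ab r, of \<Lambda>] r2 False by (simp add: d1_def th_def r_def)
      then show ?thesis by (simp add: eigenfunction_mass_eq[OF ef ab(1,3)])
    qed
  qed
qed

theorem theorem5p8:
  fixes \<Omega>' :: "(real ^ 'd) set" and H :: real
    and \<mu> :: "nat \<Rightarrow> real" and \<phi> :: "nat \<Rightarrow> real ^ 'd \<Rightarrow> real"
  assumes "smooth_bounded_domain \<Omega>'"
    and "0 < H"
    and "dirichlet_eigenbasis \<Omega>' \<mu> \<phi>"
  shows "(\<forall>cm cM \<epsilon> V. 0 < cm \<and> cm < cM \<and> 0 < \<epsilon> \<and> 0 < V \<longrightarrow>
      (\<forall>c\<in>coeff_class H cm cM. total_variation H c < \<infinity> \<longrightarrow> 0 < min_amplitude_sq H \<mu> cM \<epsilon> c) \<and>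
      0 < min_amplitude_TV_sq H \<mu> cm cM \<epsilon> V) \<and>
    (\<forall>cm cM \<epsilon> V a b. 0 < cm \<and> cm < cM \<and> 0 < \<epsilon> \<and> 0 < V \<and> 0 \<le> a \<and> a < b \<and> b \<le> H \<longrightarrow>
      0 < Inf {ereal (\<integral>y. (u y)\<^sup>2 \<partial>lebesgue_on {a<..<b}) |c m lam u.
            c \<in> coeff_class_TV H cm cM V \<and> (m, lam) \<in> A_pairs H \<mu> cM \<epsilon> c \<and> A_eigenfunction H c m lam u}) \<and>
    (\<exists>lam0 :: real \<Rightarrow> real \<Rightarrow> real \<Rightarrow> real \<Rightarrow> real.
      \<exists>\<ff> :: real \<Rightarrow> real \<Rightarrow> real \<Rightarrow> real \<Rightarrow> real \<Rightarrow> real.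
      \<forall>cm cM \<epsilon> V a b. 0 < cm \<and> cm < cM \<and> 0 < \<epsilon> \<and> 0 < V \<and> 0 \<le> a \<and> a < b \<and> b \<le> H \<longrightarrow>
        0 < \<ff> \<epsilon> cm cM (b - a) (min_amplitude_TV H \<mu> cm cM \<epsilon> V) \<and>
        (\<forall>c\<in>coeff_class_TV H cm cM V. \<forall>m lam u.
          (m, lam) \<in> A_pairs H \<mu> cM \<epsilon> c \<and> A_eigenfunction H c m lam u \<and> lam0 \<epsilon> cm cM (b - a) < lam \<longrightarrow>
          \<ff> \<epsilon> cm cM (b - a) (min_amplitude_TV H \<mu> cm cM \<epsilon> V)
            \<le> (\<integral>y. (u y)\<^sup>2 \<partial>lebesgue_on {a<..<b}))) \<and>
    (\<forall>cm cM \<epsilon> V a b \<omega>'. 0 < cm \<and> cm < cM \<and> 0 < \<epsilon> \<and> 0 < V \<and> 0 \<le> a \<and> a < b \<and> b \<le> H \<and>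
        \<omega>' \<subseteq> \<Omega>' \<and> \<omega>' \<noteq> {} \<and> open \<omega>' \<and>
        (\<omega>' \<noteq> \<Omega>' \<longrightarrow>
          0 < liminf (\<lambda>k. ereal ((L2_norm \<omega>' (\<phi> k))\<^sup>2 / (L2_norm \<Omega>' (\<phi> k))\<^sup>2))) \<longrightarrow>
      (\<exists>\<gg>>0. \<forall>c\<in>coeff_class_TV H cm cM V. \<forall>k lam u.
        (\<mu> k, lam) \<in> A_pairs H \<mu> cM \<epsilon> c \<and> A_eigenfunction H c (\<mu> k) lam u \<longrightarrow>
        (let v = (\<lambda>(x', y). u y * \<phi> k x')
         in \<gg> \<le> L2_norm (\<omega>' \<times> {a<..<b}) v / L2_norm (\<Omega>' \<times> {0<..<H}) v \<and>
            L2_norm (\<omega>' \<times> {a<..<b}) v / L2_norm (\<Omega>' \<times> {0<..<H}) v \<le> 1)))"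
proof -
  have \<mu>: "mono \<mu>" "0 < \<mu> 0" using assms(3) by (auto simp: dirichlet_eigenbasis_def)
  have \<Omega>: "open \<Omega>'" "connected \<Omega>'" "bounded \<Omega>'"
    using assms(1) by (auto simp: smooth_bounded_domain_def)
  have \<phi>: "\<And>k. square_integrable \<Omega>' (\<phi> k)" "\<And>k. L2_inner \<Omega>' (\<phi> k) (\<phi> k) = 1"
    "\<And>k. dirichlet_laplacian \<Omega>' (\<phi> k) (\<lambda>x. (\<mu> k)\<^sup>2 * \<phi> k x)"
    using assms(3) by (auto simp: dirichlet_eigenbasis_def L2_orthonormal_basis_def)
  note H = \<open>0 < H\<close>
  show ?thesis
  proof (intro conjI)
    show "\<forall>cm cM \<epsilon> V. 0 < cm \<and> cm < cM \<and> 0 < \<epsilon> \<and> 0 < V \<longrightarrow>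
      (\<forall>c\<in>coeff_class H cm cM. total_variation H c < \<infinity> \<longrightarrow> 0 < min_amplitude_sq H \<mu> cM \<epsilon> c) \<and>
      0 < min_amplitude_TV_sq H \<mu> cm cM \<epsilon> V"
    proof (intro allI impI conjI ballI)
      fix cm cM \<epsilon> V :: real assume h: "0 < cm \<and> cm < cM \<and> 0 < \<epsilon> \<and> 0 < V"
      then show "0 < min_amplitude_TV_sq H \<mu> cm cM \<epsilon> V" by (intro min_amplitude_TV_pos H \<mu>) auto
      fix c assume c: "c \<in> coeff_class H cm cM" and tv: "total_variation H c < \<infinity>"
      obtain W where "total_variation H c \<le> ereal W"
        using tv by (cases "total_variation H c") auto
      then have cK: "c \<in> coeff_class_TV H cm cM W" using c by (simp add: coeff_class_TV_def)
      have "0 < min_amplitude_TV_sq H \<mu> cm cM \<epsilon> W" by (intro min_amplitude_TV_pos H \<mu>) (use h in auto)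
      also have "\<dots> \<le> min_amplitude_sq H \<mu> cM \<epsilon> c"
        unfolding min_amplitude_TV_sq_def by (rule INF_lower[OF cK])
      finally show "0 < min_amplitude_sq H \<mu> cM \<epsilon> c" .
    qed
    show "\<forall>cm cM \<epsilon> V a b. 0 < cm \<and> cm < cM \<and> 0 < \<epsilon> \<and> 0 < V \<and> 0 \<le> a \<and> a < b \<and> b \<le> H \<longrightarrow>
      0 < Inf {ereal (\<integral>y. (u y)\<^sup>2 \<partial>lebesgue_on {a<..<b}) |c m lam u.
            c \<in> coeff_class_TV H cm cM V \<and> (m, lam) \<in> A_pairs H \<mu> cM \<epsilon> c \<and> A_eigenfunction H c m lam u}"
    proof (intro allI impI)
      fix cm cM \<epsilon> V a b :: real
      assume h: "0 < cm \<and> cm < cM \<and> 0 < \<epsilon> \<and> 0 < V \<and> 0 \<le> a \<and> a < b \<and> b \<le> H"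
      obtain d where d: "0 < d" "\<And>c m lam u. c \<in> coeff_class_TV H cm cM V \<Longrightarrow>
          (m, lam) \<in> A_pairs H \<mu> cM \<epsilon> c \<Longrightarrow> A_eigenfunction H c m lam u \<Longrightarrow>
          d \<le> (\<integral>y. (u y)\<^sup>2 \<partial>lebesgue_on {a<..<b})"
        using eigenfunction_mass_uniform[OF H _ _ _ \<mu>, of cm cM \<epsilon> a b V] h by blast
      have "ereal d \<le> Inf {ereal (\<integral>y. (u y)\<^sup>2 \<partial>lebesgue_on {a<..<b}) |c m lam u.
            c \<in> coeff_class_TV H cm cM V \<and> (m, lam) \<in> A_pairs H \<mu> cM \<epsilon> c \<and> A_eigenfunction H c m lam u}"
        by (rule Inf_greatest) (use d(2) in auto)
      with d(1) show "0 < Inf {ereal (\<integral>y. (u y)\<^sup>2 \<partial>lebesgue_on {a<..<b}) |c m lam u.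
            c \<in> coeff_class_TV H cm cM V \<and> (m, lam) \<in> A_pairs H \<mu> cM \<epsilon> c \<and> A_eigenfunction H c m lam u}"
        by (metis (no_types, lifting) ereal_less(2) less_le_trans)
    qed
    show "\<exists>lam0 :: real \<Rightarrow> real \<Rightarrow> real \<Rightarrow> real \<Rightarrow> real.
      \<exists>\<ff> :: real \<Rightarrow> real \<Rightarrow> real \<Rightarrow> real \<Rightarrow> real \<Rightarrow> real.
      \<forall>cm cM \<epsilon> V a b. 0 < cm \<and> cm < cM \<and> 0 < \<epsilon> \<and> 0 < V \<and> 0 \<le> a \<and> a < b \<and> b \<le> H \<longrightarrow>
        0 < \<ff> \<epsilon> cm cM (b - a) (min_amplitude_TV H \<mu> cm cM \<epsilon> V) \<and>
        (\<forall>c\<in>coeff_class_TV H cm cM V. \<forall>m lam u.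
          (m, lam) \<in> A_pairs H \<mu> cM \<epsilon> c \<and> A_eigenfunction H c m lam u \<and> lam0 \<epsilon> cm cM (b - a) < lam \<longrightarrow>
          \<ff> \<epsilon> cm cM (b - a) (min_amplitude_TV H \<mu> cm cM \<epsilon> V)
            \<le> (\<integral>y. (u y)\<^sup>2 \<partial>lebesgue_on {a<..<b}))"
    proof (rule exI[of _ high_energy], rule exI[of _ high_energy_mass], intro allI impI conjI ballI)
      fix cm cM \<epsilon> V a b :: real
      assume h: "0 < cm \<and> cm < cM \<and> 0 < \<epsilon> \<and> 0 < V \<and> 0 \<le> a \<and> a < b \<and> b \<le> H"
      then show "0 < high_energy_mass \<epsilon> cm cM (b - a) (min_amplitude_TV H \<mu> cm cM \<epsilon> V)"
        by (intro high_energy_mass_pos) auto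
      fix c m lam u assume "c \<in> coeff_class_TV H cm cM V"
        and "(m, lam) \<in> A_pairs H \<mu> cM \<epsilon> c \<and> A_eigenfunction H c m lam u \<and> high_energy \<epsilon> cm cM (b - a) < lam"
      then show "high_energy_mass \<epsilon> cm cM (b - a) (min_amplitude_TV H \<mu> cm cM \<epsilon> V)
          \<le> (\<integral>y. (u y)\<^sup>2 \<partial>lebesgue_on {a<..<b})"
        using h by (intro eigenfunction_mass_high[OF H _ _ _ \<mu>]) auto
    qed
    show "\<forall>cm cM \<epsilon> V a b \<omega>'. 0 < cm \<and> cm < cM \<and> 0 < \<epsilon> \<and> 0 < V \<and> 0 \<le> a \<and> a < b \<and> b \<le> H \<and>
        \<omega>' \<subseteq> \<Omega>' \<and> \<omega>' \<noteq> {} \<and> open \<omega>' \<and>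
        (\<omega>' \<noteq> \<Omega>' \<longrightarrow>
          0 < liminf (\<lambda>k. ereal ((L2_norm \<omega>' (\<phi> k))\<^sup>2 / (L2_norm \<Omega>' (\<phi> k))\<^sup>2))) \<longrightarrow>
      (\<exists>\<gg>>0. \<forall>c\<in>coeff_class_TV H cm cM V. \<forall>k lam u.
        (\<mu> k, lam) \<in> A_pairs H \<mu> cM \<epsilon> c \<and> A_eigenfunction H c (\<mu> k) lam u \<longrightarrow>
        (let v = (\<lambda>(x', y). u y * \<phi> k x')
         in \<gg> \<le> L2_norm (\<omega>' \<times> {a<..<b}) v / L2_norm (\<Omega>' \<times> {0<..<H}) v \<and>
            L2_norm (\<omega>' \<times> {a<..<b}) v / L2_norm (\<Omega>' \<times> {0<..<H}) v \<le> 1))"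
    proof (intro allI impI)
      fix cm cM \<epsilon> V a b :: real and \<omega>' :: "(real ^ 'd) set"
      assume h: "0 < cm \<and> cm < cM \<and> 0 < \<epsilon> \<and> 0 < V \<and> 0 \<le> a \<and> a < b \<and> b \<le> H \<and>
        \<omega>' \<subseteq> \<Omega>' \<and> \<omega>' \<noteq> {} \<and> open \<omega>' \<and>
        (\<omega>' \<noteq> \<Omega>' \<longrightarrow>
          0 < liminf (\<lambda>k. ereal ((L2_norm \<omega>' (\<phi> k))\<^sup>2 / (L2_norm \<Omega>' (\<phi> k))\<^sup>2)))"
      then have \<omega>: "open \<omega>'" "\<omega>' \<noteq> {}" "\<omega>' \<subseteq> \<Omega>'" by auto
      have N1: "L2_norm \<Omega>' (\<phi> k) = 1" for k by (simp add: L2_norm_def \<phi>(2))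
      note M = L2_inner_mono_set[OF \<phi>(1) \<omega>(3) \<Omega>(1) \<omega>(1)]
      have sq: "(L2_norm \<omega>' (\<phi> k))\<^sup>2 = L2_inner \<omega>' (\<phi> k) (\<phi> k)" for k using M(2) by (simp add: L2_norm_def)
      have pos: "0 < L2_inner \<omega>' (\<phi> k) (\<phi> k)" for k
        by (rule dirichlet_eigenfunction_mass_pos[OF \<Omega> \<phi>(3) _ \<omega>]) (simp add: \<phi>(2))
      obtain e where e: "0 < e" "\<And>k. e \<le> L2_inner \<omega>' (\<phi> k) (\<phi> k)"
      proof (cases "\<omega>' = \<Omega>'")
        case True
        then show ?thesis using that[of 1] \<phi>(2) by simp
      next
        case False
        then have "0 < liminf (\<lambda>k. ereal (L2_inner \<omega>' (\<phi> k) (\<phi> k)))" using h by (simp add: N1 sq)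
        then show ?thesis using pos that by (rule eventually_and_pointwise_pos_imp_uniform)
      qed
      obtain d where d: "0 < d" "\<And>c m lam u. c \<in> coeff_class_TV H cm cM V \<Longrightarrow>
          (m, lam) \<in> A_pairs H \<mu> cM \<epsilon> c \<Longrightarrow> A_eigenfunction H c m lam u \<Longrightarrow>
          d \<le> (\<integral>y. (u y)\<^sup>2 \<partial>lebesgue_on {a<..<b})"
        using eigenfunction_mass_uniform[OF H _ _ _ \<mu>, of cm cM \<epsilon> a b V] h by blast
      \<comment> \<open>Both norms of \<open>v\<close> factorize, and the one over the whole domain is \<open>1\<close>.\<close>
      have main: "sqrt e * sqrt d \<le> L2_norm (\<omega>' \<times> {a<..<b}) v / L2_norm (\<Omega>' \<times> {0<..<H}) v \<and>
            L2_norm (\<omega>' \<times> {a<..<b}) v / L2_norm (\<Omega>' \<times> {0<..<H}) v \<le> 1"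
        if cK: "c \<in> coeff_class_TV H cm cM V" and p: "(\<mu> k, lam) \<in> A_pairs H \<mu> cM \<epsilon> c"
          and u: "A_eigenfunction H c (\<mu> k) lam u" and v: "v = (\<lambda>(x', y). u y * \<phi> k x')" for c k lam u v
      proof -
        have us: "square_integrable {0<..<H} u" and un: "L2_norm {0<..<H} u = 1"
          using u by (auto simp: A_eigenfunction_def A_op_def H10_gradient_def H1_gradient_def)
        have "{a<..<b} \<subseteq> {0<..<H}" using h by auto
        note Mu = L2_inner_mono_set[OF us this open_greaterThanLessThan open_greaterThanLessThan]
        have um: "u \<in> borel_measurable (lebesgue_on {0<..<H})" and \<phi>m: "\<phi> k \<in> borel_measurable (lebesgue_on \<Omega>')"
          using us \<phi>(1) by (auto simp: square_integrable_def)
        have "L2_norm (\<Omega>' \<times> {0<..<H}) v = 1"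
          using L2_norm_product[OF \<Omega>(1) \<phi>m open_greaterThanLessThan um] N1 un by (simp add: v)
        moreover have "L2_norm (\<omega>' \<times> {a<..<b}) v = L2_norm \<omega>' (\<phi> k) * L2_norm {a<..<b} u"
          using L2_norm_product[OF \<omega>(1) M(1) open_greaterThanLessThan Mu(1)] by (simp add: v)
        moreover have "sqrt e \<le> L2_norm \<omega>' (\<phi> k)" using e(2)[of k] by (simp add: L2_norm_def)
        moreover have "sqrt d \<le> L2_norm {a<..<b} u"
          using d(2)[OF cK p u] by (simp add: L2_norm_def L2_inner_def power2_eq_square)
        moreover have "L2_norm \<omega>' (\<phi> k) \<le> 1" using M(3)[of k] \<phi>(2)[of k] by (simp add: L2_norm_def)
        moreover have "L2_norm {a<..<b} u \<le> 1" using Mu(3) un by (simp add: L2_norm_def)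
        moreover have "0 \<le> L2_norm \<omega>' (\<phi> k)" "0 \<le> L2_norm {a<..<b} u"
          using M(2) Mu(2) by (auto simp: L2_norm_def)
        ultimately show ?thesis using e(1) d(1) by (auto intro: mult_mono mult_le_one)
      qed
      show "\<exists>\<gg>>0. \<forall>c\<in>coeff_class_TV H cm cM V. \<forall>k lam u.
        (\<mu> k, lam) \<in> A_pairs H \<mu> cM \<epsilon> c \<and> A_eigenfunction H c (\<mu> k) lam u \<longrightarrow>
        (let v = (\<lambda>(x', y). u y * \<phi> k x')
         in \<gg> \<le> L2_norm (\<omega>' \<times> {a<..<b}) v / L2_norm (\<Omega>' \<times> {0<..<H}) v \<and>
            L2_norm (\<omega>' \<times> {a<..<b}) v / L2_norm (\<Omega>' \<times> {0<..<H}) v \<le> 1)"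
      proof (intro exI[of _ "sqrt e * sqrt d"] conjI ballI allI impI)
        show "0 < sqrt e * sqrt d" using e(1) d(1) by simp
        fix c k lam u assume "c \<in> coeff_class_TV H cm cM V"
          and "(\<mu> k, lam) \<in> A_pairs H \<mu> cM \<epsilon> c \<and> A_eigenfunction H c (\<mu> k) lam u"
        then show "let v = (\<lambda>(x', y). u y * \<phi> k x')
         in sqrt e * sqrt d \<le> L2_norm (\<omega>' \<times> {a<..<b}) v / L2_norm (\<Omega>' \<times> {0<..<H}) v \<and>
            L2_norm (\<omega>' \<times> {a<..<b}) v / L2_norm (\<Omega>' \<times> {0<..<H}) v \<le> 1"
          unfolding Let_def by (intro main[OF _ _ _ refl]) auto
      qed
    qed
  qed
qed

end
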